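(* Let $M$ be a finite-dimensional manifold with a formal deformation, to lowest order in $\hbar$, of its differential calculus (see context) whose Poisson bracket is nondegenerate (symplectic), and let $\nabla$ be the associated connection. If the curvature of $\nabla$ vanishes and the tensor $E^{nk}{}_{li}=\omega^{jn}N^k_{jil}$ is covariantly constant with respect to $\nabla$, then the obstruction $J_2$ to the second super Jacobi identity vanishes.
   Context: $\Omega^n(M)$ denotes the $n$-forms on $M$, $\Omega^0(M)=C^\infty(M)$. A formal deformation of the differential calculus on $M$ to lowest order in $\hbar$ consists of the following maps depending on a parameter $\hbar$ and admitting power series expansions in $\hbar$ (extended linearly in $\hbar$; $O(\hbar^k)$ denotes terms of order at least $k$ in $\hbar$): (i) an associative product $\bullet$ on $C^\infty(M)$ with $x\bullet y=xy+O(\hbar)$ and $x\bullet y-y\bullet x=\hbar\{x,y\}+O(\hbar^2)$ (so $\{\ ,\ \}$ is a Poisson bracket); (ii) products $x\bullet\tau$ and $\tau\bullet x$ for $x\in C^\infty(M)$, $\tau\in\Omega^1(M)$, both equal to $x\tau+O(\hbar)$, making $\Omega^1(M)$ a bimodule to order $O(\hbar^2)$: $(x\bullet y)\bullet\tau-x\bullet(y\bullet\tau)=O(\hbar^2)$, $\tau\bullet(x\bullet y)-(\tau\bullet x)\bullet y=O(\hbar^2)$, $(x\bullet\tau)\bullet y-x\bullet(\tau\bullet y)=O(\hbar^2)$; (iii) a deformed exterior product $\wedge_\bullet$ on forms, with $\tau\wedge_\bullet\eta=\tau\wedge\eta+O(\hbar)$, associative to $O(\hbar^2)$ (written $\bullet$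 when one of the factors is a function); (iv) an operator $\mathrm{d}^\bullet:\Omega^n(M)\to\Omega^{n+1}(M)$ with $\mathrm{d}^\bullet=\mathrm{d}+O(\hbar)$ which is a graded derivation to order $O(\hbar^2)$: $\mathrm{d}^\bullet(\xi\wedge_\bullet\eta)=\mathrm{d}^\bullet\xi\wedge_\bullet\eta+(-1)^{\deg\xi}\xi\wedge_\bullet\mathrm{d}^\bullet\eta+O(\hbar^2)$. $[\xi,\eta]_\bullet=\xi\wedge_\bullet\eta-(-1)^{\deg\xi\deg\eta}\eta\wedge_\bullet\xi$ is the super-commutator. The map $\gamma$ is defined by $[x,\tau]_\bullet=\hbar\gamma(x,\tau)+O(\hbar^2)$. $J_2:C^\infty(M)^{\otimes3}\to\Omega^2(M)$ is defined by $[x,[\mathrm{d}y,\mathrm{d}z]_\bullet]_\bullet-[\mathrm{d}z,[x,\mathrm{d}y]_\bullet]_\bullet+[\mathrm{d}y,[\mathrm{d}z,x]_\bullet]_\bullet=\hbar^2J_2(x,y,z)+O(\hbar^3)$. In local coordinates $\{y,z\}=\omega^{ij}\frac{\partial y}{\partial x^i}\frac{\partial z}{\partial x^j}$ with $(\omega^{ij})$ invertible. The associated connection $\nabla$ is the unique covariant connection on $1$-forms (extended to all tensors) with $\gamma(y,\tau)=\nabla_{\hat y}\tau=\omega^{kq}\frac{\partial y}{\partial x^k}\nabla_q\tau$, $\hat y=\{y,-\}$. Conventions: $(\nabla_VW)^l=V^k(W^l{}_{,k}+\Gamma^l_{ki}W^i)$, $\nabla_q(a_n\mathrm{d}x^n)=(\partial_qa_n-\Gamma^i_{qn}a_i)\mathrm{d}x^n$,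 $T^k_{ij}=\Gamma^k_{ij}-\Gamma^k_{ji}$, $R(U,V)(W)=\nabla_U\nabla_VW-\nabla_V\nabla_UW-\nabla_{[U,V]}W$, $R(U,V)(W)^l=R^l{}_{ijk}W^iU^jV^k$. A semicolon denotes covariant differentiation (e.g. $T^k_{ji;l}$ is the component of $\nabla_lT$). Finally $$N^k_{jil}=T^k_{ji;l}+\tfrac12R^k{}_{jli}+T^n_{jl}T^k_{in}+\tfrac12T^n_{li}T^k_{jn}.$$ *)

theory Defs
  imports "HOL-Analysis.Analysis" "HOL-Library.Function_Algebras"
begin

section \<open>Smooth manifolds\<close>

primrec Ck_on :: "nat \<Rightarrow> 'a::real_normed_vector set \<Rightarrow> ('a \<Rightarrow> 'b::real_normed_vector) \<Rightarrow> bool" where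
  "Ck_on 0 S f \<longleftrightarrow> continuous_on S f"
| "Ck_on (Suc k) S f \<longleftrightarrow> (\<forall>x\<in>S. f differentiable (at x)) \<and>
     (\<forall>v. Ck_on k S (\<lambda>x. frechet_derivative f (at x) v))"

definition smooth_on :: "'a::real_normed_vector set \<Rightarrow> ('a \<Rightarrow> 'b::real_normed_vector) \<Rightarrow> bool" where
  "smooth_on S f \<longleftrightarrow> (\<forall>k. Ck_on k S f)"

type_synonym ('m, 'n) chart = "'m set \<times> ('m \<Rightarrow> real ^ 'n)"

abbreviation dom_of :: "('m, 'n) chart \<Rightarrow> 'm set" where "dom_of \<equiv> fst"

abbreviation coord :: "('m, 'n::finite) chart \<Rightarrow> 'n \<Rightarrow> 'm \<Rightarrow> real" where
  "coord c i \<equiv> (\<lambda>p. snd c p $ i)"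

definition chart_inv :: "('m, 'n) chart \<Rightarrow> real ^ 'n \<Rightarrow> 'm" where
  "chart_inv c = inv_into (fst c) (snd c)"

text \<open>The manifold is the whole type; its dimension is the cardinality of the index type.
  Atlases need not be maximal.\<close>

definition smooth_atlas ::
    "('m::{t2_space,second_countable_topology}, 'n::finite) chart set \<Rightarrow> bool" where
  "smooth_atlas A \<longleftrightarrow>
     (\<Union>c\<in>A. dom_of c) = UNIV \<and>
     (\<forall>c\<in>A. open (dom_of c) \<and> open (snd c ` dom_of c) \<and>
        homeomorphism (dom_of c) (snd c ` dom_of c) (snd c) (chart_inv c)) \<and>
     (\<forall>c\<in>A. \<forall>c'\<in>A. smooth_on (snd c ` (dom_of c \<inter> dom_of c')) (snd c' \<circ> chart_inv c))"

definition smooth_in_chart :: "('m, 'n::finite) chart \<Rightarrow> ('m \<Rightarrow> real) \<Rightarrow> bool" where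
  "smooth_in_chart c f \<longleftrightarrow> smooth_on (snd c ` dom_of c) (f \<circ> chart_inv c)"

definition smooth_functions :: "('m, 'n::finite) chart set \<Rightarrow> ('m \<Rightarrow> real) set" where
  "smooth_functions A = {f. \<forall>c\<in>A. smooth_in_chart c f}"

text \<open>The coordinate derivative \<open>\<partial>f/\<partial>x\<^sup>i\<close> in the chart \<open>c\<close>, as a function on the manifold.\<close>

definition pd :: "('m, 'n::finite) chart \<Rightarrow> 'n \<Rightarrow> ('m \<Rightarrow> real) \<Rightarrow> 'm \<Rightarrow> real" where
  "pd c i f p =
     (if p \<in> dom_of c then frechet_derivative (f \<circ> chart_inv c) (at (snd c p)) (axis i 1) else 0)"


section \<open>Differential forms\<close>

text \<open>A form is given by its components in the charts of the atlas: \<open>\<tau> c [i\<^sub>1,\<dots>,i\<^sub>n] p\<close> is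
  \<open>\<tau>(\<partial>/\<partial>x\<^bsup>i\<^sub>1\<^esup>,\<dots>,\<partial>/\<partial>x\<^bsup>i\<^sub>n\<^esup>)\<close> at \<open>p\<close>, so that a one-form is \<open>\<Sum>i. \<tau> c [i] dx\<^sup>i\<close>. Components are set to
  zero off the atlas, off the chart domain and for index lists of the wrong length, so that
  equality in HOL is equality of forms, and addition is the pointwise one of
  Function_Algebras. The pointwise multiplication of that theory is only used below to multiply
  by the constants 1 and -1.\<close>

type_synonym ('m, 'n) form = "('m, 'n) chart \<Rightarrow> 'n list \<Rightarrow> 'm \<Rightarrow> real"

definition forms :: "('m, 'n::finite) chart set \<Rightarrow> nat \<Rightarrow> ('m, 'n) form set" where
  "forms A n = {\<tau>.
     (\<forall>c I p. \<not> (c \<in> A \<and> p \<in> dom_of c \<and> length I = n) \<longrightarrow> \<tau> c I p = 0) \<and>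
     (\<forall>c\<in>A. \<forall>I. smooth_in_chart c (\<tau> c I)) \<and>
     (\<forall>c I p a b. a < length I \<and> b < length I \<and> a \<noteq> b \<longrightarrow>
        \<tau> c (I[a := I ! b, b := I ! a]) p = - \<tau> c I p) \<and>
     (\<forall>c\<in>A. \<forall>c'\<in>A. \<forall>p \<in> dom_of c \<inter> dom_of c'. \<forall>I.
        \<tau> c' I p =
          (\<Sum>J | length J = length I.
             (\<Prod>a<length I. pd c' (I ! a) (coord c (J ! a)) p) * \<tau> c J p))}"

definition of_fun :: "('m, 'n::finite) chart set \<Rightarrow> ('m \<Rightarrow> real) \<Rightarrow> ('m, 'n) form" where
  "of_fun A f = (\<lambda>c I p. if c \<in> A \<and> p \<in> dom_of c \<and> I = [] then f p else 0)"

definition scale :: "real \<Rightarrow> ('m, 'n) form \<Rightarrow> ('m, 'n) form" where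
  "scale r \<tau> = (\<lambda>c I p. r * \<tau> c I p)"

text \<open>The sum runs over all shuffles: \<open>S\<close> is the set of positions of \<open>I\<close> handed to \<open>\<tau>\<close>. The sign
  counts inversions. For homogeneous forms only sets \<open>S\<close> of cardinality \<open>deg \<tau>\<close> contribute.\<close>

definition shuffle_sign :: "nat \<Rightarrow> nat set \<Rightarrow> real" where
  "shuffle_sign n S = (-1) ^ card {(a, b). a \<in> S \<and> b < n \<and> b \<notin> S \<and> b < a}"

definition wedge :: "('m, 'n) form \<Rightarrow> ('m, 'n) form \<Rightarrow> ('m, 'n) form" where
  "wedge \<tau> \<eta> = (\<lambda>c I p. \<Sum>S \<in> Pow {..<length I}.
     shuffle_sign (length I) S * \<tau> c (nths I S) p * \<eta> c (nths I (- S)) p)"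

definition ext_d :: "('m, 'n::finite) form \<Rightarrow> ('m, 'n) form" where
  "ext_d \<tau> = (\<lambda>c I p. \<Sum>a<length I.
     (-1) ^ a * pd c (I ! a) (\<tau> c (take a I @ drop (Suc a) I)) p)"


section \<open>Deformations of the differential calculus\<close>

text \<open>Power series in \<open>\<hbar>\<close> with coefficients in forms are elements of \<open>('m, 'n) form fps\<close>. The
  deformed product and differential are given by their coefficient maps: \<open>P k\<close> and \<open>D k\<close> are the
  coefficients of \<open>\<hbar>\<^sup>k\<close>, and \<open>prod_h P\<close>, \<open>d_h D\<close> are the \<open>\<hbar>\<close>-linear extensions.\<close>

type_synonym ('m, 'n) prod_coeffs = "nat \<Rightarrow> ('m, 'n) form \<Rightarrow> ('m, 'n) form \<Rightarrow> ('m, 'n) form"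

type_synonym ('m, 'n) diff_coeffs = "nat \<Rightarrow> ('m, 'n) form \<Rightarrow> ('m, 'n) form"

definition prod_h ::
    "('m, 'n) prod_coeffs \<Rightarrow> ('m, 'n) form fps \<Rightarrow> ('m, 'n) form fps \<Rightarrow> ('m, 'n) form fps" where
  "prod_h P \<xi> \<eta> = Abs_fps (\<lambda>n. \<Sum>i\<le>n. \<Sum>j\<le>n - i. P (n - i - j) (fps_nth \<xi> i) (fps_nth \<eta> j))"

definition d_h :: "('m, 'n) diff_coeffs \<Rightarrow> ('m, 'n) form fps \<Rightarrow> ('m, 'n) form fps" where
  "d_h D \<xi> = Abs_fps (\<lambda>n. \<Sum>i\<le>n. D (n - i) (fps_nth \<xi> i))"

definition is_O_h :: "nat \<Rightarrow> ('m, 'n) form fps \<Rightarrow> bool" where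
  "is_O_h k \<xi> \<longleftrightarrow> (\<forall>j<k. fps_nth \<xi> j = 0)"

text \<open>The axioms for functions are those for 0-forms (cf. \<open>forms_0\<close> below); in particular the
  axiom \<open>assoc_forms\<close> contains the three bimodule conditions for one-forms, and \<open>prod_0\<close> covers
  the classical limits of the products of functions with functions and with forms.\<close>

locale formal_deformation =
  fixes A :: "('m::{t2_space,second_countable_topology}, 'n::finite) chart set"
    and P :: "('m, 'n) prod_coeffs"
    and D :: "('m, 'n) diff_coeffs"
  assumes prod_forms: "\<lbrakk>\<tau> \<in> forms A p; \<eta> \<in> forms A q\<rbrakk> \<Longrightarrow> P k \<tau> \<eta> \<in> forms A (p + q)"
    and prod_add_left: "\<lbrakk>\<tau> \<in> forms A p; \<tau>' \<in> forms A p; \<eta> \<in> forms A q\<rbrakk> \<Longrightarrow>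
      P k (\<tau> + \<tau>') \<eta> = P k \<tau> \<eta> + P k \<tau>' \<eta>"
    and prod_add_right: "\<lbrakk>\<tau> \<in> forms A p; \<eta> \<in> forms A q; \<eta>' \<in> forms A q\<rbrakk> \<Longrightarrow>
      P k \<tau> (\<eta> + \<eta>') = P k \<tau> \<eta> + P k \<tau> \<eta>'"
    and prod_scale_left: "\<lbrakk>\<tau> \<in> forms A p; \<eta> \<in> forms A q\<rbrakk> \<Longrightarrow>
      P k (scale r \<tau>) \<eta> = scale r (P k \<tau> \<eta>)"
    and prod_scale_right: "\<lbrakk>\<tau> \<in> forms A p; \<eta> \<in> forms A q\<rbrakk> \<Longrightarrow>
      P k \<tau> (scale r \<eta>) = scale r (P k \<tau> \<eta>)"
    and prod_0: "\<lbrakk>\<tau> \<in> forms A p; \<eta> \<in> forms A q\<rbrakk> \<Longrightarrow> P 0 \<tau> \<eta> = wedge \<tau> \<eta>"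
    and assoc_functions: "\<lbrakk>x \<in> forms A 0; y \<in> forms A 0; z \<in> forms A 0\<rbrakk> \<Longrightarrow>
      prod_h P (prod_h P (fps_const x) (fps_const y)) (fps_const z) =
      prod_h P (fps_const x) (prod_h P (fps_const y) (fps_const z))"
    and assoc_forms: "\<lbrakk>\<xi> \<in> forms A p; \<eta> \<in> forms A q; \<zeta> \<in> forms A r\<rbrakk> \<Longrightarrow>
      is_O_h 2 (prod_h P (prod_h P (fps_const \<xi>) (fps_const \<eta>)) (fps_const \<zeta>) -
                prod_h P (fps_const \<xi>) (prod_h P (fps_const \<eta>) (fps_const \<zeta>)))"
    and d_forms: "\<tau> \<in> forms A p \<Longrightarrow> D k \<tau> \<in> forms A (Suc p)"
    and d_add: "\<lbrakk>\<tau> \<in> forms A p; \<tau>' \<in> forms A p\<rbrakk> \<Longrightarrow> D k (\<tau> + \<tau>') = D k \<tau> + D k \<tau>'"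
    and d_scale: "\<tau> \<in> forms A p \<Longrightarrow> D k (scale r \<tau>) = scale r (D k \<tau>)"
    and d_0: "\<tau> \<in> forms A p \<Longrightarrow> D 0 \<tau> = ext_d \<tau>"
    and d_derivation: "\<lbrakk>\<xi> \<in> forms A p; \<eta> \<in> forms A q\<rbrakk> \<Longrightarrow>
      is_O_h 2 (d_h D (prod_h P (fps_const \<xi>) (fps_const \<eta>)) -
        (prod_h P (d_h D (fps_const \<xi>)) (fps_const \<eta>) +
         (-1) ^ p * prod_h P (fps_const \<xi>) (d_h D (fps_const \<eta>))))"

text \<open>The super-commutator of \<open>\<xi>\<close> of degree \<open>p\<close> and \<open>\<eta>\<close> of degree \<open>q\<close>.\<close>

definition scomm :: "('m, 'n) prod_coeffs \<Rightarrow> nat \<Rightarrow> nat \<Rightarrow>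
    ('m, 'n) form fps \<Rightarrow> ('m, 'n) form fps \<Rightarrow> ('m, 'n) form fps" where
  "scomm P p q \<xi> \<eta> = prod_h P \<xi> \<eta> - (-1) ^ (p * q) * prod_h P \<eta> \<xi>"

text \<open>The next three maps are leading coefficients: the super-commutators are \<open>O(\<hbar>)\<close>, and the
  Jacobi expression is \<open>O(\<hbar>\<^sup>2)\<close>, since the undeformed product is graded commutative.\<close>

definition poisson :: "('m, 'n) prod_coeffs \<Rightarrow> ('m, 'n) form \<Rightarrow> ('m, 'n) form \<Rightarrow> ('m, 'n) form" where
  "poisson P x y = fps_nth (scomm P 0 0 (fps_const x) (fps_const y)) 1"

definition gamma :: "('m, 'n) prod_coeffs \<Rightarrow> ('m, 'n) form \<Rightarrow> ('m, 'n) form \<Rightarrow> ('m, 'n) form" where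
  "gamma P x \<tau> = fps_nth (scomm P 0 1 (fps_const x) (fps_const \<tau>)) 1"

definition J2 :: "('m, 'n::finite) prod_coeffs \<Rightarrow>
    ('m, 'n) form \<Rightarrow> ('m, 'n) form \<Rightarrow> ('m, 'n) form \<Rightarrow> ('m, 'n) form" where
  "J2 P x y z =
     (let X = fps_const x; dY = fps_const (ext_d y); dZ = fps_const (ext_d z)
      in fps_nth
          (scomm P 0 2 X (scomm P 1 1 dY dZ)
           - scomm P 1 1 dZ (scomm P 0 1 X dY)
           + scomm P 1 1 dY (scomm P 1 0 dZ X)) 2)"

text \<open>\<open>\<omega> c i j\<close> is \<open>\<omega>\<^bsup>ij\<^esup>\<close> in the chart \<open>c\<close>.\<close>

type_synonym ('m, 'n) bivector = "('m, 'n) chart \<Rightarrow> 'n \<Rightarrow> 'n \<Rightarrow> 'm \<Rightarrow> real"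

definition poisson_components ::
    "('m, 'n::finite) chart set \<Rightarrow> ('m, 'n) prod_coeffs \<Rightarrow> ('m, 'n) bivector \<Rightarrow> bool" where
  "poisson_components A P \<omega> \<longleftrightarrow>
     (\<forall>y\<in>forms A 0. \<forall>z\<in>forms A 0. \<forall>c\<in>A. \<forall>p\<in>dom_of c.
        poisson P y z c [] p =
          (\<Sum>i\<in>UNIV. \<Sum>j\<in>UNIV. \<omega> c i j p * pd c i (y c []) p * pd c j (z c []) p))"

definition nondegenerate :: "('m, 'n::finite) chart set \<Rightarrow> ('m, 'n) bivector \<Rightarrow> bool" where
  "nondegenerate A \<omega> \<longleftrightarrow> (\<forall>c\<in>A. \<forall>p\<in>dom_of c. invertible (\<chi> i j. \<omega> c i j p))"


section \<open>Connections\<close>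

text \<open>\<open>\<Gamma> c k i j\<close> is \<open>\<Gamma>\<^sup>k\<^bsub>ij\<^esub>\<close> in the chart \<open>c\<close>, with \<open>i\<close> the direction of differentiation. A connection
  is a smooth family of Christoffel symbols with the inhomogeneous transformation law.\<close>

type_synonym ('m, 'n) christoffel = "('m, 'n) chart \<Rightarrow> 'n \<Rightarrow> 'n \<Rightarrow> 'n \<Rightarrow> 'm \<Rightarrow> real"

definition is_connection :: "('m, 'n::finite) chart set \<Rightarrow> ('m, 'n) christoffel \<Rightarrow> bool" where
  "is_connection A \<Gamma> \<longleftrightarrow>
     (\<forall>c\<in>A. \<forall>k i j. smooth_in_chart c (\<Gamma> c k i j)) \<and>
     (\<forall>c\<in>A. \<forall>c'\<in>A. \<forall>p \<in> dom_of c \<inter> dom_of c'. \<forall>k i j.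
        \<Gamma> c' k i j p =
          (\<Sum>l\<in>UNIV. pd c l (coord c' k) p *
             (pd c' i (pd c' j (coord c l)) p +
              (\<Sum>m\<in>UNIV. \<Sum>n\<in>UNIV.
                 pd c' i (coord c m) p * pd c' j (coord c n) p * \<Gamma> c l m n p))))"

text \<open>\<open>\<nabla>\<^sub>q\<close> on tensor components \<open>t U L\<close> with list of upper indices \<open>U\<close> and list of lower
  indices \<open>L\<close>.\<close>

definition cov_deriv :: "('m, 'n::finite) christoffel \<Rightarrow> ('m, 'n) chart \<Rightarrow> 'n \<Rightarrow>
    ('n list \<Rightarrow> 'n list \<Rightarrow> 'm \<Rightarrow> real) \<Rightarrow> 'n list \<Rightarrow> 'n list \<Rightarrow> 'm \<Rightarrow> real" where
  "cov_deriv \<Gamma> c q t U L p =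
     pd c q (t U L) p
     + (\<Sum>a<length U. \<Sum>n\<in>UNIV. \<Gamma> c (U ! a) q n p * t (U[a := n]) L p)
     - (\<Sum>b<length L. \<Sum>n\<in>UNIV. \<Gamma> c n q (L ! b) p * t U (L[b := n]) p)"

text \<open>\<open>\<gamma>(y,\<tau>) = \<omega>\<^bsup>kq\<^esup> (\<partial>y/\<partial>x\<^sup>k) \<nabla>\<^sub>q\<tau>\<close>\<close>

definition associated_connection :: "('m, 'n::finite) chart set \<Rightarrow> ('m, 'n) prod_coeffs \<Rightarrow>
    ('m, 'n) bivector \<Rightarrow> ('m, 'n) christoffel \<Rightarrow> bool" where
  "associated_connection A P \<omega> \<Gamma> \<longleftrightarrow> is_connection A \<Gamma> \<and>
     (\<forall>y\<in>forms A 0. \<forall>\<tau>\<in>forms A 1. \<forall>c\<in>A. \<forall>p\<in>dom_of c. \<forall>n.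
        gamma P y \<tau> c [n] p =
          (\<Sum>k\<in>UNIV. \<Sum>q\<in>UNIV.
             \<omega> c k q p * pd c k (y c []) p * cov_deriv \<Gamma> c q (\<lambda>U. \<tau> c) [] [n] p))"

text \<open>Vector fields on a chart domain are given by their components \<open>V i\<close>.\<close>

definition cov_vec :: "('m, 'n::finite) christoffel \<Rightarrow> ('m, 'n) chart \<Rightarrow>
    ('n \<Rightarrow> 'm \<Rightarrow> real) \<Rightarrow> ('n \<Rightarrow> 'm \<Rightarrow> real) \<Rightarrow> 'n \<Rightarrow> 'm \<Rightarrow> real" where
  "cov_vec \<Gamma> c V W l p =
     (\<Sum>k\<in>UNIV. V k p * (pd c k (W l) p + (\<Sum>i\<in>UNIV. \<Gamma> c l k i p * W i p)))"

definition lie_bracket :: "('m, 'n::finite) chart \<Rightarrow>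
    ('n \<Rightarrow> 'm \<Rightarrow> real) \<Rightarrow> ('n \<Rightarrow> 'm \<Rightarrow> real) \<Rightarrow> 'n \<Rightarrow> 'm \<Rightarrow> real" where
  "lie_bracket c U V l p =
     (\<Sum>k\<in>UNIV. U k p * pd c k (V l) p - V k p * pd c k (U l) p)"

definition curvature_op :: "('m, 'n::finite) christoffel \<Rightarrow> ('m, 'n) chart \<Rightarrow>
    ('n \<Rightarrow> 'm \<Rightarrow> real) \<Rightarrow> ('n \<Rightarrow> 'm \<Rightarrow> real) \<Rightarrow> ('n \<Rightarrow> 'm \<Rightarrow> real) \<Rightarrow> 'n \<Rightarrow> 'm \<Rightarrow> real" where
  "curvature_op \<Gamma> c U V W =
     cov_vec \<Gamma> c U (cov_vec \<Gamma> c V W) - cov_vec \<Gamma> c V (cov_vec \<Gamma> c U W)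
     - cov_vec \<Gamma> c (lie_bracket c U V) W"

definition coord_field :: "'n \<Rightarrow> 'n \<Rightarrow> 'm \<Rightarrow> real" where
  "coord_field i = (\<lambda>l p. if l = i then 1 else 0)"

text \<open>\<open>curvature \<Gamma> c l i j k\<close> is \<open>R\<^sup>l\<^bsub>ijk\<^esub>\<close>, the \<open>l\<close>-component of \<open>R(\<partial>\<^sub>j,\<partial>\<^sub>k)(\<partial>\<^sub>i)\<close>.\<close>

definition curvature ::
    "('m, 'n::finite) christoffel \<Rightarrow> ('m, 'n) chart \<Rightarrow> 'n \<Rightarrow> 'n \<Rightarrow> 'n \<Rightarrow> 'n \<Rightarrow> 'm \<Rightarrow> real" where
  "curvature \<Gamma> c l i j k = curvature_op \<Gamma> c (coord_field j) (coord_field k) (coord_field i) l"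

definition flat :: "('m, 'n::finite) chart set \<Rightarrow> ('m, 'n) christoffel \<Rightarrow> bool" where
  "flat A \<Gamma> \<longleftrightarrow> (\<forall>c\<in>A. \<forall>p\<in>dom_of c. \<forall>l i j k. curvature \<Gamma> c l i j k p = 0)"

text \<open>\<open>torsion \<Gamma> c k i j\<close> is \<open>T\<^sup>k\<^bsub>ij\<^esub>\<close>, and \<open>torsion_deriv \<Gamma> c k i j l\<close> is \<open>T\<^sup>k\<^bsub>ij;l\<^esub>\<close>.\<close>

definition torsion ::
    "('m, 'n::finite) christoffel \<Rightarrow> ('m, 'n) chart \<Rightarrow> 'n \<Rightarrow> 'n \<Rightarrow> 'n \<Rightarrow> 'm \<Rightarrow> real" where
  "torsion \<Gamma> c k i j p = \<Gamma> c k i j p - \<Gamma> c k j i p"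

definition torsion_deriv ::
    "('m, 'n::finite) christoffel \<Rightarrow> ('m, 'n) chart \<Rightarrow> 'n \<Rightarrow> 'n \<Rightarrow> 'n \<Rightarrow> 'n \<Rightarrow> 'm \<Rightarrow> real" where
  "torsion_deriv \<Gamma> c k i j l =
     cov_deriv \<Gamma> c l (\<lambda>U L. torsion \<Gamma> c (U ! 0) (L ! 0) (L ! 1)) [k] [i, j]"

text \<open>\<open>N_tensor \<Gamma> c k j i l\<close> is \<open>N\<^sup>k\<^bsub>jil\<^esub>\<close>, and \<open>E_tensor \<omega> \<Gamma> c n k l i\<close> is \<open>E\<^bsup>nk\<^esup>\<^bsub>li\<^esub>\<close>.\<close>

definition N_tensor ::
    "('m, 'n::finite) christoffel \<Rightarrow> ('m, 'n) chart \<Rightarrow> 'n \<Rightarrow> 'n \<Rightarrow> 'n \<Rightarrow> 'n \<Rightarrow> 'm \<Rightarrow> real" where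
  "N_tensor \<Gamma> c k j i l p =
     torsion_deriv \<Gamma> c k j i l p
     + 1 / 2 * curvature \<Gamma> c k j l i p
     + (\<Sum>n\<in>UNIV. torsion \<Gamma> c n j l p * torsion \<Gamma> c k i n p)
     + 1 / 2 * (\<Sum>n\<in>UNIV. torsion \<Gamma> c n l i p * torsion \<Gamma> c k j n p)"

definition E_tensor :: "('m, 'n::finite) bivector \<Rightarrow> ('m, 'n) christoffel \<Rightarrow>
    ('m, 'n) chart \<Rightarrow> 'n \<Rightarrow> 'n \<Rightarrow> 'n \<Rightarrow> 'n \<Rightarrow> 'm \<Rightarrow> real" where
  "E_tensor \<omega> \<Gamma> c n k l i p = (\<Sum>j\<in>UNIV. \<omega> c j n p * N_tensor \<Gamma> c k j i l p)"

definition E_covariantly_constant :: "('m, 'n::finite) chart set \<Rightarrow> ('m, 'n) bivector \<Rightarrow>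
    ('m, 'n) christoffel \<Rightarrow> bool" where
  "E_covariantly_constant A \<omega> \<Gamma> \<longleftrightarrow>
     (\<forall>c\<in>A. \<forall>p\<in>dom_of c. \<forall>n k l i m.
        cov_deriv \<Gamma> c m (\<lambda>U L. E_tensor \<omega> \<Gamma> c (U ! 0) (U ! 1) (L ! 0) (L ! 1)) [n, k] [l, i] p = 0)"


section \<open>Checks on the conventions\<close>

lemma Ck_on_cong:
  assumes "open S" "\<And>x. x \<in> S \<Longrightarrow> f x = g x" "Ck_on k S f"
  shows "Ck_on k S g"
  using assms(2,3)
proof (induction k arbitrary: f g)
  case 0
  then show ?case by (simp cong: continuous_on_cong)
next
  case (Suc k)
  have der: "(f has_derivative F) (at x) \<longleftrightarrow> (g has_derivative F) (at x)" if "x \<in> S" for x F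
    using has_derivative_transform_within_open[OF _ assms(1) that] Suc.prems(1) by metis
  have eq: "frechet_derivative f (at x) v = frechet_derivative g (at x) v" if "x \<in> S" for x v
    unfolding frechet_derivative_def der[OF that] by (rule refl)
  have "Ck_on k S (\<lambda>x. frechet_derivative g (at x) v)" for v
  proof (rule Suc.IH)
    show "Ck_on k S (\<lambda>x. frechet_derivative f (at x) v)"
      using Suc.prems(2) by simp
  qed (rule eq)
  moreover have "\<forall>x\<in>S. g differentiable (at x)"
    using Suc.prems(2) der by (auto simp: differentiable_def)
  ultimately show ?case by simp
qed

lemma Ck_on_zero:
  "Ck_on k (S :: 'a::real_normed_vector set) (\<lambda>x. 0 :: 'b::real_normed_vector)"
proof (induction k)
  case (Suc k)
  have "frechet_derivative (\<lambda>x::'a. 0::'b) (at x) = (\<lambda>v. 0)" for x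
    by (rule frechet_derivative_at[symmetric]) (rule has_derivative_const)
  then show ?case using Suc by simp
qed simp

lemma smooth_in_chart_cong:
  assumes "smooth_atlas A" "c \<in> A" "\<And>p. p \<in> dom_of c \<Longrightarrow> f p = g p" "smooth_in_chart c f"
  shows "smooth_in_chart c g"
  unfolding smooth_in_chart_def smooth_on_def
proof
  fix k
  show "Ck_on k (snd c ` dom_of c) (g \<circ> chart_inv c)"
  proof (rule Ck_on_cong)
    show "open (snd c ` dom_of c)"
      using assms(1,2) by (auto simp: smooth_atlas_def)
    show "Ck_on k (snd c ` dom_of c) (f \<circ> chart_inv c)"
      using assms(4) by (auto simp: smooth_in_chart_def smooth_on_def)
  next
    fix x assume "x \<in> snd c ` dom_of c"
    then have "chart_inv c x \<in> dom_of c"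
      by (auto simp: chart_inv_def intro: inv_into_into)
    then show "(f \<circ> chart_inv c) x = (g \<circ> chart_inv c) x"
      using assms(3) by simp
  qed
qed

lemma forms_zero:
  assumes "\<tau> \<in> forms A n" "c \<notin> A \<or> p \<notin> dom_of c \<or> length I \<noteq> n"
  shows "\<tau> c I p = 0"
proof -
  have "\<forall>c I p. \<not> (c \<in> A \<and> p \<in> dom_of c \<and> length I = n) \<longrightarrow> \<tau> c I p = 0"
    using assms(1) unfolding forms_def mem_Collect_eq by (elim conjE)
  from this[rule_format, of c p I] assms(2) show ?thesis by argo
qed

lemma forms_smooth:
  assumes "\<tau> \<in> forms A n" "c \<in> A"
  shows "smooth_in_chart c (\<tau> c I)"
proof -
  have "\<forall>c\<in>A. \<forall>I. smooth_in_chart c (\<tau> c I)"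
    using assms(1) unfolding forms_def mem_Collect_eq by (elim conjE)
  from this[rule_format, OF assms(2)] show ?thesis .
qed

lemma forms_transform:
  assumes "\<tau> \<in> forms A n" "c \<in> A" "c' \<in> A" "p \<in> dom_of c" "p \<in> dom_of c'"
  shows "\<tau> c' I p =
    (\<Sum>J | length J = length I.
       (\<Prod>a<length I. pd c' (I ! a) (coord c (J ! a)) p) * \<tau> c J p)"
proof -
  have "\<forall>c\<in>A. \<forall>c'\<in>A. \<forall>p \<in> dom_of c \<inter> dom_of c'. \<forall>I.
        \<tau> c' I p =
          (\<Sum>J | length J = length I.
             (\<Prod>a<length I. pd c' (I ! a) (coord c (J ! a)) p) * \<tau> c J p)"
    using assms(1) unfolding forms_def mem_Collect_eq by (elim conjE)
  from this[rule_format, OF assms(2,3) IntI[OF assms(4,5)]] show ?thesis .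
qed

lemma forms_0:
  fixes A :: "('m::{t2_space,second_countable_topology}, 'n::finite) chart set"
  assumes A: "smooth_atlas A"
  shows "forms A 0 = of_fun A ` smooth_functions A"
proof (intro subset_antisym subsetI)
  fix \<tau> assume \<tau>: "\<tau> \<in> forms A 0"
  define ch where "ch = (\<lambda>p. SOME c. c \<in> A \<and> p \<in> dom_of c)"
  have ch: "ch p \<in> A \<and> p \<in> dom_of (ch p)" for p
  proof -
    have "\<exists>c. c \<in> A \<and> p \<in> dom_of c"
      using A unfolding smooth_atlas_def by blast
    then show ?thesis unfolding ch_def by (rule someI_ex)
  qed
  define f where "f = (\<lambda>p. \<tau> (ch p) [] p)"
  have eq: "\<tau> c [] p = f p" if "c \<in> A" "p \<in> dom_of c" for c p
  proof -
    have "\<tau> c [] p = \<tau> (ch p) [] p"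
      using forms_transform[OF \<tau>, of "ch p" c p "[]"] that ch[of p] by simp
    then show ?thesis by (simp add: f_def)
  qed
  have "\<tau> = of_fun A f"
  proof (intro ext)
    fix c I p
    show "\<tau> c I p = of_fun A f c I p"
      using eq[of c p] forms_zero[OF \<tau>, of c p I] by (auto simp: of_fun_def)
  qed
  moreover have "f \<in> smooth_functions A"
    unfolding smooth_functions_def
  proof (intro CollectI ballI)
    fix c assume c: "c \<in> A"
    show "smooth_in_chart c f"
      by (rule smooth_in_chart_cong[OF A c, of "\<tau> c []"]) (use c eq forms_smooth[OF \<tau>] in auto)
  qed
  ultimately show "\<tau> \<in> of_fun A ` smooth_functions A" by blast
next
  fix \<tau> assume "\<tau> \<in> of_fun A ` smooth_functions A"
  then obtain f where f: "f \<in> smooth_functions A" and \<tau>: "\<tau> = of_fun A f" by blast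
  have s: "smooth_in_chart c (\<tau> c I)" if c: "c \<in> A" for c I
  proof (cases "I = []")
    case True
    show ?thesis
      by (rule smooth_in_chart_cong[OF A c, of f])
        (use f c True in \<open>auto simp: \<tau> of_fun_def smooth_functions_def\<close>)
  next
    case False
    have "smooth_in_chart c (\<lambda>p. 0)"
      by (simp add: smooth_in_chart_def smooth_on_def o_def Ck_on_zero)
    then show ?thesis using False by (simp add: \<tau> of_fun_def)
  qed
  have t: "\<tau> c' I p =
          (\<Sum>J | length J = length I.
             (\<Prod>a<length I. pd c' (I ! a) (coord c (J ! a)) p) * \<tau> c J p)"
    if "c \<in> A" "c' \<in> A" "p \<in> dom_of c \<inter> dom_of c'" for c c' I p
  proof (cases "I = []")
    case True
    then show ?thesis using that by (simp add: \<tau> of_fun_def)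
  next
    case False
    then have "(\<Sum>J | length J = length I.
             (\<Prod>a<length I. pd c' (I ! a) (coord c (J ! a)) p) * \<tau> c J p) = 0"
      by (intro sum.neutral) (auto simp: \<tau> of_fun_def)
    then show ?thesis using False by (simp add: \<tau> of_fun_def)
  qed
  have z: "\<tau> c I p = 0" if "\<not> (c \<in> A \<and> p \<in> dom_of c \<and> length I = 0)" for c I p
    using that by (auto simp: \<tau> of_fun_def)
  have a: "\<tau> c (I[a := I ! b, b := I ! a]) p = - \<tau> c I p" if "a < length I" for c I a b p
    using that by (auto simp: \<tau> of_fun_def)
  show "\<tau> \<in> forms A 0"
    unfolding forms_def
  proof (intro CollectI conjI)
    show "\<forall>c I p. \<not> (c \<in> A \<and> p \<in> dom_of c \<and> length I = 0) \<longrightarrow> \<tau> c I p = 0"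
      by (intro allI impI) (rule z)
    show "\<forall>c\<in>A. \<forall>I. smooth_in_chart c (\<tau> c I)"
      by (intro ballI allI) (rule s)
    show "\<forall>c I p a b. a < length I \<and> b < length I \<and> a \<noteq> b \<longrightarrow>
        \<tau> c (I[a := I ! b, b := I ! a]) p = - \<tau> c I p"
      by (intro allI impI, elim conjE) (rule a)
    show "\<forall>c\<in>A. \<forall>c'\<in>A. \<forall>p \<in> dom_of c \<inter> dom_of c'. \<forall>I.
        \<tau> c' I p =
          (\<Sum>J | length J = length I.
             (\<Prod>a<length I. pd c' (I ! a) (coord c (J ! a)) p) * \<tau> c J p)"
      by (intro ballI allI) (rule t)
  qed
qed

lemma wedge_one_forms:
  assumes "\<alpha> \<in> forms A 1" "\<beta> \<in> forms A 1"
  shows "wedge \<alpha> \<beta> c [i, j] p = \<alpha> c [i] p * \<beta> c [j] p - \<alpha> c [j] p * \<beta> c [i] p"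
proof -
  have P: "Pow {..<length [i, j]} = {{}, {0}, {1}, {0, 1}}"
    by (auto simp: numeral_2_eq_2 lessThan_Suc Pow_insert)
  have z: "\<alpha> c [] p = 0" "\<beta> c [] p = 0" "\<alpha> c [i, j] p = 0"
    by (rule forms_zero[OF assms(1)] forms_zero[OF assms(2)]; simp)+
  have "{(a, b). a \<in> {1} \<and> b < 2 \<and> b \<notin> {1} \<and> b < a} = {(1::nat, 0::nat)}" by auto
  then have s1: "shuffle_sign 2 {1} = -1"
    unfolding shuffle_sign_def by (simp only:) simp
  have "{(a, b). a \<in> {0} \<and> b < 2 \<and> b \<notin> {0} \<and> b < a} = ({} :: (nat \<times> nat) set)" by auto
  then have s0: "shuffle_sign 2 {0} = 1"
    unfolding shuffle_sign_def by (simp only:) simp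
  have "{0::nat} \<noteq> {1}" "{0::nat} \<noteq> {0, 1}" "{1::nat} \<noteq> {0, 1}" by auto
  then show ?thesis
    unfolding wedge_def P using z s0 s1 by (simp add: nths_Cons numeral_2_eq_2)
qed

lemma ext_d_function: "ext_d \<tau> c [i] = pd c i (\<tau> c [])"
  by (rule ext) (simp add: ext_d_def)

lemma ext_d_one_form: "ext_d \<tau> c [i, j] p = pd c i (\<tau> c [j]) p - pd c j (\<tau> c [i]) p"
  by (simp add: ext_d_def lessThan_Suc)

lemma cov_deriv_one_form:
  "cov_deriv \<Gamma> c q (\<lambda>U. \<tau> c) [] [n] p =
     pd c q (\<tau> c [n]) p - (\<Sum>i\<in>UNIV. \<Gamma> c i q n p * \<tau> c [i] p)"
  by (simp add: cov_deriv_def)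

end

theory Submission
  imports Defs
begin

text \<open>
  Write \<open>B\<close> for the coefficient of \<open>\<hbar>\<close> in the super-commutator and \<open>L\<^sub>x = \<nabla>\<^bsub>{x,-}\<^esub>\<close>. Because the
  undeformed product is graded commutative, \<open>J\<^sub>2\<close> contains only iterated first-order brackets
  (\<open>J2_eq\<close>). On one-forms \<open>B(x,-)\<close> is \<open>L\<^sub>x\<close> by the definition of \<open>\<nabla>\<close>; associativity makes it a
  derivation of the wedge product (\<open>comm1_derivation\<close>), hence it is \<open>L\<^sub>x\<close> on two-forms as well. The
  derivation property of \<open>d\<^sup>\<bullet>\<close> makes \<open>d\<close> a derivation of \<open>B\<close>, so \<open>B(dy,\<tau>) = d L\<^sub>y \<tau> - L\<^sub>y d\<tau>\<close> for
  a one-form \<open>\<tau>\<close>. It follows that \<open>J\<^sub>2(x,y,z)\<close> is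
  \<open>L\<^sub>x B(dy,dz) - B(L\<^sub>x dy, dz) - B(dy, L\<^sub>x dz)\<close>: it measures how far \<open>B\<close> is from being invariant under
  the Hamiltonian derivative \<open>L\<^sub>x\<close>.

  For a flat connection the coordinate derivatives \<open>\<nabla>\<^sub>q\<close> commute as operators on one-forms. With
  this, and with \<open>d{y,x\<^sup>m} = L\<^sub>y dx\<^sup>m - L dy\<close> (\<open>L\<close> being taken along \<open>{x\<^sup>m,-}\<close>), the bracket of one-forms
  becomes (\<open>ext_deriv1_along_ham\<close>)

    \<open>B(dy,\<tau>) = - \<omega>\<^bsup>mr\<^esup> \<nabla>\<^sub>r dy \<and> \<nabla>\<^sub>m \<tau> - S(dy,\<tau>)\<close>,  where \<open>S\<^bsup>jk\<^esup>\<^bsub>il\<^esub> = \<omega>\<^bsup>jq\<^esup> T\<^bsup>k\<^esup>\<^bsub>il;q\<^esub>\<close>.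

  The first term is symmetric in the two one-forms and invariant under \<open>L\<^sub>x\<close>, since its
  coefficients are the Poisson bivector, which Hamiltonian fields preserve (\<open>along2_Q_form\<close>). As
  \<open>B(dy,dz)\<close> is symmetric too, so is \<open>S\<close> in its upper indices, and what remains of \<open>J\<^sub>2(x,y,z)\<close> is
  \<open>- (L\<^sub>x S)(dy,dz)\<close>. By the first Bianchi identity \<open>S\<close> is the antisymmetrisation of \<open>E\<close> in the lower
  indices up to sign (\<open>S_tensor_eq_E\<close>), so it is parallel if \<open>E\<close> is.

  The axioms speak of global functions and forms only. To use them for coordinate functions, and
  to express a two-form through products of coordinate differentials, smooth bump functions are
  constructed. They also show that \<open>\<omega>\<close> is smooth and antisymmetric.
\<close>


section \<open>Calculus of smooth functions on open sets\<close>

lemma Ck_on_Suc_D: "Ck_on (Suc k) S f \<Longrightarrow> Ck_on k S f"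
proof (induction k arbitrary: f)
  case 0
  then show ?case
    by (auto intro!: continuous_at_imp_continuous_on differentiable_imp_continuous_within)
qed auto

lemma Ck_on_SucI:
  assumes "open S" and "\<And>x. x \<in> S \<Longrightarrow> (f has_derivative F x) (at x)"
    and "\<And>v. Ck_on k S (\<lambda>x. F x v)"
  shows "Ck_on (Suc k) S f"
proof -
  have "F x v = frechet_derivative f (at x) v" if "x \<in> S" for x v
    using frechet_derivative_at[OF assms(2)[OF that]] by simp
  then have "Ck_on k S (\<lambda>x. frechet_derivative f (at x) v)" for v
    by (rule Ck_on_cong[OF assms(1) _ assms(3)])
  then show ?thesis
    using assms(2) by (auto simp: differentiable_def)
qed

lemma Ck_on_Suc_E:
  assumes "Ck_on (Suc k) S f"
  obtains F where "\<And>x. x \<in> S \<Longrightarrow> (f has_derivative F x) (at x)" and "\<And>v. Ck_on k S (\<lambda>x. F x v)"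
  using assms that[of "\<lambda>x. frechet_derivative f (at x)"] by (auto simp: frechet_derivative_works)

lemma Ck_on_const: "open S \<Longrightarrow> Ck_on k S (\<lambda>x. c)"
  by (induction k arbitrary: c) (auto intro!: continuous_intros)

lemma Ck_on_add:
  assumes "open S" "Ck_on k S f" "Ck_on k S g"
  shows "Ck_on k S (\<lambda>x. f x + g x)"
  using assms(2,3)
proof (induction k arbitrary: f g)
  case 0
  then show ?case by (auto intro!: continuous_intros)
next
  case (Suc k)
  from Suc.prems obtain F G where
    "\<And>x. x \<in> S \<Longrightarrow> (f has_derivative F x) (at x)" "\<And>v. Ck_on k S (\<lambda>x. F x v)"
    "\<And>x. x \<in> S \<Longrightarrow> (g has_derivative G x) (at x)" "\<And>v. Ck_on k S (\<lambda>x. G x v)"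
    by (metis Ck_on_Suc_E)
  then show ?case
    by (intro Ck_on_SucI[OF assms(1), where F = "\<lambda>x v. F x v + G x v"] has_derivative_add Suc.IH)
qed

lemma Ck_on_mult:
  fixes f g :: "'a::real_normed_vector \<Rightarrow> real"
  assumes "open S" "Ck_on k S f" "Ck_on k S g"
  shows "Ck_on k S (\<lambda>x. f x * g x)"
  using assms(2,3)
proof (induction k arbitrary: f g)
  case 0
  then show ?case by (auto intro!: continuous_intros)
next
  case (Suc k)
  from Suc.prems obtain F G where
    "\<And>x. x \<in> S \<Longrightarrow> (f has_derivative F x) (at x)" "\<And>v. Ck_on k S (\<lambda>x. F x v)"
    "\<And>x. x \<in> S \<Longrightarrow> (g has_derivative G x) (at x)" "\<And>v. Ck_on k S (\<lambda>x. G x v)"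
    by (metis Ck_on_Suc_E)
  then show ?case
    using Suc.prems[THEN Ck_on_Suc_D]
    by (intro Ck_on_SucI[OF assms(1), where F = "\<lambda>x v. f x * G x v + F x v * g x"]
        has_derivative_mult Ck_on_add[OF assms(1)] Suc.IH)
qed

lemma Ck_on_sum:
  assumes "open S" "\<And>i. i \<in> I \<Longrightarrow> Ck_on k S (f i)"
  shows "Ck_on k S (\<lambda>x. \<Sum>i\<in>I. f i x)"
  using assms(2)
  by (induction I rule: infinite_finite_induct) (auto intro!: Ck_on_const Ck_on_add assms(1))

lemma Ck_on_bounded_linear:
  assumes "bounded_linear h" "open S" "Ck_on k S f"
  shows "Ck_on k S (\<lambda>x. h (f x))"
  using assms(3)
proof (induction k arbitrary: f)
  case 0
  then show ?case
    using bounded_linear.continuous_on[OF assms(1)] by auto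
next
  case (Suc k)
  then obtain F where
    "\<And>x. x \<in> S \<Longrightarrow> (f has_derivative F x) (at x)" "\<And>v. Ck_on k S (\<lambda>x. F x v)"
    by (metis Ck_on_Suc_E)
  then show ?case
    by (intro Ck_on_SucI[OF assms(2), where F = "\<lambda>x v. h (F x v)"]
        bounded_linear.has_derivative[OF assms(1)] Suc.IH)
qed

lemma Ck_on_id: "open S \<Longrightarrow> Ck_on k S (\<lambda>x. x)"
  by (cases k)
    (auto intro!: Ck_on_SucI[where F = "\<lambda>x v. v"] Ck_on_const continuous_intros simp del: Ck_on.simps(2))

text \<open>Expanding the inner derivative in a basis turns the chain rule into a finite sum of products,
  so that the induction on \<open>k\<close> only needs products and sums.\<close>

lemma Ck_on_compose:
  fixes f :: "'a::real_normed_vector \<Rightarrow> 'b::euclidean_space" and g :: "'b \<Rightarrow> real"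
  assumes "open S" "Ck_on k S f" "Ck_on k T g" "f ` S \<subseteq> T"
  shows "Ck_on k S (\<lambda>x. g (f x))"
  using assms(2,3)
proof (induction k arbitrary: g)
  case 0
  then show ?case using continuous_on_compose2[OF _ _ assms(4)] by auto
next
  case (Suc k)
  from Suc.prems obtain F G where
    F: "\<And>x. x \<in> S \<Longrightarrow> (f has_derivative F x) (at x)" "\<And>v. Ck_on k S (\<lambda>x. F x v)" and
    G: "\<And>y. y \<in> T \<Longrightarrow> (g has_derivative G y) (at y)" "\<And>v. Ck_on k T (\<lambda>y. G y v)"
    by (metis Ck_on_Suc_E)
  have eq: "G (f x) (F x v) = (\<Sum>b\<in>Basis. (F x v \<bullet> b) * G (f x) b)" if "x \<in> S" for x v
  proof -
    have "linear (G (f x))"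
      using G(1)[of "f x"] assms(4) that by (auto simp: has_derivative_def bounded_linear.linear)
    have "G (f x) (F x v) = G (f x) (\<Sum>b\<in>Basis. (F x v \<bullet> b) *\<^sub>R b)"
      by (simp add: euclidean_representation)
    also have "\<dots> = (\<Sum>b\<in>Basis. (F x v \<bullet> b) * G (f x) b)"
      using \<open>linear (G (f x))\<close> by (simp add: linear_sum linear_scale)
    finally show ?thesis .
  qed
  have "Ck_on k S (\<lambda>x. G (f x) (F x v))" for v
  proof (rule Ck_on_cong[OF assms(1)])
    show "Ck_on k S (\<lambda>x. \<Sum>b\<in>Basis. (F x v \<bullet> b) * G (f x) b)"
      using Suc.prems(1)[THEN Ck_on_Suc_D]
      by (intro Ck_on_sum Ck_on_mult Suc.IH Ck_on_bounded_linear[OF bounded_linear_inner_left]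
          F(2) G(2) assms(1))
  qed (simp add: eq)
  moreover have "((\<lambda>x. g (f x)) has_derivative (\<lambda>v. G (f x) (F x v))) (at x)" if "x \<in> S" for x
    using has_derivative_compose[OF F(1)[OF that] G(1)] assms(4) that by auto
  ultimately show ?case
    by (intro Ck_on_SucI[OF assms(1)])
qed

lemma Ck_on_locally:
  assumes "\<And>x. x \<in> S \<Longrightarrow> \<exists>U. open U \<and> x \<in> U \<and> Ck_on k U f"
  shows "Ck_on k S f"
  using assms
proof (induction k arbitrary: f)
  case 0
  have "isCont f x" if "x \<in> S" for x
    using 0[OF that] by (auto simp: continuous_on_eq_continuous_at)
  then show ?case by (simp add: continuous_at_imp_continuous_on)
next
  case (Suc k)
  have "Ck_on k S (\<lambda>x. frechet_derivative f (at x) v)" for v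
    using Suc.prems by (intro Suc.IH) fastforce
  with Suc.prems show ?case by fastforce
qed

lemma Ck_on_subset: "Ck_on k S f \<Longrightarrow> T \<subseteq> S \<Longrightarrow> Ck_on k T f"
  by (induction k arbitrary: f) (auto intro: continuous_on_subset)

text \<open>The mean value theorem, applied first in the direction \<open>u\<close> and then in the direction \<open>v\<close>,
  writes the second difference of \<open>f\<close> over a small parallelogram as a value of the second
  derivative near \<open>x\<close>.\<close>

lemma second_difference_approx:
  fixes f :: "'a::real_normed_vector \<Rightarrow> real"
  assumes "open S" "x \<in> S" "e > 0"
    and f: "\<And>y. y \<in> S \<Longrightarrow> (f has_derivative F y) (at y)"
    and Fu: "\<And>y. y \<in> S \<Longrightarrow> ((\<lambda>y. F y u) has_derivative G y) (at y)"
    and cont: "continuous_on S (\<lambda>y. G y v)"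
  shows "\<exists>d>0. \<forall>t. 0 < t \<and> t < d \<longrightarrow>
    \<bar>(f (x + t *\<^sub>R u + t *\<^sub>R v) - f (x + t *\<^sub>R u) - f (x + t *\<^sub>R v) + f x) / t^2 - G x v\<bar> < e"
proof -
  have "isCont (\<lambda>y. G y v) x"
    using cont assms(1,2) by (simp add: continuous_on_eq_continuous_at)
  then obtain d1 where d1: "d1 > 0" "\<And>y. dist y x < d1 \<Longrightarrow> \<bar>G y v - G x v\<bar> < e"
    using assms(3) by (auto simp: continuous_at_eps_delta dist_norm)
  obtain d2 where d2: "d2 > 0" "ball x d2 \<subseteq> S"
    using assms(1,2) openE by blast
  \<comment> \<open>chosen so that the whole parallelogram lies in both balls\<close>
  define d where "d = min d1 d2 / (norm u + norm v + 1)"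
  have pos: "norm u + norm v + 1 > 0"
    by (simp add: add_nonneg_pos)
  have "d > 0"
    using d1 d2 pos by (simp add: d_def)
  moreover have "\<bar>(f (x + t *\<^sub>R u + t *\<^sub>R v) - f (x + t *\<^sub>R u) - f (x + t *\<^sub>R v) + f x) / t^2 - G x v\<bar> < e"
    if t: "0 < t" "t < d" for t
  proof -
    have near: "dist (x + s *\<^sub>R u + r *\<^sub>R v) x < min d1 d2" if "0 \<le> s" "s \<le> t" "0 \<le> r" "r \<le> t" for s r
    proof -
      have "dist (x + s *\<^sub>R u + r *\<^sub>R v) x \<le> s * norm u + r * norm v"
        using that norm_triangle_ineq[of "s *\<^sub>R u" "r *\<^sub>R v"] by (simp add: dist_norm add.assoc)
      also have "\<dots> \<le> t * norm u + t * norm v"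
        using that by (intro add_mono mult_right_mono) auto
      also have "\<dots> < t * (norm u + norm v + 1)"
        using t by (simp add: algebra_simps)
      also have "\<dots> < min d1 d2"
        using t(2) pos by (simp add: d_def pos_less_divide_eq)
      finally show ?thesis .
    qed
    then have inS: "x + s *\<^sub>R u + r *\<^sub>R v \<in> S" if "0 \<le> s" "s \<le> t" "0 \<le> r" "r \<le> t" for s r
      using d2(2) that by (force simp: dist_commute)
    have d_s: "DERIV (\<lambda>s. f (x + s *\<^sub>R u + r *\<^sub>R v)) s :> F (x + s *\<^sub>R u + r *\<^sub>R v) u"
      if "0 \<le> s" "s \<le> t" "0 \<le> r" "r \<le> t" for s r
    proof -
      have lin: "linear (F (x + s *\<^sub>R u + r *\<^sub>R v))"
        using f[OF inS[OF that]] by (auto simp: has_derivative_def bounded_linear.linear)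
      have "((\<lambda>s. x + s *\<^sub>R u + r *\<^sub>R v) has_derivative (\<lambda>h. h *\<^sub>R u)) (at s)"
        by (auto intro!: derivative_eq_intros)
      from has_derivative_compose[OF this f[OF inS[OF that]]]
      show ?thesis
        using lin by (simp add: has_field_derivative_def linear_scale mult_commute_abs)
    qed
    have d_r: "DERIV (\<lambda>r. F (x + s *\<^sub>R u + r *\<^sub>R v) u) r :> G (x + s *\<^sub>R u + r *\<^sub>R v) v"
      if "0 \<le> s" "s \<le> t" "0 \<le> r" "r \<le> t" for s r
    proof -
      have lin: "linear (G (x + s *\<^sub>R u + r *\<^sub>R v))"
        using Fu[OF inS[OF that]] by (auto simp: has_derivative_def bounded_linear.linear)
      have "((\<lambda>r. x + s *\<^sub>R u + r *\<^sub>R v) has_derivative (\<lambda>h. h *\<^sub>R v)) (at r)"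
        by (auto intro!: derivative_eq_intros)
      from has_derivative_compose[OF this Fu[OF inS[OF that]]]
      show ?thesis
        using lin by (simp add: has_field_derivative_def linear_scale mult_commute_abs)
    qed
    have "\<exists>s. 0 < s \<and> s < t \<and>
        (f (x + t *\<^sub>R u + t *\<^sub>R v) - f (x + t *\<^sub>R u + 0 *\<^sub>R v)) -
        (f (x + 0 *\<^sub>R u + t *\<^sub>R v) - f (x + 0 *\<^sub>R u + 0 *\<^sub>R v)) =
        (t - 0) * (F (x + s *\<^sub>R u + t *\<^sub>R v) u - F (x + s *\<^sub>R u + 0 *\<^sub>R v) u)"
      using t by (intro MVT2 DERIV_diff d_s) auto
    then obtain s where s: "0 < s" "s < t" and s_eq:
        "f (x + t *\<^sub>R u + t *\<^sub>R v) - f (x + t *\<^sub>R u) - f (x + t *\<^sub>R v) + f x =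
         t * (F (x + s *\<^sub>R u + t *\<^sub>R v) u - F (x + s *\<^sub>R u + 0 *\<^sub>R v) u)"
      by (auto simp: algebra_simps)
    have "\<exists>r. 0 < r \<and> r < t \<and> F (x + s *\<^sub>R u + t *\<^sub>R v) u - F (x + s *\<^sub>R u + 0 *\<^sub>R v) u =
        (t - 0) * G (x + s *\<^sub>R u + r *\<^sub>R v) v"
      using t s by (intro MVT2 d_r) auto
    then obtain r where r: "0 < r" "r < t" and r_eq:
        "F (x + s *\<^sub>R u + t *\<^sub>R v) u - F (x + s *\<^sub>R u + 0 *\<^sub>R v) u = t * G (x + s *\<^sub>R u + r *\<^sub>R v) v"
      by auto
    have "\<bar>G (x + s *\<^sub>R u + r *\<^sub>R v) v - G x v\<bar> < e"
      using near[of s r] s r by (intro d1(2)) auto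
    then show ?thesis
      using t s_eq r_eq by (simp add: power2_eq_square)
  qed
  ultimately show ?thesis by blast
qed

text \<open>Exchanging \<open>u\<close> and \<open>v\<close> does not change the second difference.\<close>

lemma second_derivative_symmetric:
  fixes f :: "'a::real_normed_vector \<Rightarrow> real"
  assumes "open S" "x \<in> S" "Ck_on 2 S f"
  shows "frechet_derivative (\<lambda>y. frechet_derivative f (at y) u) (at x) v =
    frechet_derivative (\<lambda>y. frechet_derivative f (at y) v) (at x) u" (is "?A = ?B")
proof -
  let ?F = "\<lambda>y. frechet_derivative f (at y)"
  let ?G = "\<lambda>u y. frechet_derivative (\<lambda>y. ?F y u) (at y)"
  have C: "Ck_on (Suc (Suc 0)) S f"
    using assms(3) by (simp only: numeral_2_eq_2)
  then have f: "(f has_derivative ?F y) (at y)" if "y \<in> S" for y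
    using that by (auto simp: frechet_derivative_works)
  have Fu: "((\<lambda>y. ?F y u) has_derivative ?G u y) (at y)" if "y \<in> S" for y u
    using that C by (auto simp: frechet_derivative_works)
  have cont: "continuous_on S (\<lambda>y. ?G u y v)" for u v
    using C by simp
  have "\<bar>?A - ?B\<bar> \<le> e" if "e > 0" for e
  proof -
    have e: "e / 2 > 0" using that by simp
    from second_difference_approx[OF assms(1,2) e f Fu cont, of u v]
    obtain d1 where "d1 > 0" and d1: "\<And>t. 0 < t \<Longrightarrow> t < d1 \<Longrightarrow>
        \<bar>(f (x + t *\<^sub>R u + t *\<^sub>R v) - f (x + t *\<^sub>R u) - f (x + t *\<^sub>R v) + f x) / t^2 - ?A\<bar> < e / 2"
      by blast
    from second_difference_approx[OF assms(1,2) e f Fu cont, of v u]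
    obtain d2 where "d2 > 0" and d2: "\<And>t. 0 < t \<Longrightarrow> t < d2 \<Longrightarrow>
        \<bar>(f (x + t *\<^sub>R v + t *\<^sub>R u) - f (x + t *\<^sub>R v) - f (x + t *\<^sub>R u) + f x) / t^2 - ?B\<bar> < e / 2"
      by blast
    define t where "t = min d1 d2 / 2"
    have t: "0 < t" "t < d1" "t < d2"
      using \<open>d1 > 0\<close> \<open>d2 > 0\<close> by (auto simp: t_def)
    have "f (x + t *\<^sub>R v + t *\<^sub>R u) - f (x + t *\<^sub>R v) - f (x + t *\<^sub>R u) + f x =
        f (x + t *\<^sub>R u + t *\<^sub>R v) - f (x + t *\<^sub>R u) - f (x + t *\<^sub>R v) + f x"
      by (simp add: algebra_simps)
    from d1[OF t(1,2)] d2[OF t(1,3), unfolded this] show ?thesis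
      by arith
  qed
  then have "\<bar>?A - ?B\<bar> \<le> 0"
    by (rule field_le_epsilon) simp
  then show ?thesis by simp
qed


section \<open>Bump functions\<close>

text \<open>The family of all \<open>u\<^sup>m e\<^bsup>-u\<^esup>\<close> with \<open>u = 1/t\<close>, unlike the single function \<open>e\<^bsup>-1/t\<^esup>\<close>, has derivatives
  in its own linear span, which makes smoothness an induction.\<close>

definition flat_exp :: "nat \<Rightarrow> real \<Rightarrow> real" where
  "flat_exp m t = (if t > 0 then (1 / t) ^ m * exp (- (1 / t)) else 0)"

lemma flat_exp_tendsto_0: "(flat_exp m \<longlongrightarrow> 0) (at 0)"
proof -
  have "((\<lambda>t. (1 / t) ^ m / exp (1 / t)) \<longlongrightarrow> (0::real)) (at_right 0)"
    using filterlim_compose[OF tendsto_power_div_exp_0[of m] filterlim_inverse_at_top_right]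
    by (simp add: inverse_eq_divide)
  then have "(flat_exp m \<longlongrightarrow> 0) (at_right 0)"
    by (rule Lim_transform_eventually)
      (simp add: eventually_at_filter flat_exp_def exp_minus_inverse exp_minus field_class.field_divide_inverse)
  moreover have "(flat_exp m \<longlongrightarrow> 0) (at_left 0)"
    by (rule Lim_transform_eventually[OF tendsto_const])
      (simp add: eventually_at_filter flat_exp_def)
  ultimately show ?thesis
    by (simp add: filterlim_split_at_real)
qed

lemma flat_exp_deriv:
  "(flat_exp m has_real_derivative (flat_exp (m + 2) t - real m * flat_exp (m + 1) t)) (at t)"
proof -
  consider "t > 0" | "t < 0" | "t = 0" by linarith
  then show ?thesis
  proof cases
    case 1
    have "((\<lambda>t. (1 / t) ^ m * exp (- (1 / t))) has_real_derivative
        (flat_exp (m + 2) t - real m * flat_exp (m + 1) t)) (at t)"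
    proof -
      have u: "((\<lambda>t. 1 / t) has_real_derivative - ((1 / t)\<^sup>2)) (at t)"
        using 1 by (auto intro!: derivative_eq_intros simp: power2_eq_square)
      have "(1 / t)\<^sup>2 * (1 / t) ^ (m - Suc 0) = (1 / t) ^ (m + 1)" if "m > 0"
        using that by (cases m) (auto simp: power2_eq_square)
      then have e: "real m * (- ((1 / t)\<^sup>2) * (1 / t) ^ (m - Suc 0)) = - real m * (1 / t) ^ (m + 1)"
        by (cases "m > 0") auto
      have e': "real m * (- ((1 / t)\<^sup>2) * (1 / t) ^ (m - Suc 0)) * exp (- (1 / t)) +
          exp (- (1 / t)) * - (- ((1 / t)\<^sup>2)) * (1 / t) ^ m =
          flat_exp (m + 2) t - real m * flat_exp (m + 1) t"
        unfolding e
        using 1 by (simp add: flat_exp_def power_add power2_eq_square mult.assoc mult.left_commute)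
      show ?thesis
        by (rule DERIV_cong[OF DERIV_mult[OF DERIV_power[OF u, of m]
                DERIV_fun_exp[OF DERIV_minus[OF u]]] e'])
    qed
    then show ?thesis
      by (rule has_field_derivative_transform_within_open[of _ _ _ "{0<..}"])
        (use 1 in \<open>auto simp: flat_exp_def\<close>)
  next
    case 2
    have "((\<lambda>t. 0) has_real_derivative 0) (at t)" by simp
    then have "(flat_exp m has_real_derivative 0) (at t)"
      by (rule has_field_derivative_transform_within_open[of _ _ _ "{..<0}"])
        (use 2 in \<open>auto simp: flat_exp_def\<close>)
    then show ?thesis using 2 by (simp add: flat_exp_def)
  next
    case 3
    have "((\<lambda>h. (flat_exp m (0 + h) - flat_exp m 0) / h) \<longlongrightarrow> 0) (at 0)"
    proof (rule Lim_transform_eventually[OF flat_exp_tendsto_0[of "m + 1"]])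
      show "\<forall>\<^sub>F h in at 0. flat_exp (m + 1) h = (flat_exp m (0 + h) - flat_exp m 0) / h"
        by (auto simp: eventually_at_filter flat_exp_def)
    qed
    then show ?thesis using 3 by (simp add: DERIV_def flat_exp_def)
  qed
qed

lemma Ck_on_flat_exp: "Ck_on k UNIV (flat_exp m)"
proof (induction k arbitrary: m)
  case 0
  have "isCont (flat_exp m) t" for t
    by (rule DERIV_isCont[OF flat_exp_deriv])
  then show ?case by (simp add: continuous_at_imp_continuous_on)
next
  case (Suc k)
  have "(flat_exp m has_derivative (\<lambda>v. (flat_exp (m + 2) t + (- real m) * flat_exp (m + 1) t) * v)) (at t)"
    for t
    using flat_exp_deriv[of m t] by (simp add: has_field_derivative_def)
  then show ?case
    by (intro Ck_on_SucI[where F = "\<lambda>t v. (flat_exp (m + 2) t + (- real m) * flat_exp (m + 1) t) * v"]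
        Ck_on_mult Ck_on_add Ck_on_const Suc.IH open_UNIV)
qed

text \<open>With \<open>h = flat_exp 0\<close>, the function \<open>h(1 - h(s - r\<^sup>2)/h(3r\<^sup>2))/h(1)\<close> of the squared distance \<open>s\<close>
  equals 1 as long as the inner \<open>h\<close> vanishes and 0 once the inner quotient reaches 1, which happens
  for \<open>s \<le> r\<^sup>2\<close> and for \<open>s \<ge> 4r\<^sup>2\<close>. Only sums, products and compositions of smooth
  functions occur.\<close>

lemma euclidean_bump:
  fixes x0 :: "real ^ 'n"
  assumes "r > 0"
  shows "\<exists>\<phi> :: real ^ 'n \<Rightarrow> real. (\<forall>k. Ck_on k UNIV \<phi>) \<and> (\<forall>x\<in>ball x0 r. \<phi> x = 1) \<and>
    (\<forall>x. x \<notin> cball x0 (2 * r) \<longrightarrow> \<phi> x = 0)"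
proof -
  let ?h = "flat_exp 0"
  define s where "s = (\<lambda>x::real^'n. \<Sum>i\<in>UNIV. (x $ i + - x0 $ i) * (x $ i + - x0 $ i))"
  have s_eq: "s x = (dist x0 x)\<^sup>2" for x
  proof -
    have "(dist x0 x)\<^sup>2 = (x - x0) \<bullet> (x - x0)"
      by (metis dist_commute dist_norm power2_norm_eq_inner)
    then show ?thesis by (simp add: s_def inner_vec_def)
  qed
  define C where "C = 1 / ?h (3 * r\<^sup>2)"
  define E where "E = 1 / ?h 1"
  define \<phi> where "\<phi> = (\<lambda>x. E * ?h (1 + (- C) * ?h (s x + - r\<^sup>2)))"
  have comp: "Ck_on k UNIV (\<lambda>x. ?h (f x))" if "Ck_on k UNIV f" for f :: "real^'n \<Rightarrow> real" and k
    by (rule Ck_on_compose[OF open_UNIV that Ck_on_flat_exp]) simp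
  have coordinate: "Ck_on k UNIV (\<lambda>x::real^'n. x $ i + - x0 $ i)" for k i
    by (rule Ck_on_add[OF open_UNIV Ck_on_bounded_linear[OF bounded_linear_vec_nth open_UNIV
          Ck_on_id[OF open_UNIV]] Ck_on_const[OF open_UNIV]])
  have "Ck_on k UNIV s" for k
    unfolding s_def by (intro Ck_on_sum Ck_on_mult coordinate open_UNIV)
  note smooth_s = Ck_on_add[OF open_UNIV this Ck_on_const[OF open_UNIV]]
  have "Ck_on k UNIV \<phi>" for k
    unfolding \<phi>_def
    by (rule Ck_on_mult[OF open_UNIV Ck_on_const[OF open_UNIV]] comp smooth_s
      Ck_on_add[OF open_UNIV Ck_on_const[OF open_UNIV]])+
  moreover have "\<phi> x = 1" if "x \<in> ball x0 r" for x
  proof -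
    have "s x \<le> r\<^sup>2"
      using that by (auto simp: s_eq intro!: power_mono)
    then show ?thesis by (simp add: \<phi>_def E_def flat_exp_def)
  qed
  moreover have "\<phi> x = 0" if "x \<notin> cball x0 (2 * r)" for x
  proof -
    have "(2 * r)\<^sup>2 \<le> s x"
      unfolding s_eq by (rule power_mono) (use that assms in auto)
    then have le: "3 * r\<^sup>2 \<le> s x - r\<^sup>2" by (simp add: power_mult_distrib)
    have r: "0 < 3 * r\<^sup>2" using assms by simp
    have pos: "0 < s x - r\<^sup>2" using le r by linarith
    have "1 / (s x - r\<^sup>2) \<le> 1 / (3 * r\<^sup>2)"
      by (rule divide_left_mono[OF le]) (use pos r in auto)
    then have "?h (3 * r\<^sup>2) \<le> ?h (s x - r\<^sup>2)"
      using pos r by (simp add: flat_exp_def)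
    moreover have "?h (3 * r\<^sup>2) > 0" using r by (simp add: flat_exp_def)
    ultimately have "1 + (- C) * ?h (s x + - r\<^sup>2) \<le> 0"
      by (simp add: C_def field_simps)
    then show ?thesis by (simp add: \<phi>_def flat_exp_def)
  qed
  ultimately show ?thesis by blast
qed


section \<open>Functions in a chart\<close>

locale atlas_chart =
  fixes A :: "('m::{t2_space,second_countable_topology}, 'n::finite) chart set"
    and c :: "('m, 'n) chart"
  assumes atlas: "smooth_atlas A" and chart: "c \<in> A"
begin

lemma open_dom: "open (dom_of c)"
  and open_image_dom: "open (snd c ` dom_of c)"
  and chart_homeomorphism: "homeomorphism (dom_of c) (snd c ` dom_of c) (snd c) (chart_inv c)"
  using atlas chart by (auto simp: smooth_atlas_def)

lemma chart_inv_chart: "p \<in> dom_of c \<Longrightarrow> chart_inv c (snd c p) = p"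
  and chart_chart_inv: "x \<in> snd c ` dom_of c \<Longrightarrow> snd c (chart_inv c x) = x"
  and chart_inv_in_dom: "x \<in> snd c ` dom_of c \<Longrightarrow> chart_inv c x \<in> dom_of c"
  using chart_homeomorphism by (auto simp: homeomorphism_def)

lemma open_chart_image:
  assumes "open U" "U \<subseteq> dom_of c"
  shows "open (snd c ` U)"
proof -
  have "snd c ` U = snd c ` dom_of c \<inter> chart_inv c -` U"
    using assms(2) chart_inv_chart by (force simp: image_iff)
  then show ?thesis
    using continuous_open_preimage[OF _ open_image_dom assms(1), of "chart_inv c"] chart_homeomorphism
    by (simp add: homeomorphism_def)
qed

lemma open_chart_preimage:
  assumes "open W" "W \<subseteq> snd c ` dom_of c"
  shows "open (chart_inv c ` W)"
proof -
  have "chart_inv c ` W = dom_of c \<inter> snd c -` W"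
    using assms(2) chart_inv_chart chart_chart_inv by (force simp: image_iff)
  then show ?thesis
    using continuous_open_preimage[OF _ open_dom assms(1), of "snd c"] chart_homeomorphism
    by (simp add: homeomorphism_def)
qed

lemma smooth_in_chartI:
  "(\<And>k. Ck_on k (snd c ` dom_of c) (\<lambda>x. f (chart_inv c x))) \<Longrightarrow> smooth_in_chart c f"
  by (simp add: smooth_in_chart_def smooth_on_def o_def)

lemma smooth_in_chartD:
  "smooth_in_chart c f \<Longrightarrow> Ck_on k (snd c ` dom_of c) (\<lambda>x. f (chart_inv c x))"
  by (simp add: smooth_in_chart_def smooth_on_def o_def)

lemma smooth_const: "smooth_in_chart c (\<lambda>p. r)"
  by (intro smooth_in_chartI Ck_on_const open_image_dom)

lemma smooth_add:
  "smooth_in_chart c f \<Longrightarrow> smooth_in_chart c g \<Longrightarrow> smooth_in_chart c (\<lambda>p. f p + g p)"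
  by (rule smooth_in_chartI) (rule Ck_on_add[OF open_image_dom smooth_in_chartD smooth_in_chartD])

lemma smooth_mult:
  "smooth_in_chart c f \<Longrightarrow> smooth_in_chart c g \<Longrightarrow> smooth_in_chart c (\<lambda>p. f p * g p)"
  by (rule smooth_in_chartI) (rule Ck_on_mult[OF open_image_dom smooth_in_chartD smooth_in_chartD])

lemma smooth_minus: "smooth_in_chart c f \<Longrightarrow> smooth_in_chart c (\<lambda>p. - f p)"
  using smooth_mult[OF smooth_const[of "-1"]] by simp

lemma smooth_diff:
  "smooth_in_chart c f \<Longrightarrow> smooth_in_chart c g \<Longrightarrow> smooth_in_chart c (\<lambda>p. f p - g p)"
  using smooth_add[OF _ smooth_minus] by simp

lemma smooth_sum:
  "(\<And>i. i \<in> I \<Longrightarrow> smooth_in_chart c (f i)) \<Longrightarrow> smooth_in_chart c (\<lambda>p. \<Sum>i\<in>I. f i p)"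
  by (induction I rule: infinite_finite_induct) (auto intro!: smooth_const smooth_add)

lemma smooth_coord: "smooth_in_chart c (coord c i)"
proof (rule smooth_in_chartI)
  fix k
  have "Ck_on k (snd c ` dom_of c) (\<lambda>x. x $ i)"
    by (rule Ck_on_bounded_linear[OF bounded_linear_vec_nth open_image_dom Ck_on_id[OF open_image_dom]])
  then show "Ck_on k (snd c ` dom_of c) (\<lambda>x. coord c i (chart_inv c x))"
    by (rule Ck_on_cong[OF open_image_dom, rotated]) (simp add: chart_chart_inv)
qed

lemma pd_eq_frechet:
  "x \<in> snd c ` dom_of c \<Longrightarrow>
    pd c i f (chart_inv c x) = frechet_derivative (\<lambda>x. f (chart_inv c x)) (at x) (axis i 1)"
  by (simp add: pd_def o_def chart_inv_in_dom chart_chart_inv)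

lemma smooth_pd:
  assumes "smooth_in_chart c f"
  shows "smooth_in_chart c (pd c i f)"
proof (rule smooth_in_chartI)
  fix k
  have "Ck_on k (snd c ` dom_of c)
      (\<lambda>x. frechet_derivative (\<lambda>x. f (chart_inv c x)) (at x) (axis i 1))"
    using smooth_in_chartD[OF assms, of "Suc k"] by simp
  then show "Ck_on k (snd c ` dom_of c) (\<lambda>x. pd c i f (chart_inv c x))"
    by (rule Ck_on_cong[OF open_image_dom, rotated]) (simp add: pd_eq_frechet)
qed

lemmas smooth_intros = smooth_const smooth_add smooth_mult smooth_minus smooth_diff smooth_sum smooth_pd

lemma smooth_has_derivative:
  assumes "smooth_in_chart c f" "p \<in> dom_of c"
  shows "((\<lambda>x. f (chart_inv c x)) has_derivative
    frechet_derivative (\<lambda>x. f (chart_inv c x)) (at (snd c p))) (at (snd c p))"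
  using smooth_in_chartD[OF assms(1), of "Suc 0"] assms(2) by (simp add: frechet_derivative_works)

lemma pd_eqI:
  assumes "p \<in> dom_of c" "((\<lambda>x. f (chart_inv c x)) has_derivative F) (at (snd c p))"
  shows "pd c i f p = F (axis i 1)"
  using assms frechet_derivative_at[OF assms(2)] by (simp add: pd_def o_def)

lemma pd_const: "pd c i (\<lambda>p. r) p = 0"
  by (simp add: pd_def o_def)

lemma pd_add:
  assumes "smooth_in_chart c f" "smooth_in_chart c g" "p \<in> dom_of c"
  shows "pd c i (\<lambda>p. f p + g p) p = pd c i f p + pd c i g p"
  using pd_eqI[OF assms(3) has_derivative_add[OF smooth_has_derivative[OF assms(1,3)]
        smooth_has_derivative[OF assms(2,3)]]] assms(3)
  by (simp add: pd_def o_def)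

lemma pd_mult:
  assumes "smooth_in_chart c f" "smooth_in_chart c g" "p \<in> dom_of c"
  shows "pd c i (\<lambda>p. f p * g p) p = f p * pd c i g p + pd c i f p * g p"
  using pd_eqI[OF assms(3) has_derivative_mult[OF smooth_has_derivative[OF assms(1,3)]
        smooth_has_derivative[OF assms(2,3)]]] assms(3)
  by (simp add: pd_def o_def chart_inv_chart)

lemma pd_minus:
  assumes "smooth_in_chart c f" "p \<in> dom_of c"
  shows "pd c i (\<lambda>p. - f p) p = - pd c i f p"
  using pd_mult[OF smooth_const[of "-1"] assms] by (simp add: pd_const)

lemma pd_diff:
  assumes "smooth_in_chart c f" "smooth_in_chart c g" "p \<in> dom_of c"
  shows "pd c i (\<lambda>p. f p - g p) p = pd c i f p - pd c i g p"
  using pd_add[OF assms(1) smooth_minus[OF assms(2)] assms(3)] pd_minus[OF assms(2,3)] by simp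

lemma pd_sum:
  assumes "\<And>j. j \<in> I \<Longrightarrow> smooth_in_chart c (f j)" "p \<in> dom_of c"
  shows "pd c i (\<lambda>p. \<Sum>j\<in>I. f j p) p = (\<Sum>j\<in>I. pd c i (f j) p)"
  using assms
  by (induction I rule: infinite_finite_induct) (auto simp: pd_const pd_add smooth_sum)

lemma pd_coord:
  assumes "p \<in> dom_of c"
  shows "pd c i (coord c j) p = (if i = j then 1 else 0)"
proof -
  have "((\<lambda>x. coord c j (chart_inv c x)) has_derivative (\<lambda>v. v $ j)) (at (snd c p))"
    by (rule has_derivative_transform_within_open[OF
          bounded_linear_imp_has_derivative[OF bounded_linear_vec_nth] open_image_dom])
      (use assms in \<open>auto simp: chart_chart_inv\<close>)
  from pd_eqI[OF assms this] show ?thesis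
    by (simp add: axis_def)
qed

lemma pd_local:
  assumes "open U" "p \<in> U" "U \<subseteq> dom_of c" "\<And>q. q \<in> U \<Longrightarrow> f q = g q"
  shows "pd c i f p = pd c i g p"
proof -
  have eq: "f (chart_inv c x) = g (chart_inv c x)" if "x \<in> snd c ` U" for x
    using that assms(3,4) chart_inv_chart by force
  have in_image: "snd c p \<in> snd c ` U"
    using assms(2) by simp
  have "((\<lambda>x. f (chart_inv c x)) has_derivative F) (at (snd c p)) \<longleftrightarrow>
      ((\<lambda>x. g (chart_inv c x)) has_derivative F) (at (snd c p))" for F
    using has_derivative_transform_within_open[OF _ open_chart_image[OF assms(1,3)] in_image]
      eq by metis
  then show ?thesis
    by (simp add: pd_def frechet_derivative_def o_def)
qed

lemma pd_cong:
  assumes "\<And>q. q \<in> dom_of c \<Longrightarrow> f q = g q"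
  shows "pd c i f p = pd c i g p"
proof (cases "p \<in> dom_of c")
  case True
  then show ?thesis using pd_local[OF open_dom True order_refl assms] by simp
qed (simp add: pd_def)

lemma pd_commute:
  assumes "smooth_in_chart c f" "p \<in> dom_of c"
  shows "pd c i (pd c j f) p = pd c j (pd c i f) p"
proof -
  let ?f = "\<lambda>x. f (chart_inv c x)"
  have "pd c i (pd c j f) p =
      frechet_derivative (\<lambda>y. frechet_derivative ?f (at y) (axis j 1)) (at (snd c p)) (axis i 1)" for i j
  proof (rule pd_eqI[OF assms(2)])
    have "((\<lambda>y. frechet_derivative ?f (at y) (axis j 1)) has_derivative
        frechet_derivative (\<lambda>y. frechet_derivative ?f (at y) (axis j 1)) (at (snd c p))) (at (snd c p))"
      using smooth_in_chartD[OF assms(1), of "Suc (Suc 0)"] assms(2)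
      by (simp add: frechet_derivative_works)
    then show "((\<lambda>x. pd c j f (chart_inv c x)) has_derivative
        frechet_derivative (\<lambda>y. frechet_derivative ?f (at y) (axis j 1)) (at (snd c p))) (at (snd c p))"
      by (rule has_derivative_transform_within_open[OF _ open_image_dom])
        (use assms(2) in \<open>auto simp: pd_eq_frechet\<close>)
  qed
  then show ?thesis
    using second_derivative_symmetric[OF open_image_dom _ smooth_in_chartD[OF assms(1)]] assms(2)
    by simp
qed

lemma smooth_cong:
  assumes "\<And>p. p \<in> dom_of c \<Longrightarrow> f p = g p"
  shows "smooth_in_chart c f \<longleftrightarrow> smooth_in_chart c g"
  using smooth_in_chart_cong[OF atlas chart, of f g] smooth_in_chart_cong[OF atlas chart, of g f] assms
  by fastforce

lemma smooth_locally:
  assumes "\<And>p. p \<in> dom_of c \<Longrightarrow> \<exists>U g. open U \<and> p \<in> U \<and> U \<subseteq> dom_of c \<and> smooth_in_chart c g \<and> (\<forall>q\<in>U. f q = g q)"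
  shows "smooth_in_chart c f"
proof (rule smooth_in_chartI, rule Ck_on_locally)
  fix k x assume "x \<in> snd c ` dom_of c"
  then obtain p where p: "p \<in> dom_of c" "x = snd c p" by blast
  obtain U g where U: "open U" "p \<in> U" "U \<subseteq> dom_of c" and g: "smooth_in_chart c g"
    and eq: "\<And>q. q \<in> U \<Longrightarrow> f q = g q"
    using assms[OF p(1)] by blast
  have "Ck_on k (snd c ` U) (\<lambda>x. f (chart_inv c x))"
  proof (rule Ck_on_cong[OF open_chart_image[OF U(1,3)]])
    show "Ck_on k (snd c ` U) (\<lambda>x. g (chart_inv c x))"
      using Ck_on_subset[OF smooth_in_chartD[OF g]] U(3) by blast
  next
    fix y assume "y \<in> snd c ` U"
    then show "g (chart_inv c y) = f (chart_inv c y)"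
      using eq U(3) chart_inv_chart by force
  qed
  then show "\<exists>U. open U \<and> x \<in> U \<and> Ck_on k U (\<lambda>x. f (chart_inv c x))"
    using open_chart_image[OF U(1,3)] U(2) p(2) by blast
qed

end

text \<open>Near points of the chart the extension is smooth because the transition maps are; near all
  other points it vanishes, a compact set being closed.\<close>

lemma smooth_extension:
  fixes A :: "('m::{t2_space,second_countable_topology}, 'n::finite) chart set"
  assumes A: "smooth_atlas A" and c: "c \<in> A" and f: "smooth_in_chart c f"
    and K: "compact K" "K \<subseteq> dom_of c" and zero: "\<And>p. p \<notin> K \<Longrightarrow> f p = 0"
  shows "f \<in> smooth_functions A"
  unfolding smooth_functions_def
proof (intro CollectI ballI)
  fix c' assume c': "c' \<in> A"
  interpret C: atlas_chart A c by unfold_locales (fact A c)+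
  interpret C': atlas_chart A c' by unfold_locales (fact A c')+
  show "smooth_in_chart c' f"
  proof (rule C'.smooth_in_chartI, rule Ck_on_locally)
    fix k x assume x: "x \<in> snd c' ` dom_of c'"
    show "\<exists>U. open U \<and> x \<in> U \<and> Ck_on k U (\<lambda>x. f (chart_inv c' x))"
    proof (cases "chart_inv c' x \<in> dom_of c")
      case True
      define U where "U = snd c' ` (dom_of c' \<inter> dom_of c)"
      have "open U"
        unfolding U_def by (intro C'.open_chart_image open_Int C'.open_dom C.open_dom) auto
      moreover have "x \<in> U"
        using True x C'.chart_inv_chart by (auto simp: U_def)
      moreover have "Ck_on k U (\<lambda>x. f (chart_inv c' x))"
      proof (rule Ck_on_cong[OF \<open>open U\<close>])
        have "Ck_on k U (snd c \<circ> chart_inv c')"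
          using A c c' by (auto simp: smooth_atlas_def smooth_on_def U_def)
        from Ck_on_compose[OF \<open>open U\<close> this C.smooth_in_chartD[OF f]]
        show "Ck_on k U (\<lambda>x. f (chart_inv c ((snd c \<circ> chart_inv c') x)))"
          using C'.chart_inv_chart by (force simp: U_def)
        show "f (chart_inv c ((snd c \<circ> chart_inv c') x)) = f (chart_inv c' x)" if "x \<in> U" for x
          using that C'.chart_inv_chart C.chart_inv_chart by (auto simp: U_def)
      qed
      ultimately show ?thesis by blast
    next
      case False
      define U where "U = snd c' ` (dom_of c' - K)"
      have "open U"
        unfolding U_def by (intro C'.open_chart_image open_Diff C'.open_dom compact_imp_closed K(1)) auto
      moreover have "x \<in> U"
        using False x C'.chart_inv_chart K(2) by (auto simp: U_def)
      moreover have "Ck_on k U (\<lambda>x. f (chart_inv c' x))"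
        by (rule Ck_on_cong[OF \<open>open U\<close> _ Ck_on_const[OF \<open>open U\<close>, of k 0]])
          (use zero C'.chart_inv_chart in \<open>auto simp: U_def\<close>)
      ultimately show ?thesis by blast
    qed
  qed
qed

context atlas_chart
begin

lemma bump_function:
  assumes "open U" "p \<in> U" "U \<subseteq> dom_of c"
  shows "\<exists>\<phi> V K. \<phi> \<in> smooth_functions A \<and> open V \<and> p \<in> V \<and> V \<subseteq> U \<and> (\<forall>q\<in>V. \<phi> q = 1) \<and>
    compact K \<and> K \<subseteq> U \<and> (\<forall>q. q \<notin> K \<longrightarrow> \<phi> q = 0)"
proof -
  let ?x = "snd c p"
  have "open (snd c ` U)" "?x \<in> snd c ` U"
    using open_chart_image[OF assms(1,3)] assms(2) by auto
  then obtain r' where r': "r' > 0" "cball ?x r' \<subseteq> snd c ` U"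
    using open_contains_cball by blast
  define r where "r = r' / 2"
  have r: "r > 0" "cball ?x (2 * r) \<subseteq> snd c ` U"
    using r' by (auto simp: r_def)
  obtain \<psi> :: "real ^ 'n \<Rightarrow> real" where \<psi>: "\<And>k. Ck_on k UNIV \<psi>" "\<And>x. x \<in> ball ?x r \<Longrightarrow> \<psi> x = 1"
    "\<And>x. x \<notin> cball ?x (2 * r) \<Longrightarrow> \<psi> x = 0"
    using euclidean_bump[OF r(1), of ?x] by blast
  define K where "K = chart_inv c ` cball ?x (2 * r)"
  define V where "V = chart_inv c ` ball ?x r"
  define \<phi> where "\<phi> = (\<lambda>q. if q \<in> dom_of c then \<psi> (snd c q) else 0)"
  have sub: "cball ?x (2 * r) \<subseteq> snd c ` dom_of c"
    using r(2) assms(3) by blast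
  have sub': "ball ?x r \<subseteq> cball ?x (2 * r)"
    using r(1) by (auto simp: less_imp_le)
  have KU: "K \<subseteq> U"
  proof
    fix q assume "q \<in> K"
    then obtain x where "x \<in> cball ?x (2 * r)" "q = chart_inv c x" by (auto simp: K_def)
    then show "q \<in> U" using r(2) chart_inv_chart assms(3) by force
  qed
  have K: "compact K"
    unfolding K_def
    using compact_continuous_image[OF _ compact_cball] continuous_on_subset[OF _ sub] chart_homeomorphism
    by (auto simp: homeomorphism_def)
  have zero: "\<phi> q = 0" if "q \<notin> K" for q
  proof (cases "q \<in> dom_of c")
    case True
    have "snd c q \<notin> cball ?x (2 * r)"
      using that chart_inv_chart[OF True] by (force simp: K_def)
    then show ?thesis using \<psi>(3) by (simp add: \<phi>_def)
  qed (simp add: \<phi>_def)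
  have one: "\<phi> q = 1" if "q \<in> V" for q
  proof -
    obtain x where x: "x \<in> ball ?x r" "q = chart_inv c x" using \<open>q \<in> V\<close> by (auto simp: V_def)
    then have "x \<in> snd c ` dom_of c" using sub sub' by blast
    then show ?thesis
      using x \<psi>(2) chart_chart_inv chart_inv_in_dom by (simp add: \<phi>_def)
  qed
  have "smooth_in_chart c \<phi>"
  proof (rule smooth_in_chartI)
    fix k
    show "Ck_on k (snd c ` dom_of c) (\<lambda>x. \<phi> (chart_inv c x))"
      by (rule Ck_on_cong[OF open_image_dom _ Ck_on_subset[OF \<psi>(1) subset_UNIV]])
        (simp add: \<phi>_def chart_chart_inv chart_inv_in_dom)
  qed
  then have "\<phi> \<in> smooth_functions A"
    by (rule smooth_extension[OF atlas chart _ K _ zero]) (use KU assms(3) in auto)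
  moreover have "open V"
    unfolding V_def by (rule open_chart_preimage) (use sub sub' in auto)
  moreover have "p \<in> V"
    using r(1) chart_inv_chart[of p] assms(2,3) unfolding V_def
    by (metis centre_in_ball image_eqI subsetD)
  moreover have "V \<subseteq> U"
    using KU sub' by (auto simp: V_def K_def)
  ultimately show ?thesis
    using one K KU zero by blast
qed

text \<open>Multiplying the coordinates by a bump function gives global functions that agree with them
  near a given point.\<close>

lemma local_coordinates:
  assumes "p \<in> dom_of c"
  obtains X V where "\<And>i. X i \<in> smooth_functions A" "open V" "p \<in> V" "V \<subseteq> dom_of c"
    "\<And>i q. q \<in> V \<Longrightarrow> X i q = coord c i q"
proof -
  obtain \<phi> V K where \<phi>: "\<phi> \<in> smooth_functions A" and V: "open V" "p \<in> V" "V \<subseteq> dom_of c"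
    and one: "\<And>q. q \<in> V \<Longrightarrow> \<phi> q = 1" and K: "compact K" "K \<subseteq> dom_of c" "\<And>q. q \<notin> K \<Longrightarrow> \<phi> q = 0"
    using bump_function[OF open_dom assms order_refl] by blast
  have "smooth_in_chart c \<phi>"
    using \<phi> chart by (simp add: smooth_functions_def)
  then have "(\<lambda>q. \<phi> q * coord c i q) \<in> smooth_functions A" for i
    by (intro smooth_extension[OF atlas chart _ K(1,2)] smooth_mult smooth_coord) (simp_all add: K(3))
  then show thesis
    using that[of "\<lambda>i q. \<phi> q * coord c i q" V] V one by simp
qed

end


section \<open>Flat connections in a chart\<close>

context atlas_chart
begin

text \<open>The calculations involve forms such as \<open>dx\<^sup>q\<close> that do not extend to the manifold. Forms on the
  chart domain are therefore represented by their component functions.\<close>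

definition ext_deriv1 :: "('n \<Rightarrow> 'm \<Rightarrow> real) \<Rightarrow> 'n \<Rightarrow> 'n \<Rightarrow> 'm \<Rightarrow> real" where
  "ext_deriv1 \<tau> i l p = pd c i (\<tau> l) p - pd c l (\<tau> i) p"

definition differential :: "('m \<Rightarrow> real) \<Rightarrow> 'n \<Rightarrow> 'm \<Rightarrow> real" where
  "differential f i = pd c i f"

definition wedge11 :: "('n \<Rightarrow> 'm \<Rightarrow> real) \<Rightarrow> ('n \<Rightarrow> 'm \<Rightarrow> real) \<Rightarrow> 'n \<Rightarrow> 'n \<Rightarrow> 'm \<Rightarrow> real" where
  "wedge11 \<alpha> \<beta> i l p = \<alpha> i p * \<beta> l p - \<alpha> l p * \<beta> i p"

lemma smooth_differential: "smooth_in_chart c f \<Longrightarrow> smooth_in_chart c (differential f i)"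
  by (simp add: differential_def smooth_pd)

lemma ext_deriv1_differential:
  assumes "smooth_in_chart c f" "p \<in> dom_of c"
  shows "ext_deriv1 (differential f) i l p = 0"
  using pd_commute[OF assms] by (simp add: ext_deriv1_def differential_def)

lemma smooth_wedge11:
  assumes "\<And>l. smooth_in_chart c (\<alpha> l)" "\<And>l. smooth_in_chart c (\<beta> l)"
  shows "smooth_in_chart c (wedge11 \<alpha> \<beta> i l)"
  unfolding wedge11_def[abs_def] by (intro smooth_intros assms)

end

locale flat_chart = atlas_chart A c
  for A :: "('m::{t2_space,second_countable_topology}, 'n::finite) chart set"
    and c :: "('m, 'n) chart" +
  fixes \<Gamma> :: "('m, 'n) christoffel"
  assumes smooth_\<Gamma>: "smooth_in_chart c (\<Gamma> c k i j)"
    and flat: "p \<in> dom_of c \<Longrightarrow> curvature \<Gamma> c l i j k p = 0"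
begin

lemma curvature_eq:
  "curvature \<Gamma> c l i j k p = pd c j (\<Gamma> c l k i) p - pd c k (\<Gamma> c l j i) p +
    (\<Sum>m\<in>UNIV. \<Gamma> c l j m p * \<Gamma> c m k i p) - (\<Sum>m\<in>UNIV. \<Gamma> c l k m p * \<Gamma> c m j i p)"
proof -
  have 1: "cov_vec \<Gamma> c (coord_field j) W l p = pd c j (W l) p + (\<Sum>i\<in>UNIV. \<Gamma> c l j i p * W i p)" for j W l p
    by (simp add: cov_vec_def coord_field_def if_distrib[of "\<lambda>x. x * _"] sum.delta cong: if_cong)
  have 2: "cov_vec \<Gamma> c (coord_field j) (coord_field i) l = \<Gamma> c l j i" for i j l
    by (rule ext, subst 1) (simp add: coord_field_def pd_const if_distrib[of "\<lambda>x. _ * x"] cong: if_cong)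
  have 3: "lie_bracket c (coord_field j) (coord_field k) = (\<lambda>l p. 0)"
    by (intro ext) (simp add: lie_bracket_def coord_field_def pd_const)
  show ?thesis
    unfolding curvature_def curvature_op_def
    by (simp add: 1 2 3 cov_vec_def[of \<Gamma> c "\<lambda>l p. 0"])
qed

text \<open>The index \<open>q\<close> is a parameter of the operators \<open>nab q\<close> (\<open>\<nabla>\<^sub>q\<close> on one-forms) and \<open>nab2 q\<close> (\<open>\<nabla>\<^sub>q\<close> on
  two-forms), not a tensor index: \<open>nab i (nab q \<tau>)\<close> has no Christoffel term for \<open>q\<close>. With this
  reading flatness says that the operators commute, torsion or not.\<close>

definition nab :: "'n \<Rightarrow> ('n \<Rightarrow> 'm \<Rightarrow> real) \<Rightarrow> 'n \<Rightarrow> 'm \<Rightarrow> real" where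
  "nab q \<tau> l p = pd c q (\<tau> l) p - (\<Sum>m\<in>UNIV. \<Gamma> c m q l p * \<tau> m p)"

definition nab2 :: "'n \<Rightarrow> ('n \<Rightarrow> 'n \<Rightarrow> 'm \<Rightarrow> real) \<Rightarrow> 'n \<Rightarrow> 'n \<Rightarrow> 'm \<Rightarrow> real" where
  "nab2 q \<rho> i l p = pd c q (\<rho> i l) p - (\<Sum>m\<in>UNIV. \<Gamma> c m q i p * \<rho> m l p)
    - (\<Sum>m\<in>UNIV. \<Gamma> c m q l p * \<rho> i m p)"

lemma smooth_nab: "(\<And>l. smooth_in_chart c (\<tau> l)) \<Longrightarrow> smooth_in_chart c (nab q \<tau> l)"
  unfolding nab_def[abs_def] by (intro smooth_intros smooth_\<Gamma>)

lemma smooth_torsion: "smooth_in_chart c (torsion \<Gamma> c k i j)"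
  unfolding torsion_def[abs_def] by (intro smooth_intros smooth_\<Gamma>)

lemma torsion_deriv_eq:
  "torsion_deriv \<Gamma> c k i j l p = pd c l (torsion \<Gamma> c k i j) p
    + (\<Sum>n\<in>UNIV. \<Gamma> c k l n p * torsion \<Gamma> c n i j p)
    - (\<Sum>n\<in>UNIV. \<Gamma> c n l i p * torsion \<Gamma> c k n j p)
    - (\<Sum>n\<in>UNIV. \<Gamma> c n l j p * torsion \<Gamma> c k i n p)"
  by (simp add: torsion_deriv_def cov_deriv_def lessThan_Suc numeral_2_eq_2)

lemma smooth_torsion_deriv: "smooth_in_chart c (torsion_deriv \<Gamma> c k i j l)"
proof -
  have "torsion_deriv \<Gamma> c k i j l = (\<lambda>p. pd c l (torsion \<Gamma> c k i j) p
    + (\<Sum>n\<in>UNIV. \<Gamma> c k l n p * torsion \<Gamma> c n i j p)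
    - (\<Sum>n\<in>UNIV. \<Gamma> c n l i p * torsion \<Gamma> c k n j p)
    - (\<Sum>n\<in>UNIV. \<Gamma> c n l j p * torsion \<Gamma> c k i n p))"
    by (rule ext) (rule torsion_deriv_eq)
  then show ?thesis
    by (simp only:) (intro smooth_intros smooth_\<Gamma> smooth_torsion)
qed

lemma nab_commute:
  assumes \<tau>: "\<And>l. smooth_in_chart c (\<tau> l)" and p: "p \<in> dom_of c"
  shows "nab i (nab q \<tau>) l p = nab q (nab i \<tau>) l p"
proof -
  have expand: "nab i (nab q \<tau>) l p = pd c i (pd c q (\<tau> l)) p
      - (\<Sum>m\<in>UNIV. \<Gamma> c m q l p * pd c i (\<tau> m) p) - (\<Sum>m\<in>UNIV. \<Gamma> c m i l p * pd c q (\<tau> m) p)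
      - (\<Sum>n\<in>UNIV. (pd c i (\<Gamma> c n q l) p - (\<Sum>m\<in>UNIV. \<Gamma> c n q m p * \<Gamma> c m i l p)) * \<tau> n p)" for i q
  proof -
    have "pd c i (nab q \<tau> l) p = pd c i (pd c q (\<tau> l)) p
        - (\<Sum>m\<in>UNIV. \<Gamma> c m q l p * pd c i (\<tau> m) p + pd c i (\<Gamma> c m q l) p * \<tau> m p)"
      unfolding nab_def[abs_def]
      by (simp add: pd_diff pd_sum pd_mult smooth_intros smooth_\<Gamma> \<tau> p)
    moreover have "(\<Sum>m\<in>UNIV. \<Gamma> c m i l p * (\<Sum>n\<in>UNIV. \<Gamma> c n q m p * \<tau> n p)) =
        (\<Sum>n\<in>UNIV. (\<Sum>m\<in>UNIV. \<Gamma> c n q m p * \<Gamma> c m i l p) * \<tau> n p)"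
      by (simp add: sum_distrib_left sum_distrib_right) (subst sum.swap, simp add: mult_ac)
    ultimately show ?thesis
      unfolding nab_def[of i]
      by (simp add: nab_def[of q] right_diff_distrib left_diff_distrib sum_subtractf sum.distrib)
  qed
  have "pd c i (\<Gamma> c n q l) p - (\<Sum>m\<in>UNIV. \<Gamma> c n q m p * \<Gamma> c m i l p) =
      pd c q (\<Gamma> c n i l) p - (\<Sum>m\<in>UNIV. \<Gamma> c n i m p * \<Gamma> c m q l p)" for n
    using flat[OF p, of n l i q] by (simp add: curvature_eq)
  then show ?thesis
    by (simp add: expand pd_commute[OF \<tau> p, where i = i and j = q])
qed

lemma nab_antisym:
  "nab i \<tau> l p - nab l \<tau> i p = ext_deriv1 \<tau> i l p - (\<Sum>m\<in>UNIV. torsion \<Gamma> c m i l p * \<tau> m p)"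
  by (simp add: nab_def ext_deriv1_def torsion_def left_diff_distrib sum_subtractf)

text \<open>The first Bianchi identity for a flat connection with torsion: in the cyclic sum the
  derivatives of the Christoffel symbols pair up to curvatures.\<close>

lemma bianchi:
  assumes p: "p \<in> dom_of c"
  shows "torsion_deriv \<Gamma> c k j i l p + torsion_deriv \<Gamma> c k i l j p + torsion_deriv \<Gamma> c k l j i p =
    (\<Sum>n\<in>UNIV. torsion \<Gamma> c n l j p * torsion \<Gamma> c k i n p)
    + (\<Sum>n\<in>UNIV. torsion \<Gamma> c n j i p * torsion \<Gamma> c k l n p)
    + (\<Sum>n\<in>UNIV. torsion \<Gamma> c n i l p * torsion \<Gamma> c k j n p)"
proof -
  have pdT: "pd c l (torsion \<Gamma> c k i j) p = pd c l (\<Gamma> c k i j) p - pd c l (\<Gamma> c k j i) p" for l i j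
    unfolding torsion_def[abs_def] by (rule pd_diff[OF smooth_\<Gamma> smooth_\<Gamma> p])
  note flat' = flat[OF p, unfolded curvature_eq]
  show ?thesis
    using flat'[where l = k and i = i and j = l and k = j] flat'[where l = k and i = j and j = i and k = l]
      flat'[where l = k and i = l and j = j and k = i]
    unfolding torsion_deriv_eq pdT
    by (simp add: torsion_def algebra_simps sum.distrib sum_subtractf)
qed


text \<open>Since the \<open>nab q\<close> commute, \<open>d\<close> can be moved past \<open>nab q\<close> after writing it through \<open>nab\<close> and the
  torsion (\<open>nab_antisym\<close>). Besides products of Christoffel symbols with \<open>\<nabla>\<tau>\<close>, only the
  covariant derivative of the torsion remains.\<close>

lemma ext_deriv1_nab:
  assumes \<tau>: "\<And>l. smooth_in_chart c (\<tau> l)" and p: "p \<in> dom_of c"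
  shows "ext_deriv1 (nab q \<tau>) i l p - nab2 q (ext_deriv1 \<tau>) i l p =
    (\<Sum>m\<in>UNIV. \<Gamma> c m q i p * nab m \<tau> l p) - (\<Sum>m\<in>UNIV. \<Gamma> c m q l p * nab m \<tau> i p)
    - (\<Sum>m\<in>UNIV. torsion_deriv \<Gamma> c m i l q p * \<tau> m p)"
proof -
  have pd_nab: "pd c i (nab q \<tau> l) p = pd c q (nab i \<tau> l) p
      - (\<Sum>m\<in>UNIV. \<Gamma> c m q l p * nab i \<tau> m p) + (\<Sum>m\<in>UNIV. \<Gamma> c m i l p * nab q \<tau> m p)" for i l
    using nab_commute[where \<tau> = \<tau>, OF \<tau> p, where i = i and q = q and l = l] by (simp add: nab_def[of i "nab q \<tau>"] nab_def[of q "nab i \<tau>"])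
  have smooth_d: "smooth_in_chart c (ext_deriv1 \<tau> i l)"
    unfolding ext_deriv1_def[abs_def] by (intro smooth_intros \<tau>)
  have "pd c q (nab i \<tau> l) p - pd c q (nab l \<tau> i) p = pd c q (\<lambda>p. nab i \<tau> l p - nab l \<tau> i p) p"
    by (simp add: pd_diff smooth_nab \<tau> p)
  also have "\<dots> = pd c q (ext_deriv1 \<tau> i l) p
      - (\<Sum>m\<in>UNIV. torsion \<Gamma> c m i l p * pd c q (\<tau> m) p + pd c q (torsion \<Gamma> c m i l) p * \<tau> m p)"
    unfolding nab_antisym
    by (simp add: pd_diff pd_sum pd_mult smooth_intros smooth_torsion smooth_d \<tau> p)
  finally have d_antisym: "pd c q (nab i \<tau> l) p - pd c q (nab l \<tau> i) p = pd c q (ext_deriv1 \<tau> i l) p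
      - (\<Sum>m\<in>UNIV. torsion \<Gamma> c m i l p * pd c q (\<tau> m) p)
      - (\<Sum>m\<in>UNIV. pd c q (torsion \<Gamma> c m i l) p * \<tau> m p)"
    by (simp add: sum.distrib)
  have d: "ext_deriv1 \<tau> i l p = nab i \<tau> l p - nab l \<tau> i p + (\<Sum>n\<in>UNIV. torsion \<Gamma> c n i l p * \<tau> n p)" for i l
    using nab_antisym[where i = i and \<tau> = \<tau> and l = l and p = p] by simp
  have T: "(\<Sum>m\<in>UNIV. torsion \<Gamma> c m i l p * pd c q (\<tau> m) p) =
      (\<Sum>m\<in>UNIV. torsion \<Gamma> c m i l p * nab q \<tau> m p)
      + (\<Sum>m\<in>UNIV. (\<Sum>n\<in>UNIV. \<Gamma> c m q n p * torsion \<Gamma> c n i l p) * \<tau> m p)"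
  proof -
    have "(\<Sum>m\<in>UNIV. torsion \<Gamma> c m i l p * (\<Sum>n\<in>UNIV. \<Gamma> c n q m p * \<tau> n p)) =
        (\<Sum>n\<in>UNIV. (\<Sum>m\<in>UNIV. \<Gamma> c n q m p * torsion \<Gamma> c m i l p) * \<tau> n p)"
      by (simp add: sum_distrib_left sum_distrib_right) (subst sum.swap, simp add: mult_ac)
    then show ?thesis
      by (simp add: nab_def algebra_simps sum_subtractf)
  qed
  have G1: "(\<Sum>m\<in>UNIV. \<Gamma> c m q i p * (\<Sum>n\<in>UNIV. torsion \<Gamma> c n m l p * \<tau> n p)) =
      (\<Sum>m\<in>UNIV. (\<Sum>n\<in>UNIV. \<Gamma> c n q i p * torsion \<Gamma> c m n l p) * \<tau> m p)" for i
    by (simp add: sum_distrib_left sum_distrib_right) (subst sum.swap, simp add: mult_ac)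
  have G2: "(\<Sum>m\<in>UNIV. \<Gamma> c m q l p * (\<Sum>n\<in>UNIV. torsion \<Gamma> c n i m p * \<tau> n p)) =
      (\<Sum>m\<in>UNIV. (\<Sum>n\<in>UNIV. \<Gamma> c n q l p * torsion \<Gamma> c m i n p) * \<tau> m p)"
    by (simp add: sum_distrib_left sum_distrib_right) (subst sum.swap, simp add: mult_ac)
  have nab2_d: "nab2 q (ext_deriv1 \<tau>) i l p = pd c q (ext_deriv1 \<tau> i l) p
      - (\<Sum>m\<in>UNIV. \<Gamma> c m q i p * nab m \<tau> l p) + (\<Sum>m\<in>UNIV. \<Gamma> c m q i p * nab l \<tau> m p)
      - (\<Sum>m\<in>UNIV. (\<Sum>n\<in>UNIV. \<Gamma> c n q i p * torsion \<Gamma> c m n l p) * \<tau> m p)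
      - (\<Sum>m\<in>UNIV. \<Gamma> c m q l p * nab i \<tau> m p) + (\<Sum>m\<in>UNIV. \<Gamma> c m q l p * nab m \<tau> i p)
      - (\<Sum>m\<in>UNIV. (\<Sum>n\<in>UNIV. \<Gamma> c n q l p * torsion \<Gamma> c m i n p) * \<tau> m p)"
    unfolding nab2_def d
    by (simp add: distrib_left right_diff_distrib sum.distrib sum_subtractf G1 G2)
  have "(\<Sum>m\<in>UNIV. torsion_deriv \<Gamma> c m i l q p * \<tau> m p) =
      (\<Sum>m\<in>UNIV. pd c q (torsion \<Gamma> c m i l) p * \<tau> m p)
      + (\<Sum>m\<in>UNIV. (\<Sum>n\<in>UNIV. \<Gamma> c m q n p * torsion \<Gamma> c n i l p) * \<tau> m p)
      - (\<Sum>m\<in>UNIV. (\<Sum>n\<in>UNIV. \<Gamma> c n q i p * torsion \<Gamma> c m n l p) * \<tau> m p)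
      - (\<Sum>m\<in>UNIV. (\<Sum>n\<in>UNIV. \<Gamma> c n q l p * torsion \<Gamma> c m i n p) * \<tau> m p)"
    unfolding torsion_deriv_eq by (simp only: distrib_right left_diff_distrib sum.distrib sum_subtractf)
  moreover have "(\<Sum>m\<in>UNIV. torsion \<Gamma> c m i l p * nab q \<tau> m p) =
      (\<Sum>m\<in>UNIV. \<Gamma> c m i l p * nab q \<tau> m p) - (\<Sum>m\<in>UNIV. \<Gamma> c m l i p * nab q \<tau> m p)"
    by (simp add: torsion_def left_diff_distrib sum_subtractf)
  ultimately show ?thesis
    using d_antisym T by (simp only: ext_deriv1_def[of "nab q \<tau>"] pd_nab nab2_d)
qed

definition along :: "('n \<Rightarrow> 'm \<Rightarrow> real) \<Rightarrow> ('n \<Rightarrow> 'm \<Rightarrow> real) \<Rightarrow> 'n \<Rightarrow> 'm \<Rightarrow> real" where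
  "along v \<tau> l p = (\<Sum>q\<in>UNIV. v q p * nab q \<tau> l p)"

definition along2 :: "('n \<Rightarrow> 'm \<Rightarrow> real) \<Rightarrow> ('n \<Rightarrow> 'n \<Rightarrow> 'm \<Rightarrow> real) \<Rightarrow> 'n \<Rightarrow> 'n \<Rightarrow> 'm \<Rightarrow> real" where
  "along2 v \<rho> i l p = (\<Sum>q\<in>UNIV. v q p * nab2 q \<rho> i l p)"

lemma smooth_along:
  assumes "\<And>q. smooth_in_chart c (v q)" "\<And>l. smooth_in_chart c (\<tau> l)"
  shows "smooth_in_chart c (along v \<tau> l)"
  unfolding along_def[abs_def] by (intro smooth_intros smooth_nab assms)

lemma nab_along:
  assumes v: "\<And>q. smooth_in_chart c (v q)" and \<tau>: "\<And>l. smooth_in_chart c (\<tau> l)"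
    and p: "p \<in> dom_of c"
  shows "nab r (along v \<tau>) l p = along v (nab r \<tau>) l p + (\<Sum>s\<in>UNIV. pd c r (v s) p * nab s \<tau> l p)"
proof -
  have "pd c r (along v \<tau> l) p =
      (\<Sum>s\<in>UNIV. v s p * pd c r (nab s \<tau> l) p) + (\<Sum>s\<in>UNIV. pd c r (v s) p * nab s \<tau> l p)"
    unfolding along_def[abs_def]
    by (simp add: pd_sum pd_mult smooth_intros smooth_nab v \<tau> p sum.distrib)
  moreover have "(\<Sum>m\<in>UNIV. \<Gamma> c m r l p * along v \<tau> m p) =
      (\<Sum>s\<in>UNIV. v s p * (\<Sum>m\<in>UNIV. \<Gamma> c m r l p * nab s \<tau> m p))"
    unfolding along_def
    by (simp add: sum_distrib_left) (subst sum.swap, simp add: mult_ac)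
  ultimately have "nab r (along v \<tau>) l p = (\<Sum>s\<in>UNIV. v s p * nab r (nab s \<tau>) l p)
      + (\<Sum>s\<in>UNIV. pd c r (v s) p * nab s \<tau> l p)"
    by (simp add: nab_def[of r] right_diff_distrib sum_subtractf)
  then show ?thesis
    by (simp add: along_def nab_commute[where \<tau> = \<tau>, OF \<tau> p, where i = r])
qed

text \<open>The Christoffel terms of \<open>ext_deriv1_nab\<close> combine with the derivatives of \<open>v\<close> to the one-forms
  \<open>dv\<^sup>m - \<nabla>\<^sub>v dx\<^sup>m\<close>; for a Hamiltonian \<open>v\<close> these are known from \<open>compatible_function\<close> below.\<close>

lemma ext_deriv1_along:
  assumes v: "\<And>q. smooth_in_chart c (v q)" and \<tau>: "\<And>l. smooth_in_chart c (\<tau> l)"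
    and p: "p \<in> dom_of c"
  shows "ext_deriv1 (along v \<tau>) i l p - along2 v (ext_deriv1 \<tau>) i l p =
    (\<Sum>m\<in>UNIV. (pd c i (v m) p + (\<Sum>q\<in>UNIV. v q p * \<Gamma> c m q i p)) * nab m \<tau> l p)
    - (\<Sum>m\<in>UNIV. (pd c l (v m) p + (\<Sum>q\<in>UNIV. v q p * \<Gamma> c m q l p)) * nab m \<tau> i p)
    - (\<Sum>q\<in>UNIV. v q p * (\<Sum>m\<in>UNIV. torsion_deriv \<Gamma> c m i l q p * \<tau> m p))"
proof -
  have "pd c i (along v \<tau> l) p =
      (\<Sum>s\<in>UNIV. v s p * pd c i (nab s \<tau> l) p) + (\<Sum>s\<in>UNIV. pd c i (v s) p * nab s \<tau> l p)" for i l
    unfolding along_def[abs_def]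
    by (simp add: pd_sum pd_mult smooth_intros smooth_nab v \<tau> p sum.distrib)
  then have "ext_deriv1 (along v \<tau>) i l p = (\<Sum>s\<in>UNIV. v s p * ext_deriv1 (nab s \<tau>) i l p)
      + (\<Sum>s\<in>UNIV. pd c i (v s) p * nab s \<tau> l p) - (\<Sum>s\<in>UNIV. pd c l (v s) p * nab s \<tau> i p)"
    by (simp add: ext_deriv1_def right_diff_distrib sum_subtractf)
  moreover have "(\<Sum>s\<in>UNIV. v s p * ext_deriv1 (nab s \<tau>) i l p) - along2 v (ext_deriv1 \<tau>) i l p =
      (\<Sum>s\<in>UNIV. v s p * (ext_deriv1 (nab s \<tau>) i l p - nab2 s (ext_deriv1 \<tau>) i l p))"
    by (simp add: along2_def right_diff_distrib sum_subtractf)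
  moreover have "\<dots> = (\<Sum>s\<in>UNIV. v s p * (\<Sum>m\<in>UNIV. \<Gamma> c m s i p * nab m \<tau> l p))
      - (\<Sum>s\<in>UNIV. v s p * (\<Sum>m\<in>UNIV. \<Gamma> c m s l p * nab m \<tau> i p))
      - (\<Sum>q\<in>UNIV. v q p * (\<Sum>m\<in>UNIV. torsion_deriv \<Gamma> c m i l q p * \<tau> m p))"
    by (simp add: ext_deriv1_nab[where \<tau> = \<tau>, OF \<tau> p] right_diff_distrib sum_subtractf)
  moreover have "(\<Sum>s\<in>UNIV. v s p * (\<Sum>m\<in>UNIV. \<Gamma> c m s i p * nab m \<tau> l p)) =
      (\<Sum>m\<in>UNIV. (\<Sum>q\<in>UNIV. v q p * \<Gamma> c m q i p) * nab m \<tau> l p)" for i l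
    by (simp add: sum_distrib_left sum_distrib_right) (subst sum.swap, simp add: mult_ac)
  ultimately show ?thesis
    by (simp add: distrib_right sum.distrib)
qed

lemma along2_ext_deriv1_differential:
  assumes "smooth_in_chart c f" "p \<in> dom_of c"
  shows "along2 v (ext_deriv1 (differential f)) i l p = 0"
proof -
  have "pd c m (ext_deriv1 (differential f) i l) p = pd c m (\<lambda>q. 0) p" for m i l
    by (rule pd_cong) (simp add: ext_deriv1_differential assms(1))
  then show ?thesis
    by (simp add: along2_def nab2_def ext_deriv1_differential assms pd_const)
qed

end


section \<open>The Jacobi expression of a flat connection\<close>

locale flat_poisson_chart = flat_chart A c \<Gamma>
  for A :: "('m::{t2_space,second_countable_topology}, 'n::finite) chart set"
    and c :: "('m, 'n) chart" and \<Gamma> :: "('m, 'n) christoffel" +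
  fixes \<omega> :: "('m, 'n) bivector"
  assumes smooth_\<omega>: "smooth_in_chart c (\<omega> c i j)"
    and \<omega>_antisym: "p \<in> dom_of c \<Longrightarrow> \<omega> c j i p = - \<omega> c i j p"
begin

text \<open>The components of the Hamiltonian vector field \<open>{f,-}\<close>.\<close>

definition ham :: "('m \<Rightarrow> real) \<Rightarrow> 'n \<Rightarrow> 'm \<Rightarrow> real" where
  "ham f q p = (\<Sum>k\<in>UNIV. \<omega> c k q p * pd c k f p)"

text \<open>\<open>Q_form\<close> and \<open>S_form\<close> are, up to sign, the two parts of the first-order bracket of \<open>df\<close> with a
  one-form: a bidifferential operator built from the bivector, and a tensor.\<close>

definition Q_form :: "('n \<Rightarrow> 'm \<Rightarrow> real) \<Rightarrow> ('n \<Rightarrow> 'm \<Rightarrow> real) \<Rightarrow> 'n \<Rightarrow> 'n \<Rightarrow> 'm \<Rightarrow> real" where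
  "Q_form \<alpha> \<beta> i l p = (\<Sum>m\<in>UNIV. \<Sum>r\<in>UNIV. \<omega> c m r p * wedge11 (nab r \<alpha>) (nab m \<beta>) i l p)"

definition S_tensor :: "'n \<Rightarrow> 'n \<Rightarrow> 'n \<Rightarrow> 'n \<Rightarrow> 'm \<Rightarrow> real" where
  "S_tensor j k i l p = (\<Sum>q\<in>UNIV. \<omega> c j q p * torsion_deriv \<Gamma> c k i l q p)"

definition S_form :: "('n \<Rightarrow> 'm \<Rightarrow> real) \<Rightarrow> ('n \<Rightarrow> 'm \<Rightarrow> real) \<Rightarrow> 'n \<Rightarrow> 'n \<Rightarrow> 'm \<Rightarrow> real" where
  "S_form \<alpha> \<beta> i l p = (\<Sum>j\<in>UNIV. \<Sum>k\<in>UNIV. S_tensor j k i l p * (\<alpha> j p * \<beta> k p))"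

text \<open>In components: \<open>d{f,x\<^sup>m} = L\<^sub>f dx\<^sup>m - L\<^sub>m df\<close> for all coordinates \<open>x\<^sup>m\<close>, where \<open>L\<^sub>f\<close> and \<open>L\<^sub>m\<close> are the
  covariant derivatives along \<open>{f,-}\<close> and \<open>{x\<^sup>m,-}\<close>. Note that \<open>\<nabla>\<^sub>q dx\<^sup>m\<close> has components
  \<open>- \<Gamma>\<^bsup>m\<^esup>\<^bsub>qi\<^esub>\<close>.\<close>

definition compatible_function :: "('m \<Rightarrow> real) \<Rightarrow> bool" where
  "compatible_function f \<longleftrightarrow> (\<forall>p\<in>dom_of c. \<forall>m i.
     pd c i (ham f m) p + (\<Sum>q\<in>UNIV. ham f q p * \<Gamma> c m q i p) =
       - (\<Sum>r\<in>UNIV. \<omega> c m r p * nab r (differential f) i p))"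

text \<open>The Lie derivative of the bivector along \<open>v\<close> vanishes.\<close>

definition poisson_field :: "('n \<Rightarrow> 'm \<Rightarrow> real) \<Rightarrow> bool" where
  "poisson_field v \<longleftrightarrow> (\<forall>p\<in>dom_of c. \<forall>q r.
     (\<Sum>m\<in>UNIV. v m p * pd c m (\<omega> c q r) p) =
       (\<Sum>s\<in>UNIV. \<omega> c q s p * pd c s (v r) p) + (\<Sum>s\<in>UNIV. \<omega> c s r p * pd c s (v q) p))"

lemma smooth_ham: "smooth_in_chart c f \<Longrightarrow> smooth_in_chart c (ham f q)"
  unfolding ham_def[abs_def] by (intro smooth_intros smooth_\<omega>)

lemma smooth_S_tensor: "smooth_in_chart c (S_tensor j k i l)"
  unfolding S_tensor_def[abs_def] by (intro smooth_intros smooth_\<omega> smooth_torsion_deriv)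

lemma smooth_Q_form:
  "(\<And>l. smooth_in_chart c (\<alpha> l)) \<Longrightarrow> (\<And>l. smooth_in_chart c (\<beta> l)) \<Longrightarrow> smooth_in_chart c (Q_form \<alpha> \<beta> i l)"
  unfolding Q_form_def[abs_def] by (intro smooth_intros smooth_\<omega> smooth_wedge11 smooth_nab)

lemma smooth_S_form:
  "(\<And>l. smooth_in_chart c (\<alpha> l)) \<Longrightarrow> (\<And>l. smooth_in_chart c (\<beta> l)) \<Longrightarrow> smooth_in_chart c (S_form \<alpha> \<beta> i l)"
  unfolding S_form_def[abs_def] by (intro smooth_intros smooth_S_tensor)

lemma ext_deriv1_along_ham:
  assumes f: "smooth_in_chart c f" "compatible_function f"
    and \<tau>: "\<And>l. smooth_in_chart c (\<tau> l)" and p: "p \<in> dom_of c"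
  shows "ext_deriv1 (along (ham f) \<tau>) i l p - along2 (ham f) (ext_deriv1 \<tau>) i l p =
    - Q_form (differential f) \<tau> i l p - S_form (differential f) \<tau> i l p"
proof -
  let ?\<alpha> = "differential f"
  have compat: "pd c i (ham f m) p + (\<Sum>q\<in>UNIV. ham f q p * \<Gamma> c m q i p) =
       - (\<Sum>r\<in>UNIV. \<omega> c m r p * nab r ?\<alpha> i p)" for m i
    using f(2) p by (simp add: compatible_function_def)
  have "(\<Sum>q\<in>UNIV. ham f q p * (\<Sum>m\<in>UNIV. torsion_deriv \<Gamma> c m i l q p * \<tau> m p)) =
      (\<Sum>q\<in>UNIV. \<Sum>j\<in>UNIV. \<Sum>k\<in>UNIV. \<omega> c j q p * torsion_deriv \<Gamma> c k i l q p * (?\<alpha> j p * \<tau> k p))"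
    by (simp add: ham_def differential_def sum_distrib_left sum_distrib_right)
      (subst sum.swap, simp add: mult_ac)
  also have "\<dots> = (\<Sum>j\<in>UNIV. \<Sum>q\<in>UNIV. \<Sum>k\<in>UNIV. \<omega> c j q p * torsion_deriv \<Gamma> c k i l q p * (?\<alpha> j p * \<tau> k p))"
    by (rule sum.swap)
  also have "\<dots> = S_form ?\<alpha> \<tau> i l p"
    unfolding S_form_def S_tensor_def sum_distrib_right
    by (intro sum.cong refl sum.swap)
  finally show ?thesis
    by (simp add: ext_deriv1_along[where \<tau> = \<tau>, OF smooth_ham[OF f(1)] \<tau> p] compat Q_form_def wedge11_def
        right_diff_distrib sum_subtractf sum_distrib_right mult.assoc sum_negf)
qed

lemma Q_form_sym:
  assumes "p \<in> dom_of c"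
  shows "Q_form \<alpha> \<beta> i l p = Q_form \<beta> \<alpha> i l p"
proof -
  have "Q_form \<beta> \<alpha> i l p = (\<Sum>r\<in>UNIV. \<Sum>m\<in>UNIV. \<omega> c m r p * wedge11 (nab r \<beta>) (nab m \<alpha>) i l p)"
    unfolding Q_form_def by (rule sum.swap)
  moreover have "\<omega> c m r p * wedge11 (nab r \<beta>) (nab m \<alpha>) i l p =
      \<omega> c r m p * wedge11 (nab m \<alpha>) (nab r \<beta>) i l p" for m r
    by (simp add: wedge11_def \<omega>_antisym[OF assms, of m r] algebra_simps)
  ultimately show ?thesis by (simp add: Q_form_def)
qed

lemma nab2_wedge11:
  assumes "\<And>l. smooth_in_chart c (\<alpha> l)" "\<And>l. smooth_in_chart c (\<beta> l)" "p \<in> dom_of c"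
  shows "nab2 q (wedge11 \<alpha> \<beta>) i l p = wedge11 (nab q \<alpha>) \<beta> i l p + wedge11 \<alpha> (nab q \<beta>) i l p"
proof -
  have "pd c q (wedge11 \<alpha> \<beta> i l) p = \<alpha> i p * pd c q (\<beta> l) p + pd c q (\<alpha> i) p * \<beta> l p
      - (\<alpha> l p * pd c q (\<beta> i) p + pd c q (\<alpha> l) p * \<beta> i p)"
    unfolding wedge11_def[abs_def] by (simp add: pd_diff pd_mult smooth_intros assms)
  then show ?thesis
    by (simp add: nab2_def nab_def wedge11_def algebra_simps sum_subtractf sum_distrib_left)
qed

lemma along2_wedge11:
  assumes "\<And>l. smooth_in_chart c (\<alpha> l)" "\<And>l. smooth_in_chart c (\<beta> l)" "p \<in> dom_of c"
  shows "along2 v (wedge11 \<alpha> \<beta>) i l p = wedge11 (along v \<alpha>) \<beta> i l p + wedge11 \<alpha> (along v \<beta>) i l p"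
  unfolding along2_def nab2_wedge11[where \<alpha> = \<alpha> and \<beta> = \<beta>, OF assms]
  by (simp add: wedge11_def along_def algebra_simps sum_subtractf sum.distrib sum_distrib_left)

lemma along2_scale:
  assumes "smooth_in_chart c f" "\<And>i l. smooth_in_chart c (\<rho> i l)" "p \<in> dom_of c"
  shows "along2 v (\<lambda>i l p. f p * \<rho> i l p) i l p =
    (\<Sum>q\<in>UNIV. v q p * pd c q f p) * \<rho> i l p + f p * along2 v \<rho> i l p"
proof -
  have "nab2 q (\<lambda>i l p. f p * \<rho> i l p) i l p = pd c q f p * \<rho> i l p + f p * nab2 q \<rho> i l p" for q
    by (simp add: nab2_def pd_mult assms algebra_simps sum_distrib_left)
  then show ?thesis
    by (simp add: along2_def distrib_left sum.distrib sum_distrib_left sum_distrib_right mult_ac)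
qed

lemma along2_sum:
  assumes "\<And>j i l. smooth_in_chart c (\<rho> j i l)" "p \<in> dom_of c"
  shows "along2 v (\<lambda>i l p. \<Sum>j\<in>J. \<rho> j i l p) i l p = (\<Sum>j\<in>J. along2 v (\<rho> j) i l p)"
proof -
  have swap: "(\<Sum>m\<in>UNIV. \<Sum>j\<in>J. g m j) = (\<Sum>j\<in>J. \<Sum>m\<in>UNIV. g m j)" for g :: "'n \<Rightarrow> _ \<Rightarrow> real"
    by (rule sum.swap)
  have "nab2 q (\<lambda>i l p. \<Sum>j\<in>J. \<rho> j i l p) i l p = (\<Sum>j\<in>J. nab2 q (\<rho> j) i l p)" for q
    by (simp add: nab2_def pd_sum assms sum_subtractf sum_distrib_left swap)
  then show ?thesis
    by (simp add: along2_def sum_distrib_left swap)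
qed

text \<open>Since the operators \<open>nab q\<close> commute, the commutator of \<open>\<nabla>\<^sub>v\<close> with \<open>nab r\<close> only differentiates
  the components of \<open>v\<close> (\<open>nab_along\<close>). Together with the derivative of the coefficients \<open>\<omega>\<close> these
  terms form the Lie derivative of the bivector.\<close>

lemma along2_Q_form:
  assumes v: "\<And>q. smooth_in_chart c (v q)" "poisson_field v"
    and \<alpha>: "\<And>l. smooth_in_chart c (\<alpha> l)" and \<beta>: "\<And>l. smooth_in_chart c (\<beta> l)" and p: "p \<in> dom_of c"
  shows "along2 v (Q_form \<alpha> \<beta>) i l p = Q_form (along v \<alpha>) \<beta> i l p + Q_form \<alpha> (along v \<beta>) i l p"
proof -
  let ?W = "\<lambda>m r. wedge11 (nab r \<alpha>) (nab m \<beta>) i l p"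
  have sW: "smooth_in_chart c (wedge11 (nab r \<alpha>) (nab m \<beta>) i l)" for m r i l
    by (intro smooth_wedge11 smooth_nab \<alpha> \<beta>)
  have along_nab: "along v (nab r \<tau>) j p = nab r (along v \<tau>) j p - (\<Sum>s\<in>UNIV. pd c r (v s) p * nab s \<tau> j p)"
    if "\<And>l. smooth_in_chart c (\<tau> l)" for r \<tau> j
    using nab_along[where \<tau> = \<tau> and v = v, OF v(1) that p] by simp
  have W1: "wedge11 (along v (nab r \<alpha>)) (nab m \<beta>) i l p =
      wedge11 (nab r (along v \<alpha>)) (nab m \<beta>) i l p - (\<Sum>s\<in>UNIV. pd c r (v s) p * ?W m s)" for m r
    by (simp add: wedge11_def along_nab \<alpha> algebra_simps sum_subtractf sum_distrib_left)
  have W2: "wedge11 (nab r \<alpha>) (along v (nab m \<beta>)) i l p =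
      wedge11 (nab r \<alpha>) (nab m (along v \<beta>)) i l p - (\<Sum>s\<in>UNIV. pd c m (v s) p * ?W s r)" for m r
    by (simp add: wedge11_def along_nab \<beta> algebra_simps sum_subtractf sum_distrib_left)
  have "along2 v (Q_form \<alpha> \<beta>) i l p = (\<Sum>m\<in>UNIV. \<Sum>r\<in>UNIV.
      along2 v (\<lambda>i l p. \<omega> c m r p * wedge11 (nab r \<alpha>) (nab m \<beta>) i l p) i l p)"
    unfolding Q_form_def[abs_def] by (simp add: along2_sum smooth_intros smooth_\<omega> sW p)
  also have "\<dots> = (\<Sum>m\<in>UNIV. \<Sum>r\<in>UNIV. (\<Sum>q\<in>UNIV. v q p * pd c q (\<omega> c m r) p) * ?W m r
      + \<omega> c m r p * (wedge11 (nab r (along v \<alpha>)) (nab m \<beta>) i l p - (\<Sum>s\<in>UNIV. pd c r (v s) p * ?W m s)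
      + (wedge11 (nab r \<alpha>) (nab m (along v \<beta>)) i l p - (\<Sum>s\<in>UNIV. pd c m (v s) p * ?W s r))))"
    by (simp add: along2_scale smooth_\<omega> sW p along2_wedge11 smooth_nab \<alpha> \<beta> W1 W2)
  also have "\<dots> = Q_form (along v \<alpha>) \<beta> i l p + Q_form \<alpha> (along v \<beta>) i l p
      + ((\<Sum>m\<in>UNIV. \<Sum>r\<in>UNIV. (\<Sum>q\<in>UNIV. v q p * pd c q (\<omega> c m r) p) * ?W m r)
      - (\<Sum>m\<in>UNIV. \<Sum>r\<in>UNIV. \<Sum>s\<in>UNIV. \<omega> c m r p * pd c r (v s) p * ?W m s)
      - (\<Sum>m\<in>UNIV. \<Sum>r\<in>UNIV. \<Sum>s\<in>UNIV. \<omega> c m r p * pd c m (v s) p * ?W s r))"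
    by (simp add: Q_form_def distrib_left right_diff_distrib sum.distrib sum_subtractf sum_distrib_left mult.assoc)
  also have "(\<Sum>m\<in>UNIV. \<Sum>r\<in>UNIV. \<Sum>s\<in>UNIV. \<omega> c m r p * pd c r (v s) p * ?W m s) =
      (\<Sum>m\<in>UNIV. \<Sum>r\<in>UNIV. (\<Sum>s\<in>UNIV. \<omega> c m s p * pd c s (v r) p) * ?W m r)"
    unfolding sum_distrib_right by (intro sum.cong refl sum.swap)
  also have "(\<Sum>m\<in>UNIV. \<Sum>r\<in>UNIV. \<Sum>s\<in>UNIV. \<omega> c m r p * pd c m (v s) p * ?W s r) =
      (\<Sum>m\<in>UNIV. \<Sum>r\<in>UNIV. (\<Sum>s\<in>UNIV. \<omega> c s r p * pd c s (v m) p) * ?W m r)"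
  proof -
    have "(\<Sum>m\<in>UNIV. \<Sum>r\<in>UNIV. \<Sum>s\<in>UNIV. \<omega> c m r p * pd c m (v s) p * ?W s r) =
        (\<Sum>m\<in>UNIV. \<Sum>s\<in>UNIV. \<Sum>r\<in>UNIV. \<omega> c m r p * pd c m (v s) p * ?W s r)"
      by (intro sum.cong refl sum.swap)
    also have "\<dots> = (\<Sum>s\<in>UNIV. \<Sum>m\<in>UNIV. \<Sum>r\<in>UNIV. \<omega> c m r p * pd c m (v s) p * ?W s r)"
      by (rule sum.swap)
    also have "\<dots> = (\<Sum>s\<in>UNIV. \<Sum>r\<in>UNIV. \<Sum>m\<in>UNIV. \<omega> c m r p * pd c m (v s) p * ?W s r)"
      by (intro sum.cong refl sum.swap)
    finally show ?thesis by (simp add: sum_distrib_right)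
  qed
  finally show ?thesis
    using v(2) p by (simp add: poisson_field_def distrib_right sum.distrib)
qed

text \<open>The hypothesis \<open>parallel\<close> says that \<open>S_tensor\<close> is covariantly constant at \<open>p\<close>.\<close>

lemma along2_S_form:
  assumes parallel: "\<And>q j k i l. pd c q (S_tensor j k i l) p =
      - (\<Sum>n\<in>UNIV. \<Gamma> c j q n p * S_tensor n k i l p) - (\<Sum>n\<in>UNIV. \<Gamma> c k q n p * S_tensor j n i l p)
      + (\<Sum>n\<in>UNIV. \<Gamma> c n q i p * S_tensor j k n l p) + (\<Sum>n\<in>UNIV. \<Gamma> c n q l p * S_tensor j k i n p)"
    and \<alpha>: "\<And>l. smooth_in_chart c (\<alpha> l)" and \<beta>: "\<And>l. smooth_in_chart c (\<beta> l)" and p: "p \<in> dom_of c"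
  shows "along2 v (S_form \<alpha> \<beta>) i l p = S_form (along v \<alpha>) \<beta> i l p + S_form \<alpha> (along v \<beta>) i l p"
proof -
  have swap3: "(\<Sum>m\<in>UNIV. \<Sum>j\<in>UNIV. \<Sum>k\<in>UNIV. g m j k) = (\<Sum>j\<in>UNIV. \<Sum>k\<in>UNIV. \<Sum>m\<in>UNIV. g m j k)"
    for g :: "'n \<Rightarrow> 'n \<Rightarrow> 'n \<Rightarrow> real"
    by (subst sum.swap) (intro sum.cong refl sum.swap)
  have "nab2 q (S_form \<alpha> \<beta>) i l p = S_form (nab q \<alpha>) \<beta> i l p + S_form \<alpha> (nab q \<beta>) i l p" for q
  proof -
    have pdS: "pd c q (S_form \<alpha> \<beta> i l) p = (\<Sum>j\<in>UNIV. \<Sum>k\<in>UNIV.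
        S_tensor j k i l p * (\<alpha> j p * pd c q (\<beta> k) p + pd c q (\<alpha> j) p * \<beta> k p)
        + pd c q (S_tensor j k i l) p * (\<alpha> j p * \<beta> k p))"
      unfolding S_form_def[abs_def] by (simp add: pd_sum pd_mult smooth_intros smooth_S_tensor \<alpha> \<beta> p)
    have g1: "(\<Sum>m\<in>UNIV. \<Gamma> c m q i p * S_form \<alpha> \<beta> m l p) =
        (\<Sum>j\<in>UNIV. \<Sum>k\<in>UNIV. (\<Sum>n\<in>UNIV. \<Gamma> c n q i p * S_tensor j k n l p) * (\<alpha> j p * \<beta> k p))" for i
      by (simp only: S_form_def sum_distrib_left sum_distrib_right mult.assoc) (rule swap3)
    have g2: "(\<Sum>m\<in>UNIV. \<Gamma> c m q l p * S_form \<alpha> \<beta> i m p) =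
        (\<Sum>j\<in>UNIV. \<Sum>k\<in>UNIV. (\<Sum>n\<in>UNIV. \<Gamma> c n q l p * S_tensor j k i n p) * (\<alpha> j p * \<beta> k p))" for i
      by (simp only: S_form_def sum_distrib_left sum_distrib_right mult.assoc) (rule swap3)
    have g3: "(\<Sum>j\<in>UNIV. \<Sum>k\<in>UNIV. S_tensor j k i l p * ((\<Sum>n\<in>UNIV. \<Gamma> c n q j p * \<alpha> n p) * \<beta> k p)) =
        (\<Sum>j\<in>UNIV. \<Sum>k\<in>UNIV. (\<Sum>n\<in>UNIV. \<Gamma> c j q n p * S_tensor n k i l p) * (\<alpha> j p * \<beta> k p))"
    proof -
      have "(\<Sum>j\<in>UNIV. \<Sum>k\<in>UNIV. S_tensor j k i l p * ((\<Sum>n\<in>UNIV. \<Gamma> c n q j p * \<alpha> n p) * \<beta> k p)) =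
          (\<Sum>j\<in>UNIV. \<Sum>k\<in>UNIV. \<Sum>n\<in>UNIV. \<Gamma> c n q j p * S_tensor j k i l p * (\<alpha> n p * \<beta> k p))"
        by (simp add: sum_distrib_left sum_distrib_right mult_ac)
      also have "\<dots> = (\<Sum>j\<in>UNIV. \<Sum>n\<in>UNIV. \<Sum>k\<in>UNIV. \<Gamma> c n q j p * S_tensor j k i l p * (\<alpha> n p * \<beta> k p))"
        by (intro sum.cong refl sum.swap)
      also have "\<dots> = (\<Sum>n\<in>UNIV. \<Sum>k\<in>UNIV. \<Sum>j\<in>UNIV. \<Gamma> c n q j p * S_tensor j k i l p * (\<alpha> n p * \<beta> k p))"
        by (rule swap3)
      finally show ?thesis by (simp add: sum_distrib_right)
    qed
    have g4: "(\<Sum>j\<in>UNIV. \<Sum>k\<in>UNIV. S_tensor j k i l p * (\<alpha> j p * (\<Sum>n\<in>UNIV. \<Gamma> c n q k p * \<beta> n p))) =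
        (\<Sum>j\<in>UNIV. \<Sum>k\<in>UNIV. (\<Sum>n\<in>UNIV. \<Gamma> c k q n p * S_tensor j n i l p) * (\<alpha> j p * \<beta> k p))"
    proof -
      have "(\<Sum>j\<in>UNIV. \<Sum>k\<in>UNIV. S_tensor j k i l p * (\<alpha> j p * (\<Sum>n\<in>UNIV. \<Gamma> c n q k p * \<beta> n p))) =
          (\<Sum>j\<in>UNIV. \<Sum>k\<in>UNIV. \<Sum>n\<in>UNIV. \<Gamma> c n q k p * S_tensor j k i l p * (\<alpha> j p * \<beta> n p))"
        by (simp add: sum_distrib_left sum_distrib_right mult_ac)
      also have "\<dots> = (\<Sum>j\<in>UNIV. \<Sum>n\<in>UNIV. \<Sum>k\<in>UNIV. \<Gamma> c n q k p * S_tensor j k i l p * (\<alpha> j p * \<beta> n p))"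
        by (intro sum.cong refl sum.swap)
      finally show ?thesis by (simp add: sum_distrib_right)
    qed
    show ?thesis
      unfolding nab2_def pdS g1 g2 parallel
      unfolding S_form_def nab_def left_diff_distrib right_diff_distrib sum_subtractf g3 g4
      by (simp add: distrib_left distrib_right left_diff_distrib sum.distrib sum_subtractf sum_negf)
  qed
  moreover have "(\<Sum>q\<in>UNIV. v q p * S_form (nab q \<alpha>) \<beta> i l p) = S_form (along v \<alpha>) \<beta> i l p"
    unfolding S_form_def along_def sum_distrib_left sum_distrib_right
    by (subst swap3) (simp add: mult_ac)
  moreover have "(\<Sum>q\<in>UNIV. v q p * S_form \<alpha> (nab q \<beta>) i l p) = S_form \<alpha> (along v \<beta>) i l p"
    unfolding S_form_def along_def sum_distrib_left sum_distrib_right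
    by (subst swap3) (simp add: mult_ac)
  ultimately show ?thesis
    by (simp add: along2_def distrib_left sum.distrib)
qed

text \<open>In \<open>E\<close> the antisymmetrisation turns two of the three cyclic terms of the Bianchi identity into
  the third.\<close>

lemma S_tensor_eq_E:
  assumes p: "p \<in> dom_of c"
  shows "S_tensor j k i l p = E_tensor \<omega> \<Gamma> c j k l i p - E_tensor \<omega> \<Gamma> c j k i l p"
proof -
  have T: "torsion \<Gamma> c k a b p = - torsion \<Gamma> c k b a p" for k a b
    by (simp add: torsion_def)
  have antisym: "torsion_deriv \<Gamma> c k a b q p = - torsion_deriv \<Gamma> c k b a q p" for k a b q
  proof -
    have "pd c q (torsion \<Gamma> c k a b) p = - pd c q (torsion \<Gamma> c k b a) p"
      using pd_minus[OF smooth_torsion[of k b a] p, of q] by (simp add: torsion_def[abs_def])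
    then show ?thesis
      unfolding torsion_deriv_eq
      using T[of _ a b] T[of k _ b] T[of k a _] by (simp add: sum_negf)
  qed
  have "N_tensor \<Gamma> c k m i l p - N_tensor \<Gamma> c k m l i p = - torsion_deriv \<Gamma> c k i l m p" for m
  proof -
    have "N_tensor \<Gamma> c k m i l p - N_tensor \<Gamma> c k m l i p =
        torsion_deriv \<Gamma> c k m i l p + torsion_deriv \<Gamma> c k l m i p
        + (\<Sum>n\<in>UNIV. torsion \<Gamma> c n m l p * torsion \<Gamma> c k i n p)
        - (\<Sum>n\<in>UNIV. torsion \<Gamma> c n m i p * torsion \<Gamma> c k l n p)
        + (\<Sum>n\<in>UNIV. torsion \<Gamma> c n l i p * torsion \<Gamma> c k m n p)"
      using antisym[of k m l i] T[of _ i l] by (simp add: N_tensor_def flat[OF p] sum_negf)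
    also have "\<dots> = torsion_deriv \<Gamma> c k m i l p + torsion_deriv \<Gamma> c k l m i p
        - (torsion_deriv \<Gamma> c k m i l p + torsion_deriv \<Gamma> c k i l m p + torsion_deriv \<Gamma> c k l m i p)"
      unfolding bianchi[OF p] using T[of _ m l] T[of _ l i] by (simp add: sum_negf)
    finally show ?thesis by simp
  qed
  then have "torsion_deriv \<Gamma> c k i l m p = N_tensor \<Gamma> c k m l i p - N_tensor \<Gamma> c k m i l p" for m
    by (simp add: algebra_simps eq_neg_iff_add_eq_0)
  then have "S_tensor j k i l p =
      (\<Sum>m\<in>UNIV. \<omega> c j m p * N_tensor \<Gamma> c k m l i p) - (\<Sum>m\<in>UNIV. \<omega> c j m p * N_tensor \<Gamma> c k m i l p)"
    by (simp add: S_tensor_def right_diff_distrib sum_subtractf)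
  then show ?thesis
    by (simp add: E_tensor_def \<omega>_antisym[OF p, of _ j] sum_negf)
qed

lemma smooth_E_tensor: "smooth_in_chart c (E_tensor \<omega> \<Gamma> c n k l i)"
proof -
  have "smooth_in_chart c (N_tensor \<Gamma> c k j i l)" for j
  proof (subst smooth_cong)
    show "smooth_in_chart c (\<lambda>p. torsion_deriv \<Gamma> c k j i l p
        + (\<Sum>n\<in>UNIV. torsion \<Gamma> c n j l p * torsion \<Gamma> c k i n p)
        + 1 / 2 * (\<Sum>n\<in>UNIV. torsion \<Gamma> c n l i p * torsion \<Gamma> c k j n p))"
      by (intro smooth_intros smooth_torsion smooth_torsion_deriv)
  qed (simp add: N_tensor_def flat)
  then show ?thesis
    unfolding E_tensor_def[abs_def] by (intro smooth_intros smooth_\<omega>)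
qed

lemma S_tensor_parallel:
  assumes E: "\<And>n k l i m. cov_deriv \<Gamma> c m
      (\<lambda>U L. E_tensor \<omega> \<Gamma> c (U ! 0) (U ! 1) (L ! 0) (L ! 1)) [n, k] [l, i] p = 0"
    and p: "p \<in> dom_of c"
  shows "pd c q (S_tensor j k i l) p =
      - (\<Sum>n\<in>UNIV. \<Gamma> c j q n p * S_tensor n k i l p) - (\<Sum>n\<in>UNIV. \<Gamma> c k q n p * S_tensor j n i l p)
      + (\<Sum>n\<in>UNIV. \<Gamma> c n q i p * S_tensor j k n l p) + (\<Sum>n\<in>UNIV. \<Gamma> c n q l p * S_tensor j k i n p)"
proof -
  let ?E = "E_tensor \<omega> \<Gamma> c"
  have "pd c q (S_tensor j k i l) p = pd c q (\<lambda>p. ?E j k l i p - ?E j k i l p) p"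
    by (rule pd_cong) (rule S_tensor_eq_E)
  also have "\<dots> = pd c q (?E j k l i) p - pd c q (?E j k i l) p"
    by (rule pd_diff[OF smooth_E_tensor smooth_E_tensor p])
  finally have 1: "pd c q (S_tensor j k i l) p = pd c q (?E j k l i) p - pd c q (?E j k i l) p" .
  have E': "pd c q (?E j k l i) p = - (\<Sum>n\<in>UNIV. \<Gamma> c j q n p * ?E n k l i p)
      - (\<Sum>n\<in>UNIV. \<Gamma> c k q n p * ?E j n l i p)
      + (\<Sum>n\<in>UNIV. \<Gamma> c n q l p * ?E j k n i p) + (\<Sum>n\<in>UNIV. \<Gamma> c n q i p * ?E j k l n p)" for l i
    using E[of q j k l i] by (simp add: cov_deriv_def lessThan_Suc numeral_2_eq_2)
  show ?thesis
    unfolding 1 E' S_tensor_eq_E[OF p] by (simp add: right_diff_distrib sum_subtractf)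
qed

text \<open>The three terms are the iterated brackets \<open>[x,[dy,dz]]\<close>, \<open>[dz,[x,dy]]\<close> and \<open>[dy,[x,dz]]\<close>. Each
  bracket \<open>[df,\<tau>]\<close> is \<open>-Q(df,\<tau>) - S(df,\<tau>)\<close>, and both bilinear operators are symmetric and invariant
  under the derivative along \<open>{x,-}\<close>.\<close>

lemma jacobi_expression_zero:
  assumes smooth: "smooth_in_chart c x" "smooth_in_chart c y" "smooth_in_chart c z"
    and compat: "compatible_function y" "compatible_function z"
    and poisson: "poisson_field (ham x)"
    and S_sym: "\<And>p j k i l. p \<in> dom_of c \<Longrightarrow> S_tensor j k i l p = S_tensor k j i l p"
    and E: "\<And>p n k l i m. p \<in> dom_of c \<Longrightarrow> cov_deriv \<Gamma> c m
      (\<lambda>U L. E_tensor \<omega> \<Gamma> c (U ! 0) (U ! 1) (L ! 0) (L ! 1)) [n, k] [l, i] p = 0"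
    and p: "p \<in> dom_of c"
  shows "along2 (ham x) (ext_deriv1 (along (ham y) (differential z))) i l p
    - (ext_deriv1 (along (ham z) (along (ham x) (differential y))) i l p
       - along2 (ham z) (ext_deriv1 (along (ham x) (differential y))) i l p)
    - (ext_deriv1 (along (ham y) (along (ham x) (differential z))) i l p
       - along2 (ham y) (ext_deriv1 (along (ham x) (differential z))) i l p) = 0"
proof -
  let ?dy = "differential y" and ?dz = "differential z" and ?v = "ham x"
  have sQ: "smooth_in_chart c (Q_form ?dy ?dz i l)" for i l
    by (intro smooth_Q_form smooth_differential smooth)
  have sS: "smooth_in_chart c (S_form ?dy ?dz i l)" for i l
    by (intro smooth_S_form smooth_differential smooth)
  have bracket: "ext_deriv1 (along (ham y) ?dz) i l q = - Q_form ?dy ?dz i l q - S_form ?dy ?dz i l q"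
    if "q \<in> dom_of c" for i l q
    using ext_deriv1_along_ham[where \<tau> = ?dz and i = i and l = l,
        OF smooth(2) compat(1) smooth_differential[OF smooth(3)] that]
      along2_ext_deriv1_differential[OF smooth(3) that] by simp
  have pd_bracket: "pd c m (ext_deriv1 (along (ham y) ?dz) i l) p =
      - pd c m (Q_form ?dy ?dz i l) p - pd c m (S_form ?dy ?dz i l) p" for m i l
  proof -
    have "pd c m (ext_deriv1 (along (ham y) ?dz) i l) p =
        pd c m (\<lambda>q. - Q_form ?dy ?dz i l q - S_form ?dy ?dz i l q) p"
      by (rule pd_cong) (rule bracket)
    then show ?thesis by (simp add: pd_diff pd_minus smooth_minus sQ sS p)
  qed
  have "along2 ?v (ext_deriv1 (along (ham y) ?dz)) i l p =
      - along2 ?v (Q_form ?dy ?dz) i l p - along2 ?v (S_form ?dy ?dz) i l p"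
    unfolding along2_def nab2_def bracket[OF p] pd_bracket
    by (simp add: algebra_simps sum_subtractf sum.distrib sum_negf sum_distrib_left)
  also have "\<dots> = - (Q_form (along ?v ?dy) ?dz i l p + Q_form ?dy (along ?v ?dz) i l p)
      - (S_form (along ?v ?dy) ?dz i l p + S_form ?dy (along ?v ?dz) i l p)"
    by (simp only: along2_Q_form[where \<alpha> = ?dy and \<beta> = ?dz, OF smooth_ham[OF smooth(1)] poisson smooth_differential[OF smooth(2)]
        smooth_differential[OF smooth(3)] p] along2_S_form[where \<alpha> = ?dy and \<beta> = ?dz, OF S_tensor_parallel[OF E[OF p] p]
        smooth_differential[OF smooth(2)] smooth_differential[OF smooth(3)] p])
  finally have 1: "along2 ?v (ext_deriv1 (along (ham y) ?dz)) i l p =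
      - (Q_form (along ?v ?dy) ?dz i l p + Q_form ?dy (along ?v ?dz) i l p)
      - (S_form (along ?v ?dy) ?dz i l p + S_form ?dy (along ?v ?dz) i l p)" .
  have S_form_sym: "S_form \<alpha> \<beta> i l p = S_form \<beta> \<alpha> i l p" for \<alpha> \<beta>
  proof -
    have "S_form \<beta> \<alpha> i l p = (\<Sum>k\<in>UNIV. \<Sum>j\<in>UNIV. S_tensor j k i l p * (\<beta> j p * \<alpha> k p))"
      unfolding S_form_def by (rule sum.swap)
    then show ?thesis
      unfolding S_form_def by (simp add: S_sym[OF p] mult.commute)
  qed
  have along_smooth: "smooth_in_chart c (along ?v (differential f) l)" if "smooth_in_chart c f" for f l
    by (intro smooth_along smooth_ham smooth_differential smooth that)
  show ?thesis
    unfolding 1 ext_deriv1_along_ham[where \<tau> = "along ?v ?dy", OF smooth(3) compat(2) along_smooth[OF smooth(2)] p]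
      ext_deriv1_along_ham[where \<tau> = "along ?v ?dz", OF smooth(2) compat(1) along_smooth[OF smooth(3)] p]
    using Q_form_sym[OF p, of ?dz "along ?v ?dy" i l] S_form_sym[of ?dz "along ?v ?dy"] by simp
qed

end


section \<open>First-order brackets of a deformation\<close>

lemma forms_antisym:
  assumes "\<tau> \<in> forms A n" "a < length I" "b < length I" "a \<noteq> b"
  shows "\<tau> c (I[a := I ! b, b := I ! a]) p = - \<tau> c I p"
proof -
  have "\<forall>c I p a b. a < length I \<and> b < length I \<and> a \<noteq> b \<longrightarrow>
      \<tau> c (I[a := I ! b, b := I ! a]) p = - \<tau> c I p"
    using assms(1) unfolding forms_def mem_Collect_eq by (elim conjE)
  then show ?thesis using assms(2-4) by blast
qed

lemma forms_linear:
  fixes A :: "('m::{t2_space,second_countable_topology}, 'n::finite) chart set"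
  assumes A: "smooth_atlas A" and \<tau>: "\<tau> \<in> forms A n" and \<eta>: "\<eta> \<in> forms A n"
  shows "(\<lambda>c I p. a * \<tau> c I p + b * \<eta> c I p) \<in> forms A n"
  unfolding forms_def mem_Collect_eq
proof (intro conjI allI ballI impI)
  fix c and I :: "'n list" and p assume "\<not> (c \<in> A \<and> p \<in> dom_of c \<and> length I = n)"
  then show "a * \<tau> c I p + b * \<eta> c I p = 0"
    using forms_zero[OF \<tau>] forms_zero[OF \<eta>] by simp
next
  fix c and I :: "'n list" assume c: "c \<in> A"
  interpret atlas_chart A c by unfold_locales (fact A c)+
  show "smooth_in_chart c (\<lambda>p. a * \<tau> c I p + b * \<eta> c I p)"
    by (intro smooth_intros forms_smooth[OF \<tau> c] forms_smooth[OF \<eta> c])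
next
  fix c and I :: "'n list" and p k l assume "k < length I \<and> l < length I \<and> k \<noteq> l"
  then show "a * \<tau> c (I[k := I ! l, l := I ! k]) p + b * \<eta> c (I[k := I ! l, l := I ! k]) p =
      - (a * \<tau> c I p + b * \<eta> c I p)"
    by (simp add: forms_antisym[OF \<tau>] forms_antisym[OF \<eta>])
next
  fix c c' p and I :: "'n list" assume "c \<in> A" "c' \<in> A" "p \<in> dom_of c \<inter> dom_of c'"
  then have t: "\<xi> c' I p = (\<Sum>J | length J = length I.
      (\<Prod>a<length I. pd c' (I ! a) (coord c (J ! a)) p) * \<xi> c J p)" if "\<xi> \<in> forms A n" for \<xi>
    using forms_transform[OF that] by blast
  show "a * \<tau> c' I p + b * \<eta> c' I p = (\<Sum>J | length J = length I.
      (\<Prod>a<length I. pd c' (I ! a) (coord c (J ! a)) p) * (a * \<tau> c J p + b * \<eta> c J p))"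
    unfolding t[OF \<tau>] t[OF \<eta>] by (simp add: sum_distrib_left sum.distrib[symmetric] algebra_simps)
qed

lemma wedge_function_left:
  assumes "f \<in> forms A 0"
  shows "wedge f \<rho> c I p = f c [] p * \<rho> c I p"
proof -
  have "(\<Sum>S \<in> Pow {..<length I}. shuffle_sign (length I) S * f c (nths I S) p * \<rho> c (nths I (- S)) p) =
      (\<Sum>S \<in> {{}}. shuffle_sign (length I) S * f c (nths I S) p * \<rho> c (nths I (- S)) p)"
  proof (rule sum.mono_neutral_right)
    show "\<forall>S \<in> Pow {..<length I} - {{}}.
        shuffle_sign (length I) S * f c (nths I S) p * \<rho> c (nths I (- S)) p = 0"
    proof
      fix S assume S: "S \<in> Pow {..<length I} - {{}}"
      then have "{i. i < length I \<and> i \<in> S} = S" "S \<noteq> {}" "finite S"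
        by (auto intro: finite_subset)
      then have "length (nths I S) \<noteq> 0" by (simp add: length_nths)
      then show "shuffle_sign (length I) S * f c (nths I S) p * \<rho> c (nths I (- S)) p = 0"
        using forms_zero[OF assms] by simp
    qed
  qed auto
  then show ?thesis
    by (simp add: wedge_def shuffle_sign_def nths_all)
qed

lemma wedge_function_right:
  assumes "f \<in> forms A 0"
  shows "wedge \<rho> f c I p = f c [] p * \<rho> c I p"
proof -
  let ?n = "length I"
  have "(\<Sum>S \<in> Pow {..<?n}. shuffle_sign ?n S * \<rho> c (nths I S) p * f c (nths I (- S)) p) =
      (\<Sum>S \<in> {{..<?n}}. shuffle_sign ?n S * \<rho> c (nths I S) p * f c (nths I (- S)) p)"
  proof (rule sum.mono_neutral_right)
    show "\<forall>S \<in> Pow {..<?n} - {{..<?n}}.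
        shuffle_sign ?n S * \<rho> c (nths I S) p * f c (nths I (- S)) p = 0"
    proof
      fix S assume "S \<in> Pow {..<?n} - {{..<?n}}"
      then have "{i. i < ?n \<and> i \<in> - S} \<noteq> {}" by auto
      then have "length (nths I (- S)) \<noteq> 0" by (simp add: length_nths)
      then show "shuffle_sign ?n S * \<rho> c (nths I S) p * f c (nths I (- S)) p = 0"
        using forms_zero[OF assms] by simp
    qed
  qed auto
  moreover have "nths I {..<?n} = I" by (simp add: nths_all)
  moreover have "length (nths I (- {..<?n})) = 0" by (simp add: length_nths)
  then have "nths I (- {..<?n}) = []" by (simp only: length_0_conv)
  moreover have "{(a, b). a \<in> {..<?n} \<and> b < ?n \<and> b \<notin> {..<?n} \<and> b < a} = {}" by auto
  then have "shuffle_sign ?n {..<?n} = 1"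
    by (simp only: shuffle_sign_def card.empty power_0)
  ultimately show ?thesis
    by (simp add: wedge_def)
qed

lemma wedge_function_commute: "f \<in> forms A 0 \<Longrightarrow> wedge f \<rho> = wedge \<rho> f"
  by (intro ext) (simp add: wedge_function_left wedge_function_right)

text \<open>\<open>comm1\<close> is the coefficient of \<open>\<hbar>\<close> in the super-commutator of a function with a form, \<open>acomm1\<close>
  that of two one-forms; the two differ by the sign \<open>(-1)\<^bsup>pq\<^esup>\<close>.\<close>

definition comm1 :: "('m, 'n) prod_coeffs \<Rightarrow> ('m, 'n) form \<Rightarrow> ('m, 'n) form \<Rightarrow> ('m, 'n) form" where
  "comm1 P x \<eta> = P 1 x \<eta> - P 1 \<eta> x"

definition acomm1 :: "('m, 'n) prod_coeffs \<Rightarrow> ('m, 'n) form \<Rightarrow> ('m, 'n) form \<Rightarrow> ('m, 'n) form" where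
  "acomm1 P \<alpha> \<beta> = P 1 \<alpha> \<beta> + P 1 \<beta> \<alpha>"

locale manifold_deformation = formal_deformation A P D
  for A :: "('m::{t2_space,second_countable_topology}, 'n::finite) chart set"
    and P :: "('m, 'n) prod_coeffs" and D :: "('m, 'n) diff_coeffs" +
  assumes atlas: "smooth_atlas A"
begin

lemma forms_add: "\<tau> \<in> forms A n \<Longrightarrow> \<eta> \<in> forms A n \<Longrightarrow> \<tau> + \<eta> \<in> forms A n"
  using forms_linear[OF atlas, of \<tau> n \<eta> 1 1] by (simp add: plus_fun_def)

lemma forms_diff: "\<tau> \<in> forms A n \<Longrightarrow> \<eta> \<in> forms A n \<Longrightarrow> \<tau> - \<eta> \<in> forms A n"
  using forms_linear[OF atlas, of \<tau> n \<eta> 1 "-1"] by (simp add: fun_diff_def)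

lemma ext_d_forms: "\<tau> \<in> forms A p \<Longrightarrow> ext_d \<tau> \<in> forms A (Suc p)"
  using d_forms[of \<tau> p 0] d_0 by simp

lemma wedge_forms: "\<tau> \<in> forms A p \<Longrightarrow> \<eta> \<in> forms A q \<Longrightarrow> wedge \<tau> \<eta> \<in> forms A (p + q)"
  using prod_forms[of \<tau> p \<eta> q 0] prod_0 by simp

lemma forms_0I: "(\<lambda>c I p. 0) \<in> forms A n"
proof -
  have *: "smooth_in_chart c (\<lambda>p::'m. 0)" if "c \<in> A" for c :: "('m, 'n) chart"
  proof -
    interpret atlas_chart A c by unfold_locales (fact atlas that)+
    show ?thesis by (rule smooth_const)
  qed
  then show ?thesis by (simp add: forms_def)
qed

lemma zero_forms: "0 \<in> forms A n"
  using forms_0I by (simp add: zero_fun_def)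

lemma prod_zero_left: "\<eta> \<in> forms A q \<Longrightarrow> P k 0 \<eta> = 0"
  using prod_add_left[OF zero_forms zero_forms, of \<eta> q k] by simp

lemma prod_zero_right: "\<eta> \<in> forms A q \<Longrightarrow> P k \<eta> 0 = 0"
  using prod_add_right[OF _ zero_forms zero_forms, of \<eta> q k] by simp

lemma d_zero: "D k 0 = 0"
  using d_add[OF zero_forms zero_forms, of k] by simp

lemma prod_diff_left:
  "\<lbrakk>\<tau> \<in> forms A p; \<tau>' \<in> forms A p; \<eta> \<in> forms A q\<rbrakk> \<Longrightarrow> P k (\<tau> - \<tau>') \<eta> = P k \<tau> \<eta> - P k \<tau>' \<eta>"
  using prod_add_left[OF forms_diff[of \<tau> p \<tau>'], of \<tau>' \<eta> q k] by (simp add: eq_diff_eq)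

lemma prod_diff_right:
  "\<lbrakk>\<tau> \<in> forms A p; \<eta> \<in> forms A q; \<eta>' \<in> forms A q\<rbrakk> \<Longrightarrow> P k \<tau> (\<eta> - \<eta>') = P k \<tau> \<eta> - P k \<tau> \<eta>'"
  using prod_add_right[OF _ forms_diff[of \<eta> q \<eta>'], of \<tau> p \<eta>' k] by (simp add: eq_diff_eq)

lemma wedge_diff_left:
  "\<lbrakk>\<tau> \<in> forms A p; \<tau>' \<in> forms A p; \<eta> \<in> forms A q\<rbrakk> \<Longrightarrow>
    wedge (\<tau> - \<tau>') \<eta> = wedge \<tau> \<eta> - wedge \<tau>' \<eta>"
  using prod_diff_left[of \<tau> p \<tau>' \<eta> q 0] prod_0[OF forms_diff[of \<tau> p \<tau>'], of \<eta> q]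
    prod_0[of \<tau> p \<eta> q] prod_0[of \<tau>' p \<eta> q]
  by simp

lemma wedge_diff_right:
  "\<lbrakk>\<tau> \<in> forms A p; \<eta> \<in> forms A q; \<eta>' \<in> forms A q\<rbrakk> \<Longrightarrow>
    wedge \<tau> (\<eta> - \<eta>') = wedge \<tau> \<eta> - wedge \<tau> \<eta>'"
  using prod_diff_right[of \<tau> p \<eta> q \<eta>' 0] prod_0[OF _ forms_diff[of \<eta> q \<eta>'], of \<tau> p]
    prod_0[of \<tau> p \<eta> q] prod_0[of \<tau> p \<eta>' q]
  by simp

lemma ext_d_diff:
  "\<lbrakk>\<tau> \<in> forms A p; \<tau>' \<in> forms A p\<rbrakk> \<Longrightarrow> ext_d (\<tau> - \<tau>') = ext_d \<tau> - ext_d \<tau>'"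
  using d_add[OF forms_diff[of \<tau> p \<tau>'], of \<tau>' 0] d_0[of "\<tau> - \<tau>'" p] d_0[of \<tau> p] d_0[of \<tau>' p]
  by (simp add: forms_diff eq_diff_eq)

lemma comm1_forms: "\<lbrakk>x \<in> forms A 0; \<eta> \<in> forms A q\<rbrakk> \<Longrightarrow> comm1 P x \<eta> \<in> forms A q"
  using prod_forms[of x 0 \<eta> q 1] prod_forms[of \<eta> q x 0 1] by (simp add: comm1_def forms_diff)

lemma acomm1_forms: "\<lbrakk>\<alpha> \<in> forms A 1; \<beta> \<in> forms A 1\<rbrakk> \<Longrightarrow> acomm1 P \<alpha> \<beta> \<in> forms A 2"
  using prod_forms[of \<alpha> 1 \<beta> 1 1] prod_forms[of \<beta> 1 \<alpha> 1 1]
  by (simp add: acomm1_def forms_add numeral_2_eq_2)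

lemma prod_h_const_left:
  assumes "\<xi> \<in> forms A p" and S: "\<And>j. fps_nth S j \<in> forms A q"
  shows "fps_nth (prod_h P (fps_const \<xi>) S) n = (\<Sum>j\<le>n. P (n - j) \<xi> (fps_nth S j))"
proof -
  have "(\<Sum>i\<le>n. \<Sum>j\<le>n - i. P (n - i - j) (fps_nth (fps_const \<xi>) i) (fps_nth S j)) =
      (\<Sum>i\<le>n. if i = 0 then \<Sum>j\<le>n. P (n - j) \<xi> (fps_nth S j) else 0)"
    by (intro sum.cong refl) (simp add: prod_zero_left[OF S])
  then show ?thesis by (simp add: prod_h_def)
qed

lemma prod_h_const_right:
  assumes "\<xi> \<in> forms A p" and S: "\<And>j. fps_nth S j \<in> forms A q"
  shows "fps_nth (prod_h P S (fps_const \<xi>)) n = (\<Sum>i\<le>n. P (n - i) (fps_nth S i) \<xi>)"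
proof -
  have "(\<Sum>j\<le>n - i. P (n - i - j) (fps_nth S i) (fps_nth (fps_const \<xi>) j)) = P (n - i) (fps_nth S i) \<xi>"
    for i
  proof -
    have "(\<Sum>j\<le>n - i. P (n - i - j) (fps_nth S i) (fps_nth (fps_const \<xi>) j)) =
        (\<Sum>j\<le>n - i. if j = 0 then P (n - i) (fps_nth S i) \<xi> else 0)"
      by (intro sum.cong refl) (simp add: prod_zero_right[OF S])
    then show ?thesis by simp
  qed
  then show ?thesis by (simp add: prod_h_def)
qed

lemma const_forms: "\<xi> \<in> forms A p \<Longrightarrow> fps_nth (fps_const \<xi>) j \<in> forms A p"
  by (simp add: zero_forms)

lemma prod_h_const_const:
  assumes "\<xi> \<in> forms A p" "\<eta> \<in> forms A q"
  shows "fps_nth (prod_h P (fps_const \<xi>) (fps_const \<eta>)) n = P n \<xi> \<eta>"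
proof -
  have "(\<Sum>j\<le>n. P (n - j) \<xi> (fps_nth (fps_const \<eta>) j)) = (\<Sum>j\<le>n. if j = 0 then P n \<xi> \<eta> else 0)"
    by (intro sum.cong refl) (simp add: prod_zero_right[OF assms(1)])
  then show ?thesis
    by (simp add: prod_h_const_left[OF assms(1) const_forms[OF assms(2)]])
qed

lemma d_h_nth: "fps_nth (d_h D S) n = (\<Sum>i\<le>n. D (n - i) (fps_nth S i))"
  by (simp add: d_h_def)

lemma d_h_const: "fps_nth (d_h D (fps_const \<xi>)) n = D n \<xi>"
proof -
  have "(\<Sum>i\<le>n. D (n - i) (fps_nth (fps_const \<xi>) i)) = (\<Sum>i\<le>n. if i = 0 then D n \<xi> else 0)"
    by (intro sum.cong refl) (simp add: d_zero)
  then show ?thesis by (simp add: d_h_nth)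
qed

lemma associativity_order_1:
  assumes "\<xi> \<in> forms A p" "\<eta> \<in> forms A q" "\<zeta> \<in> forms A r"
  shows "P 1 (wedge \<xi> \<eta>) \<zeta> + wedge (P 1 \<xi> \<eta>) \<zeta> = P 1 \<xi> (wedge \<eta> \<zeta>) + wedge \<xi> (P 1 \<eta> \<zeta>)"
proof -
  have f: "fps_nth (prod_h P (fps_const \<xi>) (fps_const \<eta>)) j \<in> forms A (p + q)"
    "fps_nth (prod_h P (fps_const \<eta>) (fps_const \<zeta>)) j \<in> forms A (q + r)" for j
    using assms by (simp_all add: prod_h_const_const prod_forms)
  have "fps_nth (prod_h P (prod_h P (fps_const \<xi>) (fps_const \<eta>)) (fps_const \<zeta>)) 1 =
      fps_nth (prod_h P (fps_const \<xi>) (prod_h P (fps_const \<eta>) (fps_const \<zeta>))) 1"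
    using assoc_forms[OF assms] by (simp add: is_O_h_def)
  then show ?thesis
    by (simp add: prod_h_const_left[OF assms(1) f(2)] prod_h_const_right[OF assms(3) f(1)]
        prod_h_const_const[OF assms(1,2)] prod_h_const_const[OF assms(2,3)] prod_0[OF assms(1,2)]
        prod_0[OF assms(2,3)] prod_0[OF prod_forms[OF assms(1,2)] assms(3)]
        prod_0[OF assms(1) prod_forms[OF assms(2,3)]] atMost_Suc add.commute)
qed

text \<open>Associativity is applied to \<open>(x,\<eta>,\<zeta>)\<close>, \<open>(\<eta>,x,\<zeta>)\<close> and \<open>(\<eta>,\<zeta>,x)\<close>. In the alternating sum the
  terms with an undeformed inner product cancel, because functions commute with all forms to
  lowest order.\<close>

lemma comm1_derivation:
  assumes x: "x \<in> forms A 0" and \<eta>: "\<eta> \<in> forms A q" and \<zeta>: "\<zeta> \<in> forms A r"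
  shows "comm1 P x (wedge \<eta> \<zeta>) = wedge (comm1 P x \<eta>) \<zeta> + wedge \<eta> (comm1 P x \<zeta>)"
proof -
  have forms: "P 1 x \<eta> \<in> forms A q" "P 1 \<eta> x \<in> forms A q" "P 1 x \<zeta> \<in> forms A r" "P 1 \<zeta> x \<in> forms A r"
    using prod_forms[OF x \<eta>] prod_forms[OF \<eta> x] prod_forms[OF x \<zeta>] prod_forms[OF \<zeta> x] by simp_all
  have "wedge (comm1 P x \<eta>) \<zeta> = wedge (P 1 x \<eta>) \<zeta> - wedge (P 1 \<eta> x) \<zeta>"
    unfolding comm1_def by (rule wedge_diff_left[OF forms(1,2) \<zeta>])
  moreover have "wedge \<eta> (comm1 P x \<zeta>) = wedge \<eta> (P 1 x \<zeta>) - wedge \<eta> (P 1 \<zeta> x)"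
    unfolding comm1_def by (rule wedge_diff_right[OF \<eta> forms(3,4)])
  moreover have "wedge x \<eta> = wedge \<eta> x" "wedge x \<zeta> = wedge \<zeta> x"
    "wedge x (P 1 \<eta> \<zeta>) = wedge (P 1 \<eta> \<zeta>) x"
    by (rule wedge_function_commute[OF x])+
  moreover note associativity_order_1[OF x \<eta> \<zeta>] associativity_order_1[OF \<eta> x \<zeta>]
    associativity_order_1[OF \<eta> \<zeta> x]
  ultimately have eqs:
    "wedge (comm1 P x \<eta>) \<zeta> = wedge (P 1 x \<eta>) \<zeta> - wedge (P 1 \<eta> x) \<zeta>"
    "wedge \<eta> (comm1 P x \<zeta>) = wedge \<eta> (P 1 x \<zeta>) - wedge \<eta> (P 1 \<zeta> x)"
    "P 1 (wedge \<eta> x) \<zeta> + wedge (P 1 x \<eta>) \<zeta> = P 1 x (wedge \<eta> \<zeta>) + wedge (P 1 \<eta> \<zeta>) x"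
    "P 1 (wedge \<eta> x) \<zeta> + wedge (P 1 \<eta> x) \<zeta> = P 1 \<eta> (wedge \<zeta> x) + wedge \<eta> (P 1 x \<zeta>)"
    "P 1 (wedge \<eta> \<zeta>) x + wedge (P 1 \<eta> \<zeta>) x = P 1 \<eta> (wedge \<zeta> x) + wedge \<eta> (P 1 \<zeta> x)"
    by simp_all
  show ?thesis
  proof (intro ext)
    fix c I p
    show "comm1 P x (wedge \<eta> \<zeta>) c I p = (wedge (comm1 P x \<eta>) \<zeta> + wedge \<eta> (comm1 P x \<zeta>)) c I p"
      using eqs[THEN fun_cong, THEN fun_cong, THEN fun_cong, of c I p]
      unfolding comm1_def[of P x "wedge \<eta> \<zeta>"] plus_fun_apply minus_apply by linarith
  qed
qed

lemma derivation_order_1: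
  assumes "\<xi> \<in> forms A p" "\<eta> \<in> forms A q"
  shows "ext_d (P 1 \<xi> \<eta>) + D 1 (wedge \<xi> \<eta>) = P 1 (ext_d \<xi>) \<eta> + wedge (D 1 \<xi>) \<eta>
    + (-1) ^ p * (P 1 \<xi> (ext_d \<eta>) + wedge \<xi> (D 1 \<eta>))"
proof -
  have f: "fps_nth (d_h D (fps_const \<xi>)) j \<in> forms A (Suc p)"
    "fps_nth (d_h D (fps_const \<eta>)) j \<in> forms A (Suc q)" for j
    using assms by (simp_all add: d_h_const d_forms)
  have sign: "fps_nth ((-1) ^ p * X) n = (-1) ^ p * fps_nth X n" for X :: "('m, 'n) form fps" and n
    by (cases "even p") auto
  have "fps_nth (d_h D (prod_h P (fps_const \<xi>) (fps_const \<eta>))) 1 =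
      fps_nth (prod_h P (d_h D (fps_const \<xi>)) (fps_const \<eta>)) 1 +
      fps_nth ((-1) ^ p * prod_h P (fps_const \<xi>) (d_h D (fps_const \<eta>))) 1"
    using d_derivation[OF assms] unfolding is_O_h_def fps_sub_nth fps_add_nth by simp
  moreover have "fps_nth (d_h D (prod_h P (fps_const \<xi>) (fps_const \<eta>))) 1 =
      ext_d (P 1 \<xi> \<eta>) + D 1 (wedge \<xi> \<eta>)"
    by (simp add: d_h_nth prod_h_const_const[OF assms] prod_0[OF assms] d_0[OF prod_forms[OF assms]]
        atMost_Suc)
  moreover have "fps_nth (prod_h P (d_h D (fps_const \<xi>)) (fps_const \<eta>)) 1 =
      P 1 (ext_d \<xi>) \<eta> + wedge (D 1 \<xi>) \<eta>"
    unfolding prod_h_const_right[OF assms(2) f(1)] d_h_const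
    by (simp add: atMost_Suc d_0[OF assms(1)] prod_0[OF d_forms[OF assms(1)] assms(2)])
  moreover have "fps_nth (prod_h P (fps_const \<xi>) (d_h D (fps_const \<eta>))) 1 =
      P 1 \<xi> (ext_d \<eta>) + wedge \<xi> (D 1 \<eta>)"
    unfolding prod_h_const_left[OF assms(1) f(2)] d_h_const
    by (simp add: atMost_Suc d_0[OF assms(2)] prod_0[OF assms(1) d_forms[OF assms(2)]])
  ultimately show ?thesis
    by (simp only: sign)
qed

lemma wedge_one_forms_anticommute:
  assumes "\<alpha> \<in> forms A 1" "\<beta> \<in> forms A 1"
  shows "wedge \<alpha> \<beta> + wedge \<beta> \<alpha> = 0"
proof (intro ext)
  fix c I p
  show "(wedge \<alpha> \<beta> + wedge \<beta> \<alpha>) c I p = 0 c I p"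
  proof (cases "length I = 2")
    case True
    then obtain i j where "I = [i, j]"
      by (metis (no_types, lifting) One_nat_def Suc_1 length_0_conv length_Suc_conv)
    then show ?thesis
      using wedge_one_forms[OF assms] wedge_one_forms[OF assms(2,1)] by simp
  next
    case False
    then show ?thesis
      using forms_zero[OF wedge_forms[OF assms]] forms_zero[OF wedge_forms[OF assms(2,1)]] by simp
  qed
qed

text \<open>In the next two lemmas the first-order part of the deformed differential enters only
  through super-commutators of the undeformed product, which vanish.\<close>

lemma ext_d_comm1_functions:
  assumes x: "x \<in> forms A 0" and y: "y \<in> forms A 0"
  shows "ext_d (comm1 P x y) = comm1 P x (ext_d y) - comm1 P y (ext_d x)"
proof -
  have forms: "P 1 x y \<in> forms A 0" "P 1 y x \<in> forms A 0"
    using prod_forms[OF x y] prod_forms[OF y x] by simp_all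
  have "ext_d (comm1 P x y) = ext_d (P 1 x y) - ext_d (P 1 y x)"
    unfolding comm1_def by (rule ext_d_diff[OF forms])
  moreover have "wedge y x = wedge x y" "wedge (D 1 y) x = wedge x (D 1 y)" "wedge y (D 1 x) = wedge (D 1 x) y"
    by (rule wedge_function_commute[OF x, symmetric] wedge_function_commute[OF y])+
  moreover note derivation_order_1[OF x y] derivation_order_1[OF y x]
  ultimately have eqs: "ext_d (comm1 P x y) = ext_d (P 1 x y) - ext_d (P 1 y x)"
    "ext_d (P 1 x y) + D 1 (wedge x y) =
      P 1 (ext_d x) y + wedge (D 1 x) y + (P 1 x (ext_d y) + wedge x (D 1 y))"
    "ext_d (P 1 y x) + D 1 (wedge x y) =
      P 1 (ext_d y) x + wedge x (D 1 y) + (P 1 y (ext_d x) + wedge (D 1 x) y)"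
    by simp_all
  show ?thesis
  proof (intro ext)
    fix c I p
    show "ext_d (comm1 P x y) c I p = (comm1 P x (ext_d y) - comm1 P y (ext_d x)) c I p"
      using eqs[THEN fun_cong, THEN fun_cong, THEN fun_cong, of c I p]
      unfolding comm1_def[of P x "ext_d y"] comm1_def[of P y "ext_d x"] plus_fun_apply minus_apply by linarith
  qed
qed

lemma ext_d_comm1_one_form:
  assumes x: "x \<in> forms A 0" and \<tau>: "\<tau> \<in> forms A 1"
  shows "ext_d (comm1 P x \<tau>) = acomm1 P (ext_d x) \<tau> + comm1 P x (ext_d \<tau>)"
proof -
  have forms: "P 1 x \<tau> \<in> forms A 1" "P 1 \<tau> x \<in> forms A 1"
    using prod_forms[OF x \<tau>] prod_forms[OF \<tau> x] by simp_all
  have "ext_d (comm1 P x \<tau>) = ext_d (P 1 x \<tau>) - ext_d (P 1 \<tau> x)"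
    unfolding comm1_def by (rule ext_d_diff[OF forms])
  moreover have "wedge \<tau> x = wedge x \<tau>" "wedge (D 1 \<tau>) x = wedge x (D 1 \<tau>)"
    by (rule wedge_function_commute[OF x, symmetric])+
  moreover have "wedge (D 1 x) \<tau> + wedge \<tau> (D 1 x) = 0"
    using wedge_one_forms_anticommute[of "D 1 x" \<tau>] d_forms[OF x, of 1] \<tau> by simp
  moreover note derivation_order_1[OF x \<tau>] derivation_order_1[OF \<tau> x]
  ultimately have eqs: "ext_d (comm1 P x \<tau>) = ext_d (P 1 x \<tau>) - ext_d (P 1 \<tau> x)"
    "wedge (D 1 x) \<tau> + wedge \<tau> (D 1 x) = 0"
    "ext_d (P 1 x \<tau>) + D 1 (wedge x \<tau>) =
      P 1 (ext_d x) \<tau> + wedge (D 1 x) \<tau> + (P 1 x (ext_d \<tau>) + wedge x (D 1 \<tau>))"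
    "ext_d (P 1 \<tau> x) + D 1 (wedge x \<tau>) =
      P 1 (ext_d \<tau>) x + wedge x (D 1 \<tau>) - (P 1 \<tau> (ext_d x) + wedge \<tau> (D 1 x))"
    by simp_all
  show ?thesis
  proof (intro ext)
    fix c I p
    show "ext_d (comm1 P x \<tau>) c I p = (acomm1 P (ext_d x) \<tau> + comm1 P x (ext_d \<tau>)) c I p"
      using eqs[THEN fun_cong, THEN fun_cong, THEN fun_cong, of c I p]
      unfolding comm1_def[of P x "ext_d \<tau>"] acomm1_def plus_fun_apply minus_apply zero_fun_apply
      by linarith
  qed
qed

lemma associativity_order_2:
  assumes x: "x \<in> forms A 0" and y: "y \<in> forms A 0" and z: "z \<in> forms A 0"
  shows "P 2 (wedge x y) z + P 1 (P 1 x y) z + wedge (P 2 x y) z =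
    P 2 x (wedge y z) + P 1 x (P 1 y z) + wedge x (P 2 y z)"
proof -
  have f: "fps_nth (prod_h P (fps_const x) (fps_const y)) j \<in> forms A (0 + 0)"
    "fps_nth (prod_h P (fps_const y) (fps_const z)) j \<in> forms A (0 + 0)" for j
    using assms prod_forms[OF x y] prod_forms[OF y z] by (simp_all add: prod_h_const_const)
  have "fps_nth (prod_h P (prod_h P (fps_const x) (fps_const y)) (fps_const z)) 2 =
      fps_nth (prod_h P (fps_const x) (prod_h P (fps_const y) (fps_const z))) 2"
    using assoc_functions[OF assms] by simp
  then show ?thesis
    by (simp add: prod_h_const_left[OF x f(2)] prod_h_const_right[OF z f(1)]
        prod_h_const_const[OF x y] prod_h_const_const[OF y z] prod_0[OF x y] prod_0[OF y z]
        prod_0[OF prod_forms[OF x y] z] prod_0[OF x prod_forms[OF y z]]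
        numeral_2_eq_2 atMost_Suc algebra_simps)
qed

text \<open>The alternating sum of the second-order associativity law over the permutations of \<open>x, y, z\<close>.
  The terms with a second-order product cancel by commutativity of the undeformed product.\<close>

lemma comm1_jacobi:
  assumes x: "x \<in> forms A 0" and y: "y \<in> forms A 0" and z: "z \<in> forms A 0"
  shows "comm1 P x (comm1 P y z) = comm1 P (comm1 P x y) z + comm1 P y (comm1 P x z)"
proof -
  have P: "P k a b \<in> forms A 0" if "a \<in> forms A 0" "b \<in> forms A 0" for k a b
    using prod_forms[OF that] by simp
  have w: "wedge y x = wedge x y" "wedge z x = wedge x z" "wedge z y = wedge y z"
    by (rule wedge_function_commute[OF y] wedge_function_commute[OF z])+
  have w2: "wedge (P 2 a b) c = wedge c (P 2 a b)" if "a \<in> forms A 0" "b \<in> forms A 0" for a b c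
    by (rule wedge_function_commute[OF P[OF that]])
  note a = associativity_order_2
  have eqs: "P 2 (wedge x y) z + P 1 (P 1 x y) z + wedge z (P 2 x y) =
    P 2 x (wedge y z) + P 1 x (P 1 y z) + wedge x (P 2 y z)"
   "P 2 (wedge y z) x + P 1 (P 1 y z) x + wedge x (P 2 y z) =
    P 2 y (wedge x z) + P 1 y (P 1 z x) + wedge y (P 2 z x)"
   "P 2 (wedge x z) y + P 1 (P 1 z x) y + wedge y (P 2 z x) =
    P 2 z (wedge x y) + P 1 z (P 1 x y) + wedge z (P 2 x y)"
   "P 2 (wedge x y) z + P 1 (P 1 y x) z + wedge z (P 2 y x) =
    P 2 y (wedge x z) + P 1 y (P 1 x z) + wedge y (P 2 x z)"
   "P 2 (wedge x z) y + P 1 (P 1 x z) y + wedge y (P 2 x z) =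
    P 2 x (wedge y z) + P 1 x (P 1 z y) + wedge x (P 2 z y)"
   "P 2 (wedge y z) x + P 1 (P 1 z y) x + wedge x (P 2 z y) =
    P 2 z (wedge x y) + P 1 z (P 1 y x) + wedge z (P 2 y x)"
    using a[OF x y z] a[OF y z x] a[OF z x y] a[OF y x z] a[OF x z y] a[OF z y x]
    by (simp_all add: w w2 x y z)
  have expand: "comm1 P a (comm1 P b d) = P 1 a (P 1 b d) - P 1 a (P 1 d b) - P 1 (P 1 b d) a + P 1 (P 1 d b) a"
    "comm1 P (comm1 P b d) a = - P 1 a (P 1 b d) + P 1 a (P 1 d b) + P 1 (P 1 b d) a - P 1 (P 1 d b) a"
    if "a \<in> forms A 0" "b \<in> forms A 0" "d \<in> forms A 0" for a b d
    using that by (simp_all add: comm1_def prod_diff_left[of _ 0 _ _ 0] prod_diff_right[of _ 0 _ 0] P)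
  show ?thesis
  proof (intro ext)
    fix c I p
    show "comm1 P x (comm1 P y z) c I p = (comm1 P (comm1 P x y) z + comm1 P y (comm1 P x z)) c I p"
      using eqs[THEN fun_cong, THEN fun_cong, THEN fun_cong, of c I p]
      unfolding plus_fun_apply expand[OF x y z] expand[OF z x y] expand[OF y x z] minus_apply uminus_apply
      by linarith
  qed
qed

lemma poisson_eq_comm1: "\<lbrakk>x \<in> forms A 0; y \<in> forms A 0\<rbrakk> \<Longrightarrow> poisson P x y = comm1 P x y"
  by (simp add: poisson_def scomm_def comm1_def prod_h_const_const)

lemma gamma_eq_comm1: "\<lbrakk>x \<in> forms A 0; \<tau> \<in> forms A 1\<rbrakk> \<Longrightarrow> gamma P x \<tau> = comm1 P x \<tau>"
  by (simp add: gamma_def scomm_def comm1_def prod_h_const_const)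

text \<open>The inner super-commutators start at order \<open>\<hbar>\<close>, and their second-order parts drop out because
  the wedge product is graded commutative. So only first-order brackets enter \<open>J\<^sub>2\<close>.\<close>

lemma J2_eq:
  assumes x: "x \<in> forms A 0" and y: "y \<in> forms A 0" and z: "z \<in> forms A 0"
  shows "J2 P x y z = comm1 P x (acomm1 P (ext_d y) (ext_d z))
    - acomm1 P (ext_d z) (comm1 P x (ext_d y)) - acomm1 P (ext_d y) (comm1 P x (ext_d z))"
proof -
  let ?dy = "ext_d y" and ?dz = "ext_d z"
  have dy: "?dy \<in> forms A 1" and dz: "?dz \<in> forms A 1"
    using ext_d_forms[OF y] ext_d_forms[OF z] by simp_all
  have P11: "P k \<alpha> \<beta> \<in> forms A 2" if "\<alpha> \<in> forms A 1" "\<beta> \<in> forms A 1" for k \<alpha> \<beta>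
    using prod_forms[OF that, of k] by (simp add: numeral_2_eq_2)
  have P01: "P k x \<beta> \<in> forms A 1" "P k \<beta> x \<in> forms A 1" if "\<beta> \<in> forms A 1" for k \<beta>
    using prod_forms[OF x that, of k] prod_forms[OF that x, of k] by simp_all
  define Y where "Y = scomm P 1 1 (fps_const ?dy) (fps_const ?dz)"
  define U where "U = scomm P 0 1 (fps_const x) (fps_const ?dy)"
  define V where "V = scomm P 1 0 (fps_const ?dz) (fps_const x)"
  have Y: "fps_nth Y n = P n ?dy ?dz + P n ?dz ?dy" for n
    by (simp add: Y_def scomm_def prod_h_const_const[OF dy dz] prod_h_const_const[OF dz dy])
  have U: "fps_nth U n = P n x ?dy - P n ?dy x" for n
    by (simp add: U_def scomm_def prod_h_const_const[OF dy x] prod_h_const_const[OF x dy])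
  have V: "fps_nth V n = P n ?dz x - P n x ?dz" for n
    by (simp add: V_def scomm_def prod_h_const_const[OF dz x] prod_h_const_const[OF x dz])
  have Yf: "fps_nth Y n \<in> forms A 2" for n
    unfolding Y by (intro forms_add P11 dy dz)
  have Uf: "fps_nth U n \<in> forms A 1" and Vf: "fps_nth V n \<in> forms A 1" for n
    unfolding U V by (intro forms_diff P01 dy dz)+
  have Y0: "fps_nth Y 0 = 0" and Y1: "fps_nth Y 1 = acomm1 P ?dy ?dz"
    using wedge_one_forms_anticommute[OF dy dz] by (simp_all add: Y prod_0[OF dy dz] prod_0[OF dz dy] acomm1_def)
  have U0: "fps_nth U 0 = 0" and U1: "fps_nth U 1 = comm1 P x ?dy"
    using wedge_function_commute[OF x, of ?dy] by (simp_all add: U prod_0[OF x dy] prod_0[OF dy x] comm1_def)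
  have V0: "fps_nth V 0 = 0" and V1: "fps_nth V 1 = 0 - comm1 P x ?dz"
    using wedge_function_commute[OF x, of ?dz] by (simp_all add: V prod_0[OF x dz] prod_0[OF dz x] comm1_def)
  have 1: "fps_nth (scomm P 0 2 (fps_const x) Y) 2 = comm1 P x (acomm1 P ?dy ?dz)"
  proof -
    have "wedge x (fps_nth Y 2) = wedge (fps_nth Y 2) x"
      by (rule wedge_function_commute[OF x])
    then show ?thesis
      using Y0 Y1 Yf[of 2]
      by (simp add: scomm_def prod_h_const_left[OF x Yf] prod_h_const_right[OF x Yf] numeral_2_eq_2
          atMost_Suc prod_zero_left[OF x] prod_zero_right[OF x] prod_0[OF x] prod_0[OF _ x] comm1_def)
  qed
  have 2: "fps_nth (scomm P 1 1 (fps_const \<alpha>) W) 2 = acomm1 P \<alpha> (fps_nth W 1)"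
    if \<alpha>: "\<alpha> \<in> forms A 1" and W: "\<And>n. fps_nth W n \<in> forms A 1" "fps_nth W 0 = 0" for \<alpha> W
    using W wedge_one_forms_anticommute[OF \<alpha> W(1)[of 2]]
    by (simp add: scomm_def prod_h_const_left[OF \<alpha> W(1)] prod_h_const_right[OF \<alpha> W(1)] numeral_2_eq_2
        atMost_Suc prod_zero_left[OF \<alpha>] prod_zero_right[OF \<alpha>] prod_0[OF \<alpha> W(1)] prod_0[OF W(1) \<alpha>] acomm1_def
        algebra_simps)
  have xdz: "comm1 P x ?dz \<in> forms A 1"
    by (rule comm1_forms[OF x dz])
  have "acomm1 P ?dy (0 - comm1 P x ?dz) = - acomm1 P ?dy (comm1 P x ?dz)"
    unfolding acomm1_def
    by (simp only: prod_diff_left[OF zero_forms xdz dy] prod_diff_right[OF dy zero_forms xdz]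
        prod_zero_left[OF dy] prod_zero_right[OF dy]) simp
  then show ?thesis
    unfolding J2_def Let_def Y_def[symmetric] U_def[symmetric] V_def[symmetric]
    using 1 2[OF dz Uf U0] 2[OF dy Vf V0] U1 V1 by simp
qed

lemma J2_forms:
  assumes x: "x \<in> forms A 0" and y: "y \<in> forms A 0" and z: "z \<in> forms A 0"
  shows "J2 P x y z \<in> forms A 2"
proof -
  have d: "ext_d y \<in> forms A 1" "ext_d z \<in> forms A 1"
    using ext_d_forms[OF y] ext_d_forms[OF z] by simp_all
  show ?thesis
    unfolding J2_eq[OF x y z]
    by (intro forms_diff comm1_forms[OF x] acomm1_forms d)
qed

end


section \<open>The deformation in a chart\<close>

context manifold_deformation
begin

lemma of_fun_forms: "f \<in> smooth_functions A \<Longrightarrow> of_fun A f \<in> forms A 0"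
  using forms_0[OF atlas] by simp

lemma forms_sum: "(\<And>j. j \<in> J \<Longrightarrow> \<eta> j \<in> forms A n) \<Longrightarrow> (\<Sum>j\<in>J. \<eta> j) \<in> forms A n"
  by (induction J rule: infinite_finite_induct) (auto intro: zero_forms forms_add)

lemma comm1_add:
  assumes "x \<in> forms A 0" "\<eta> \<in> forms A q" "\<eta>' \<in> forms A q"
  shows "comm1 P x (\<eta> + \<eta>') = comm1 P x \<eta> + comm1 P x \<eta>'"
  unfolding comm1_def prod_add_left[OF assms(2,3,1)] prod_add_right[OF assms] by simp

lemma comm1_sum:
  assumes x: "x \<in> forms A 0" and \<eta>: "\<And>j. j \<in> J \<Longrightarrow> \<eta> j \<in> forms A q"
  shows "comm1 P x (\<Sum>j\<in>J. \<eta> j) = (\<Sum>j\<in>J. comm1 P x (\<eta> j))"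
proof -
  have zero: "comm1 P x 0 = 0"
    by (simp add: comm1_def prod_zero_left[OF x] prod_zero_right[OF x])
  show ?thesis
    using \<eta>
  proof (induction J rule: infinite_finite_induct)
    case (insert j J)
    have "comm1 P x (\<eta> j + (\<Sum>j\<in>J. \<eta> j)) = comm1 P x (\<eta> j) + comm1 P x (\<Sum>j\<in>J. \<eta> j)"
    proof (rule comm1_add[OF x])
      show "\<eta> j \<in> forms A q" by (rule insert.prems) simp
      show "(\<Sum>j\<in>J. \<eta> j) \<in> forms A q" by (rule forms_sum, rule insert.prems) simp
    qed
    moreover have "comm1 P x (\<Sum>j\<in>J. \<eta> j) = (\<Sum>j\<in>J. comm1 P x (\<eta> j))"
      by (rule insert.IH, rule insert.prems) simp
    ultimately show ?case
      by (simp only: sum.insert[OF insert.hyps])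
  qed (simp_all add: zero)
qed

end

locale deformation_chart = manifold_deformation A P D
  for A :: "('m::{t2_space,second_countable_topology}, 'n::finite) chart set"
    and P :: "('m, 'n) prod_coeffs" and D :: "('m, 'n) diff_coeffs" +
  fixes c :: "('m, 'n) chart" and \<omega> :: "('m, 'n) bivector" and \<Gamma> :: "('m, 'n) christoffel"
  assumes chart: "c \<in> A"
    and poisson: "poisson_components A P \<omega>"
    and connection: "associated_connection A P \<omega> \<Gamma>"
    and flat_connection: "flat A \<Gamma>"
begin

sublocale C: atlas_chart A c
  by unfold_locales (fact atlas chart)+

lemma smooth_function: "x \<in> forms A 0 \<Longrightarrow> smooth_in_chart c (x c [])"
  and smooth_two_form: "\<rho> \<in> forms A 2 \<Longrightarrow> smooth_in_chart c (\<rho> c [i, l])"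
  using forms_smooth chart by blast+

lemma of_fun_chart: "q \<in> dom_of c \<Longrightarrow> of_fun A f c [] q = f q"
  using chart by (simp add: of_fun_def)

text \<open>Only the differentials of the coordinate functions matter in what follows.\<close>

lemma coordinate_functions:
  assumes "p \<in> dom_of c"
  obtains X V where "\<And>i. X i \<in> forms A 0" "open V" "p \<in> V" "V \<subseteq> dom_of c"
    "\<And>q k i. q \<in> V \<Longrightarrow> pd c k (X i c []) q = (if k = i then 1 else 0)"
proof -
  obtain X V where X: "\<And>i. X i \<in> smooth_functions A" and V: "open V" "p \<in> V" "V \<subseteq> dom_of c"
    and eq: "\<And>i q. q \<in> V \<Longrightarrow> X i q = coord c i q"
    using C.local_coordinates[OF assms] by metis
  have "pd c k (of_fun A (X i) c []) q = (if k = i then 1 else 0)" if "q \<in> V" for q k i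
  proof -
    have "pd c k (of_fun A (X i) c []) q = pd c k (coord c i) q"
      by (rule C.pd_local[OF V(1) that V(3)]) (use V(3) chart in \<open>auto simp: of_fun_def eq\<close>)
    then show ?thesis using C.pd_coord that V(3) by (metis subsetD)
  qed
  then show thesis
    using that[of "\<lambda>i. of_fun A (X i)" V] V of_fun_forms[OF X] by blast
qed

lemma comm1_functions:
  assumes "x \<in> forms A 0" "y \<in> forms A 0" "p \<in> dom_of c"
  shows "comm1 P x y c [] p =
    (\<Sum>i\<in>UNIV. \<Sum>j\<in>UNIV. \<omega> c i j p * pd c i (x c []) p * pd c j (y c []) p)"
  using poisson[unfolded poisson_components_def, rule_format, OF assms(1,2) chart assms(3)]
  by (simp only: poisson_eq_comm1[OF assms(1,2)])

lemma comm1_swap: "comm1 P y x = - comm1 P x y"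
  by (simp add: comm1_def)

lemma smooth_connection: "smooth_in_chart c (\<Gamma> c k i j)"
  using connection chart by (simp add: associated_connection_def is_connection_def)

lemma comm1_coordinates:
  assumes X: "\<And>i. X i \<in> forms A 0"
    and dX: "\<And>k i. pd c k (X i c []) q = (if k = i then 1 else 0)" and q: "q \<in> dom_of c"
  shows "comm1 P (X i) (X j) c [] q = \<omega> c i j q"
  by (simp add: comm1_functions[OF X X q] dX if_distrib[of "\<lambda>x. x * _"] if_distrib[of "\<lambda>x. _ * x"] cong: if_cong)

text \<open>Near a point \<open>\<omega>\<^bsup>ij\<^esup>\<close> is the bracket of two global functions; this gives its smoothness and
  antisymmetry.\<close>

sublocale flat_poisson_chart A c \<Gamma> \<omega>
proof
  show "smooth_in_chart c (\<Gamma> c k i j)" for k i j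
    by (rule smooth_connection)
  show "curvature \<Gamma> c l i j k p = 0" if "p \<in> dom_of c" for p l i j k
    using flat_connection chart that by (simp add: flat_def)
  show "smooth_in_chart c (\<omega> c i j)" for i j
  proof (rule C.smooth_locally)
    fix p assume "p \<in> dom_of c"
    then obtain X V where X: "\<And>i. X i \<in> forms A 0" and V: "open V" "p \<in> V" "V \<subseteq> dom_of c"
      and dX: "\<And>q k i. q \<in> V \<Longrightarrow> pd c k (X i c []) q = (if k = i then 1 else 0)"
      using coordinate_functions by metis
    have "smooth_in_chart c (comm1 P (X i) (X j) c [])"
      by (rule smooth_function[OF comm1_forms[OF X X]])
    moreover have "\<omega> c i j q = comm1 P (X i) (X j) c [] q" if "q \<in> V" for q
      using comm1_coordinates[OF X dX] that V(3) by auto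
    ultimately show "\<exists>U g. open U \<and> p \<in> U \<and> U \<subseteq> dom_of c \<and> smooth_in_chart c g \<and> (\<forall>q\<in>U. \<omega> c i j q = g q)"
      using V by blast
  qed
  show "\<omega> c j i p = - \<omega> c i j p" if p: "p \<in> dom_of c" for p i j
  proof -
    obtain X V where X: "\<And>i. X i \<in> forms A 0" and V: "p \<in> V"
      and dX: "\<And>q k i. q \<in> V \<Longrightarrow> pd c k (X i c []) q = (if k = i then 1 else 0)"
      using coordinate_functions[OF p] by metis
    show ?thesis
      using comm1_coordinates[OF X dX[OF V] p, of j i] comm1_coordinates[OF X dX[OF V] p, of i j]
        comm1_swap[of "X j" "X i"] by simp
  qed
qed

lemma comm1_function:
  assumes "x \<in> forms A 0" "y \<in> forms A 0" "p \<in> dom_of c"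
  shows "comm1 P x y c [] p = (\<Sum>m\<in>UNIV. ham (x c []) m p * pd c m (y c []) p)"
  unfolding comm1_functions[OF assms] ham_def sum_distrib_right by (rule sum.swap)

lemma comm1_one_form:
  assumes "x \<in> forms A 0" "\<tau> \<in> forms A 1" "p \<in> dom_of c"
  shows "comm1 P x \<tau> c [n] p = along (ham (x c [])) (\<lambda>l. \<tau> c [l]) n p"
proof -
  have "comm1 P x \<tau> c [n] p = (\<Sum>k\<in>UNIV. \<Sum>q\<in>UNIV. \<omega> c k q p * pd c k (x c []) p *
      cov_deriv \<Gamma> c q (\<lambda>U. \<tau> c) [] [n] p)"
    using connection[unfolded associated_connection_def, THEN conjunct2, rule_format, OF assms(1,2) chart assms(3)]
    by (simp only: gamma_eq_comm1[OF assms(1,2)])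
  also have "\<dots> = (\<Sum>q\<in>UNIV. \<Sum>k\<in>UNIV. \<omega> c k q p * pd c k (x c []) p * nab q (\<lambda>l. \<tau> c [l]) n p)"
    unfolding cov_deriv_one_form nab_def by (rule sum.swap)
  finally show ?thesis by (simp add: along_def ham_def sum_distrib_right)
qed

lemma ext_d_function_components: "(\<lambda>l. ext_d y c [l]) = C.differential (y c [])"
  by (rule ext) (simp add: ext_d_function C.differential_def)

lemma ext_d_forms_1: "y \<in> forms A 0 \<Longrightarrow> ext_d y \<in> forms A 1"
  using ext_d_forms[of y 0] by simp

lemma nab_coordinate_differential:
  assumes V: "open V" "q \<in> V" "V \<subseteq> dom_of c"
    and dX: "\<And>q k. q \<in> V \<Longrightarrow> pd c k f q = (if k = m then 1 else 0)"
  shows "nab r (C.differential f) i q = - \<Gamma> c m r i q"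
proof -
  have "pd c r (pd c i f) q = pd c r (\<lambda>q. if i = m then 1 else 0) q"
    by (rule C.pd_local[OF V]) (rule dX)
  then have "pd c r (pd c i f) q = 0" by (simp add: C.pd_const)
  then show ?thesis
    by (simp add: nab_def C.differential_def dX[OF V(2)] if_distrib[of "\<lambda>x. _ * x"] cong: if_cong)
qed

text \<open>This is \<open>d{y,x\<^sup>m} = [y,dx\<^sup>m] - [x\<^sup>m,dy]\<close> (\<open>ext_d_comm1_functions\<close>), with both brackets on the right
  expressed by the connection.\<close>

lemma compatible:
  assumes y: "y \<in> forms A 0"
  shows "compatible_function (y c [])"
  unfolding compatible_function_def
proof (intro ballI allI)
  fix p m i assume p: "p \<in> dom_of c"
  obtain X V where X: "\<And>i. X i \<in> forms A 0" and V: "open V" "p \<in> V" "V \<subseteq> dom_of c"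
    and dX: "\<And>q k i. q \<in> V \<Longrightarrow> pd c k (X i c []) q = (if k = i then 1 else 0)"
    using coordinate_functions[OF p] by metis
  have "pd c i (comm1 P y (X m) c []) p = pd c i (ham (y c []) m) p"
  proof (rule C.pd_local[OF V])
    fix q assume q: "q \<in> V"
    then have "q \<in> dom_of c" using V(3) by blast
    then show "comm1 P y (X m) c [] q = ham (y c []) m q"
      by (simp add: comm1_function[OF y X] dX[OF q] if_distrib[of "\<lambda>x. _ * x"] cong: if_cong)
  qed
  moreover have "pd c i (comm1 P y (X m) c []) p =
      comm1 P y (ext_d (X m)) c [i] p - comm1 P (X m) (ext_d y) c [i] p"
    using fun_cong[OF ext_d_function, of "comm1 P y (X m)" c i p] ext_d_comm1_functions[OF y X, of m] by simp
  moreover have "comm1 P y (ext_d (X m)) c [i] p = - (\<Sum>q\<in>UNIV. ham (y c []) q p * \<Gamma> c m q i p)"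
    by (simp add: comm1_one_form[OF y ext_d_forms_1[OF X] p] ext_d_function_components along_def
        nab_coordinate_differential[OF V dX] sum_negf)
  moreover have "ham (X m c []) q p = \<omega> c m q p" for q
    by (simp add: ham_def dX[OF V(2)] if_distrib[of "\<lambda>x. _ * x"] cong: if_cong)
  then have "comm1 P (X m) (ext_d y) c [i] p = (\<Sum>r\<in>UNIV. \<omega> c m r p * nab r (C.differential (y c [])) i p)"
    by (simp add: comm1_one_form[OF X ext_d_forms_1[OF y] p] ext_d_function_components along_def)
  ultimately show "pd c i (ham (y c []) m) p + (\<Sum>q\<in>UNIV. ham (y c []) q p * \<Gamma> c m q i p) =
      - (\<Sum>r\<in>UNIV. \<omega> c m r p * nab r (C.differential (y c [])) i p)"
    by simp
qed

text \<open>The Jacobi identity for \<open>x\<close> and two coordinate functions.\<close>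

lemma hamiltonian_field_poisson:
  assumes x: "x \<in> forms A 0"
  shows "poisson_field (ham (x c []))"
  unfolding poisson_field_def
proof (intro ballI allI)
  fix p q r assume p: "p \<in> dom_of c"
  obtain X V where X: "\<And>i. X i \<in> forms A 0" and V: "open V" "p \<in> V" "V \<subseteq> dom_of c"
    and dX: "\<And>q k i. q \<in> V \<Longrightarrow> pd c k (X i c []) q = (if k = i then 1 else 0)"
    using coordinate_functions[OF p] by metis
  have XX: "pd c m (comm1 P (X q) (X r) c []) p = pd c m (\<omega> c q r) p" for m
    by (rule C.pd_local[OF V]) (use comm1_coordinates[OF X dX] V(3) in blast)
  have xX: "pd c m (comm1 P x (X i) c []) p = pd c m (ham (x c []) i) p" for m i
  proof (rule C.pd_local[OF V])
    fix q assume q: "q \<in> V"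
    then have "q \<in> dom_of c" using V(3) by blast
    then show "comm1 P x (X i) c [] q = ham (x c []) i q"
      by (simp add: comm1_function[OF x X] dX[OF q] if_distrib[of "\<lambda>x. _ * x"] cong: if_cong)
  qed
  have hamX: "ham (X q c []) s p = \<omega> c q s p" for s
    by (simp add: ham_def dX[OF V(2)] if_distrib[of "\<lambda>x. _ * x"] cong: if_cong)
  have "comm1 P x (comm1 P (X q) (X r)) c [] p =
      comm1 P (comm1 P x (X q)) (X r) c [] p + comm1 P (X q) (comm1 P x (X r)) c [] p"
    using comm1_jacobi[OF x X X, of q r] by simp
  then show "(\<Sum>m\<in>UNIV. ham (x c []) m p * pd c m (\<omega> c q r) p) =
      (\<Sum>s\<in>UNIV. \<omega> c q s p * pd c s (ham (x c []) r) p) + (\<Sum>s\<in>UNIV. \<omega> c s r p * pd c s (ham (x c []) q) p)"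
    unfolding comm1_functions[OF comm1_forms[OF x X] X p] comm1_function[OF X comm1_forms[OF x X] p]
      comm1_function[OF x comm1_forms[OF X X] p]
    by (simp add: XX xX hamX dX[OF V(2)] if_distrib[of "\<lambda>x. x * _"] if_distrib[of "\<lambda>x. _ * x"] cong: if_cong)
qed

text \<open>Near \<open>p\<close> a two-form \<open>\<rho>\<close> is \<open>\<Sum>a b. (\<rho>\<^bsub>ab\<^esub>/2) dx\<^sup>a \<and> dx\<^sup>b\<close>; multiplied by a bump function \<open>\<phi>\<close> this
  becomes an identity of global forms, to which the derivation property applies. As \<open>\<phi>\<close> is 1 near
  \<open>p\<close>, it does not contribute at \<open>p\<close>.\<close>

lemma comm1_two_form:
  assumes x: "x \<in> forms A 0" and \<rho>: "\<rho> \<in> forms A 2" and p: "p \<in> dom_of c"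
  shows "comm1 P x \<rho> c [i, l] p = along2 (ham (x c [])) (\<lambda>i l. \<rho> c [i, l]) i l p"
proof -
  let ?v = "ham (x c [])"
  obtain X V where X: "\<And>i. X i \<in> forms A 0" and V: "open V" "p \<in> V" "V \<subseteq> dom_of c"
    and dX: "\<And>q k i. q \<in> V \<Longrightarrow> pd c k (X i c []) q = (if k = i then 1 else 0)"
    using coordinate_functions[OF p] by metis
  obtain \<phi> W K where \<phi>: "\<phi> \<in> smooth_functions A" and W: "open W" "p \<in> W" "W \<subseteq> V"
    and one: "\<And>q. q \<in> W \<Longrightarrow> \<phi> q = 1" and K: "compact K" "K \<subseteq> V" and zero: "\<And>q. q \<notin> K \<Longrightarrow> \<phi> q = 0"
    using C.bump_function[OF V] by blast
  have Wdom: "W \<subseteq> dom_of c" using W(3) V(3) by blast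
  define F where "F = (\<lambda>a b q. \<phi> q * (1 / 2 * \<rho> c [a, b] q))"
  define B where "B = (\<lambda>a b. wedge (of_fun A (F a b)) (wedge (ext_d (X a)) (ext_d (X b))))"
  have "smooth_in_chart c \<phi>"
    using \<phi> chart by (simp add: smooth_functions_def)
  then have "F a b \<in> smooth_functions A" for a b
    unfolding F_def
    by (intro smooth_extension[OF atlas chart _ K(1)] C.smooth_intros smooth_two_form[OF \<rho>])
      (use K(2) V(3) zero in auto)
  then have F: "of_fun A (F a b) \<in> forms A 0" for a b
    by (rule of_fun_forms)
  have \<Phi>: "of_fun A \<phi> \<in> forms A 0"
    by (rule of_fun_forms[OF \<phi>])
  note dX1 = ext_d_forms_1[OF X]
  have dXdX: "wedge (ext_d (X a)) (ext_d (X b)) \<in> forms A 2" for a b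
    using wedge_forms[OF dX1 dX1] by (simp add: numeral_2_eq_2)
  have B: "B a b \<in> forms A 2" for a b
    using wedge_forms[OF F dXdX] by (simp only: add_0 B_def)
  have \<rho>_antisym: "\<rho> c [b, a] q = - \<rho> c [a, b] q" for a b q
    using forms_antisym[OF \<rho>, of 0 "[a, b]" 1 c q] by simp
  have dX_wedge: "wedge (ext_d (X a)) (ext_d (X b)) c [i, l] q =
      (if i = a then 1 else 0) * (if l = b then 1 else 0) - (if l = a then 1 else 0) * (if i = b then 1 else 0)"
    if "q \<in> V" for a b i l q
    by (simp add: wedge_one_forms[OF dX1 dX1] ext_d_function dX[OF that])
  have B_sum: "(\<Sum>a\<in>UNIV. \<Sum>b\<in>UNIV. B a b) \<in> forms A 2"
    by (intro forms_sum B)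
  have \<Phi>\<rho>: "wedge (of_fun A \<phi>) \<rho> \<in> forms A 2"
    using wedge_forms[OF \<Phi> \<rho>] by (simp only: add_0)
  have sum_apply: "(\<Sum>a\<in>UNIV. \<Sum>b\<in>UNIV. H a b) c' I q = (\<Sum>a\<in>UNIV. \<Sum>b\<in>UNIV. H a b c' I q)"
    for H :: "'n \<Rightarrow> 'n \<Rightarrow> ('m, 'n) form" and c' I q
  proof -
    have 1: "(\<Sum>a\<in>J. G a) c' I q = (\<Sum>a\<in>J. G a c' I q)" for G :: "'n \<Rightarrow> ('m, 'n) form" and J
      by (induction J rule: infinite_finite_induct) auto
    show ?thesis by (simp add: 1)
  qed
  have in_chart: "wedge (of_fun A \<phi>) \<rho> c I q = (\<Sum>a\<in>UNIV. \<Sum>b\<in>UNIV. B a b) c I q" if q: "q \<in> dom_of c" for I q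
  proof (cases "length I = 2")
    case True
    then obtain i l where I: "I = [i, l]"
      by (metis (no_types, lifting) One_nat_def Suc_1 length_0_conv length_Suc_conv)
    have lhs: "wedge (of_fun A \<phi>) \<rho> c I q = \<phi> q * \<rho> c [i, l] q"
      by (simp add: wedge_function_left[OF \<Phi>] of_fun_chart[OF q] I)
    have B_apply: "B a b c I q = F a b q * wedge (ext_d (X a)) (ext_d (X b)) c [i, l] q" for a b
      by (simp add: B_def wedge_function_left[OF F] of_fun_chart[OF q] I)
    show ?thesis
    proof (cases "q \<in> V")
      case True
      have "(\<Sum>a\<in>UNIV. \<Sum>b\<in>UNIV. B a b c I q) = F i l q - F l i q"
        by (simp add: B_apply dX_wedge[OF True] right_diff_distrib sum_subtractf
            if_distrib[of "\<lambda>x. x * _"] if_distrib[of "\<lambda>x. _ * x"] cong: if_cong)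
      then show ?thesis
        unfolding sum_apply lhs using \<rho>_antisym[of l i q] by (simp add: F_def)
    next
      case False
      then have "\<phi> q = 0" using zero K(2) by blast
      then show ?thesis unfolding sum_apply lhs by (simp add: B_apply F_def)
    qed
  next
    case False
    then show ?thesis using forms_zero[OF B_sum] forms_zero[OF \<Phi>\<rho>] by simp
  qed
  have "wedge (of_fun A \<phi>) \<rho> = (\<Sum>a\<in>UNIV. \<Sum>b\<in>UNIV. B a b)"
  proof (intro ext)
    fix c' I q
    show "wedge (of_fun A \<phi>) \<rho> c' I q = (\<Sum>a\<in>UNIV. \<Sum>b\<in>UNIV. B a b) c' I q"
    proof (cases "q \<in> dom_of c")
      case True
      show ?thesis
      proof (cases "c' \<in> A \<and> q \<in> dom_of c'")
        case c': True
        show ?thesis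
          using forms_transform[OF \<Phi>\<rho> chart _ True, of c' I] forms_transform[OF B_sum chart _ True, of c' I]
            c' by (simp add: in_chart[OF True])
      next
        case False
        then show ?thesis using forms_zero[OF B_sum] forms_zero[OF \<Phi>\<rho>] by metis
      qed
    next
      case False
      then have "\<phi> q = 0" using zero K(2) V(3) by blast
      then have "of_fun A \<phi> c' [] q = 0" "of_fun A (F a b) c' [] q = 0" for a b
        by (simp_all add: of_fun_def F_def)
      then show ?thesis
        by (simp add: sum_apply B_def wedge_function_left[OF F] wedge_function_left[OF \<Phi>])
    qed
  qed
  then have eq: "comm1 P x (wedge (of_fun A \<phi>) \<rho>) = (\<Sum>a\<in>UNIV. \<Sum>b\<in>UNIV. comm1 P x (B a b))"
    by (simp add: comm1_sum[OF x forms_sum[OF B]] comm1_sum[OF x B])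
  have pd_\<phi>: "pd c m (of_fun A \<phi> c []) p = 0" for m
  proof -
    have "pd c m (of_fun A \<phi> c []) p = pd c m (\<lambda>q. 1) p"
      by (rule C.pd_local[OF W(1,2) Wdom]) (use chart Wdom one in \<open>auto simp: of_fun_def\<close>)
    then show ?thesis by (simp add: C.pd_const)
  qed
  have lhs: "comm1 P x (wedge (of_fun A \<phi>) \<rho>) c [i, l] p = comm1 P x \<rho> c [i, l] p"
  proof -
    have "of_fun A \<phi> c [] p = 1"
      using one[OF W(2)] by (simp add: of_fun_chart[OF p])
    then show ?thesis
      by (simp add: comm1_derivation[OF x \<Phi> \<rho>] wedge_function_left[OF \<Phi>]
          wedge_function_left[OF comm1_forms[OF x \<Phi>]] comm1_function[OF x \<Phi> p] pd_\<phi>)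
  qed
  have pd_F: "pd c m (of_fun A (F a b) c []) p = 1 / 2 * pd c m (\<rho> c [a, b]) p" for m a b
  proof -
    have "pd c m (of_fun A (F a b) c []) p = pd c m (\<lambda>q. 1 / 2 * \<rho> c [a, b] q) p"
      by (rule C.pd_local[OF W(1,2) Wdom]) (use chart Wdom one in \<open>auto simp: of_fun_def F_def\<close>)
    also have "\<dots> = 1 / 2 * pd c m (\<rho> c [a, b]) p"
      by (simp only: C.pd_mult[OF C.smooth_const smooth_two_form[OF \<rho>] p] C.pd_const mult_zero_left add_0_right)
    finally show ?thesis .
  qed
  have F_p: "of_fun A (F a b) c [] p = 1 / 2 * \<rho> c [a, b] p" for a b
    using one[OF W(2)] by (simp add: of_fun_chart[OF p] F_def)
  define g where "g = (\<lambda>a n. \<Sum>q\<in>UNIV. ?v q p * \<Gamma> c a q n p)"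
  have xdX: "comm1 P x (ext_d (X a)) c [n] p = - g a n" for a n
    by (simp add: comm1_one_form[OF x dX1 p] ext_d_function_components along_def
        nab_coordinate_differential[OF V dX] sum_negf g_def)
  have rhs: "comm1 P x (B a b) c [i, l] p =
      (\<Sum>m\<in>UNIV. ?v m p * (1 / 2 * pd c m (\<rho> c [a, b]) p)) *
        ((if i = a then 1 else 0) * (if l = b then 1 else 0) - (if l = a then 1 else 0) * (if i = b then 1 else 0))
      + 1 / 2 * \<rho> c [a, b] p *
        ((- g a i * (if l = b then 1 else 0) + g a l * (if i = b then 1 else 0))
        + ((if i = a then 1 else 0) * - g b l + (if l = a then 1 else 0) * g b i))" for a b
    unfolding B_def comm1_derivation[OF x F dXdX] comm1_derivation[OF x dX1 dX1]
    by (simp add: wedge_function_left[OF F] wedge_function_left[OF comm1_forms[OF x F]]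
        comm1_function[OF x F p] pd_F F_p dX_wedge[OF V(2)] wedge_one_forms[OF comm1_forms[OF x dX1] dX1]
        wedge_one_forms[OF dX1 comm1_forms[OF x dX1]] xdX ext_d_function dX[OF V(2)])
  have pd_antisym: "pd c m (\<rho> c [l, i]) p = - pd c m (\<rho> c [i, l]) p" for m
  proof -
    have "\<rho> c [l, i] = (\<lambda>q. - \<rho> c [i, l] q)"
      by (rule ext) (rule \<rho>_antisym)
    then show ?thesis using C.pd_minus[OF smooth_two_form[OF \<rho>] p] by simp
  qed
  have outer_delta: "(\<Sum>a\<in>UNIV. \<Sum>b\<in>UNIV. if k = a then h a b else 0) = (\<Sum>b\<in>UNIV. h k b)"
    for h :: "'n \<Rightarrow> 'n \<Rightarrow> real" and k
    by (subst sum.swap) simp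
  have "comm1 P x \<rho> c [i, l] p = (\<Sum>a\<in>UNIV. \<Sum>b\<in>UNIV. comm1 P x (B a b) c [i, l] p)"
    unfolding lhs[symmetric] eq sum_apply ..
  also have "\<dots> = (\<Sum>m\<in>UNIV. ?v m p * (1 / 2 * pd c m (\<rho> c [i, l]) p))
      - (\<Sum>m\<in>UNIV. ?v m p * (1 / 2 * pd c m (\<rho> c [l, i]) p))
      + ((\<Sum>a\<in>UNIV. 1 / 2 * \<rho> c [a, i] p * g a l) - (\<Sum>a\<in>UNIV. 1 / 2 * \<rho> c [a, l] p * g a i)
      - (\<Sum>b\<in>UNIV. 1 / 2 * \<rho> c [i, b] p * g b l) + (\<Sum>b\<in>UNIV. 1 / 2 * \<rho> c [l, b] p * g b i))"
    unfolding rhs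
    by (simp add: distrib_left right_diff_distrib sum.distrib sum_subtractf sum_negf outer_delta
        if_distrib[of "\<lambda>x. x * _"] if_distrib[of "\<lambda>x. _ * x"] cong: if_cong)
  also have "\<dots> = (\<Sum>m\<in>UNIV. ?v m p * pd c m (\<rho> c [i, l]) p)
      - (\<Sum>a\<in>UNIV. \<rho> c [a, l] p * g a i) - (\<Sum>b\<in>UNIV. \<rho> c [i, b] p * g b l)"
    by (simp add: pd_antisym \<rho>_antisym[of i] \<rho>_antisym[of _ l] sum_negf sum_distrib_left[symmetric]
        sum_divide_distrib[symmetric])
  also have "\<dots> = along2 ?v (\<lambda>i l. \<rho> c [i, l]) i l p"
  proof -
    have g: "(\<Sum>a\<in>UNIV. h a * g a n) = (\<Sum>q\<in>UNIV. ?v q p * (\<Sum>a\<in>UNIV. \<Gamma> c a q n p * h a))" for h n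
      unfolding g_def sum_distrib_left by (subst sum.swap) (simp add: mult_ac)
    show ?thesis
      unfolding g along2_def nab2_def by (simp add: right_diff_distrib sum_subtractf)
  qed
  finally show ?thesis .
qed

text \<open>The bracket of \<open>dz\<close> with a one-form is not given by the axioms; it follows from
  \<open>d[z,\<tau>] = [dz,\<tau>] + [z,d\<tau>]\<close>.\<close>

lemma acomm1_components:
  assumes z: "z \<in> forms A 0" and \<tau>: "\<tau> \<in> forms A 1" and p: "p \<in> dom_of c"
  shows "acomm1 P (ext_d z) \<tau> c [i, l] p =
    C.ext_deriv1 (along (ham (z c [])) (\<lambda>l. \<tau> c [l])) i l p
    - along2 (ham (z c [])) (C.ext_deriv1 (\<lambda>l. \<tau> c [l])) i l p"
proof -
  have d: "(\<lambda>i l. ext_d \<tau> c [i, l]) = C.ext_deriv1 (\<lambda>l. \<tau> c [l])"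
    by (intro ext) (simp add: ext_d_one_form C.ext_deriv1_def)
  have d\<tau>: "ext_d \<tau> \<in> forms A 2"
    using ext_d_forms[OF \<tau>] by (simp add: numeral_2_eq_2)
  have "pd c i (comm1 P z \<tau> c [l]) p = pd c i (along (ham (z c [])) (\<lambda>l. \<tau> c [l]) l) p" for i l
    by (rule C.pd_cong) (rule comm1_one_form[OF z \<tau>])
  then have "ext_d (comm1 P z \<tau>) c [i, l] p = C.ext_deriv1 (along (ham (z c [])) (\<lambda>l. \<tau> c [l])) i l p"
    by (simp add: ext_d_one_form C.ext_deriv1_def)
  moreover have "ext_d (comm1 P z \<tau>) c [i, l] p =
      acomm1 P (ext_d z) \<tau> c [i, l] p + comm1 P z (ext_d \<tau>) c [i, l] p"
    using ext_d_comm1_one_form[OF z \<tau>] by simp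
  ultimately show ?thesis
    by (simp add: comm1_two_form[OF z d\<tau> p] d)
qed

lemma acomm1_commute: "acomm1 P \<alpha> \<beta> = acomm1 P \<beta> \<alpha>"
  by (simp add: acomm1_def add.commute)

lemma acomm1_differentials:
  assumes y: "y \<in> forms A 0" and z: "z \<in> forms A 0" and p: "p \<in> dom_of c"
  shows "acomm1 P (ext_d y) (ext_d z) c [i, l] p =
    - Q_form (C.differential (y c [])) (C.differential (z c [])) i l p
    - S_form (C.differential (y c [])) (C.differential (z c [])) i l p"
  unfolding acomm1_components[OF y ext_d_forms_1[OF z] p] ext_d_function_components
  by (rule ext_deriv1_along_ham[OF smooth_function[OF y] compatible[OF y]
        C.smooth_differential[OF smooth_function[OF z]] p])

text \<open>The bracket of two exact one-forms is symmetric, and so is its part \<open>Q_form\<close>. The remaining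
  part, evaluated on coordinate differentials, is \<open>S_tensor\<close>.\<close>

lemma S_tensor_sym:
  assumes p: "p \<in> dom_of c"
  shows "S_tensor j k i l p = S_tensor k j i l p"
proof -
  obtain X V where X: "\<And>i. X i \<in> forms A 0" and V: "p \<in> V"
    and dX: "\<And>q k i. q \<in> V \<Longrightarrow> pd c k (X i c []) q = (if k = i then 1 else 0)"
    using coordinate_functions[OF p] by metis
  have S: "S_form (C.differential (X j c [])) (C.differential (X k c [])) i l p = S_tensor j k i l p" for j k
    by (simp add: S_form_def C.differential_def dX[OF V] if_distrib[of "\<lambda>x. x * _"]
        if_distrib[of "\<lambda>x. _ * x"] cong: if_cong)
  show ?thesis
    using acomm1_differentials[OF X X p, of j k i l] acomm1_differentials[OF X X p, of k j i l]
      acomm1_commute[of "ext_d (X j)"] Q_form_sym[OF p, of _ "C.differential (X j c [])"]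
    by (simp add: S)
qed

lemma J2_components:
  assumes E: "E_covariantly_constant A \<omega> \<Gamma>"
    and x: "x \<in> forms A 0" and y: "y \<in> forms A 0" and z: "z \<in> forms A 0" and p: "p \<in> dom_of c"
  shows "J2 P x y z c [i, l] p = 0"
proof -
  let ?x = "x c []" and ?y = "y c []" and ?z = "z c []"
  note dy = ext_d_forms_1[OF y] and dz = ext_d_forms_1[OF z]
  have along_comm: "C.ext_deriv1 (along v (\<lambda>l. comm1 P x (ext_d f) c [l])) i l p =
        C.ext_deriv1 (along v (along (ham ?x) (C.differential (f c [])))) i l p"
    "along2 v (C.ext_deriv1 (\<lambda>l. comm1 P x (ext_d f) c [l])) i l p =
        along2 v (C.ext_deriv1 (along (ham ?x) (C.differential (f c [])))) i l p"
    if f: "f \<in> forms A 0" for v f i l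
  proof -
    have eq: "comm1 P x (ext_d f) c [l] q = along (ham ?x) (C.differential (f c [])) l q"
      if "q \<in> dom_of c" for q l
      using comm1_one_form[OF x ext_d_forms_1[OF f] that] by (simp add: ext_d_function_components)
    have pd1: "pd c m (comm1 P x (ext_d f) c [l]) q = pd c m (along (ham ?x) (C.differential (f c [])) l) q" for m l q
      by (rule C.pd_cong) (rule eq)
    have "along v (\<lambda>l. comm1 P x (ext_d f) c [l]) l q = along v (along (ham ?x) (C.differential (f c []))) l q"
      if "q \<in> dom_of c" for l q
      by (simp add: along_def nab_def pd1 eq[OF that])
    then have "pd c m (along v (\<lambda>l. comm1 P x (ext_d f) c [l]) l) p =
        pd c m (along v (along (ham ?x) (C.differential (f c []))) l) p" for m l
      by (rule C.pd_cong)
    then show "C.ext_deriv1 (along v (\<lambda>l. comm1 P x (ext_d f) c [l])) i l p =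
        C.ext_deriv1 (along v (along (ham ?x) (C.differential (f c [])))) i l p"
      by (simp add: C.ext_deriv1_def)
    have "C.ext_deriv1 (\<lambda>l. comm1 P x (ext_d f) c [l]) = C.ext_deriv1 (along (ham ?x) (C.differential (f c [])))"
      by (intro ext) (simp add: C.ext_deriv1_def pd1)
    then show "along2 v (C.ext_deriv1 (\<lambda>l. comm1 P x (ext_d f) c [l])) i l p =
        along2 v (C.ext_deriv1 (along (ham ?x) (C.differential (f c [])))) i l p"
      by simp
  qed
  have dydz: "comm1 P x (acomm1 P (ext_d y) (ext_d z)) c [i, l] p =
      along2 (ham ?x) (C.ext_deriv1 (along (ham ?y) (C.differential ?z))) i l p"
  proof -
    have eq: "acomm1 P (ext_d y) (ext_d z) c [i, l] q = C.ext_deriv1 (along (ham ?y) (C.differential ?z)) i l q"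
      if "q \<in> dom_of c" for i l q
      unfolding acomm1_components[OF y dz that] ext_d_function_components
      by (simp add: along2_ext_deriv1_differential[OF smooth_function[OF z] that])
    have "pd c m (acomm1 P (ext_d y) (ext_d z) c [i, l]) p =
        pd c m (C.ext_deriv1 (along (ham ?y) (C.differential ?z)) i l) p" for m i l
      by (rule C.pd_cong) (rule eq)
    then show ?thesis
      unfolding comm1_two_form[OF x acomm1_forms[OF dy dz] p] by (simp add: along2_def nab2_def eq[OF p])
  qed
  have E': "cov_deriv \<Gamma> c m (\<lambda>U L. E_tensor \<omega> \<Gamma> c (U ! 0) (U ! 1) (L ! 0) (L ! 1)) [n, k] [l, i] q = 0"
    if "q \<in> dom_of c" for m n k l i q
    using E chart that by (simp add: E_covariantly_constant_def)
  have "J2 P x y z c [i, l] p =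
    along2 (ham ?x) (C.ext_deriv1 (along (ham ?y) (C.differential ?z))) i l p
    - (C.ext_deriv1 (along (ham ?z) (along (ham ?x) (C.differential ?y))) i l p
       - along2 (ham ?z) (C.ext_deriv1 (along (ham ?x) (C.differential ?y))) i l p)
    - (C.ext_deriv1 (along (ham ?y) (along (ham ?x) (C.differential ?z))) i l p
       - along2 (ham ?y) (C.ext_deriv1 (along (ham ?x) (C.differential ?z))) i l p)"
    unfolding J2_eq[OF x y z] minus_apply dydz acomm1_components[OF z comm1_forms[OF x dy] p]
      acomm1_components[OF y comm1_forms[OF x dz] p] along_comm[OF y] along_comm[OF z] ..
  also have "\<dots> = 0"
    by (rule jacobi_expression_zero[OF smooth_function[OF x] smooth_function[OF y] smooth_function[OF z]
          compatible[OF y] compatible[OF z] hamiltonian_field_poisson[OF x] S_tensor_sym E' p])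
  finally show ?thesis .
qed

end


theorem proposition3p6:
  fixes A :: "('m::{t2_space,second_countable_topology}, 'n::finite) chart set"
    and P :: "('m, 'n) prod_coeffs"
    and D :: "('m, 'n) diff_coeffs"
    and \<omega> :: "('m, 'n) bivector"
    and \<Gamma> :: "('m, 'n) christoffel"
  assumes "smooth_atlas A"
    and "formal_deformation A P D"
    and "poisson_components A P \<omega>"
    and "nondegenerate A \<omega>"
    and "associated_connection A P \<omega> \<Gamma>"
    and "flat A \<Gamma>"
    and "E_covariantly_constant A \<omega> \<Gamma>"
  shows "\<forall>x\<in>forms A 0. \<forall>y\<in>forms A 0. \<forall>z\<in>forms A 0. J2 P x y z = 0"
proof (intro ballI)
  fix x y z assume xyz: "x \<in> forms A 0" "y \<in> forms A 0" "z \<in> forms A 0"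
  interpret manifold_deformation A P D
    using assms(1,2) by (simp add: manifold_deformation_def manifold_deformation_axioms_def)
  show "J2 P x y z = 0"
  proof (intro ext)
    fix c I p
    show "J2 P x y z c I p = 0 c I p"
    proof (cases "c \<in> A \<and> p \<in> dom_of c \<and> length I = 2")
      case True
      then obtain i l where I: "I = [i, l]"
        by (metis (no_types, lifting) One_nat_def Suc_1 length_0_conv length_Suc_conv)
      interpret deformation_chart A P D c \<omega> \<Gamma>
        by unfold_locales (use True assms(3,5,6) in auto)
      show ?thesis
        using J2_components[OF assms(7) xyz, of p i l] True by (simp add: I)
    next
      case False
      then show ?thesis
        using forms_zero[OF J2_forms[OF xyz]] by auto
    qed
  qed
qed

end
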